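(* Consider the Sturm–Liouville system $\mathcal A\xi=-\frac{d}{dt}(P\dot \xi+Q\xi)+Q^T\dot \xi+R\xi=0$ on a time interval $[a,b]$, let $[c,d]\subset[a,b]$, and let $\Lambda_0$ be a Lagrangian subspace of $(\mathbf C^{2n}\oplus\mathbf C^{2n},-\omega\oplus\omega)$. Then $$m^-_{[a,b]}(\Lambda_0)\ \ge\ m^-_{[c,d]}(\Lambda_0)+m^-_{[a,c]}(\Lambda_D)+m^-_{[d,b]}(\Lambda_D)-\nu(\Lambda_0),$$ where $\nu(\Lambda_0)=\dim\big((\Lambda_0+\Lambda_D)\cap\Lambda_N\big)$.
   Context: **System.** $P,Q,R:[a,b]\to\mathbf R^{n\times n}$ are continuous, $P(t)$ is symmetric positive definite and $R(t)$ is symmetric (they arise as $P=\frac{\partial^2L}{\partial\dot x^2}$, $Q=\frac{\partial^2L}{\partial x\partial\dot x}$, $R=\frac{\partial^2L}{\partial x^2}$ along a stationary point of a $C^2$ Lagrangian $L(t,x,\dot x)$ satisfying the Legendre convexity condition). **Symplectic notation.** $\langle\cdot,\cdot\rangle$ is the standard Hermitian inner product, $J=\begin{bmatrix}0&-I_n\\ I_n&0\end{bmatrix}$, $\omega(u,v)=\langle Ju,v\rangle$ on $\mathbf C^{2n}$. A complex subspace is Lagrangian if the symplectic form vanishes on it and it has half the dimension. **Morse index on a subinterval.** For a function $\xi$ put $y=P\dot\xi+Q\xi$, $z=(y,\xi)^T$. For a nondegenerate subinterval $[s,r]\subset[a,b]$ and a Lagrangian subspace $\Lambda$ of $(\mathbf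 C^{2n}\oplus\mathbf C^{2n},-\omega\oplus\omega)$, $\mathcal A$ is self-adjoint on $L^2([s,r],\mathbf C^n)$ with domain $E_\Lambda(s,r)=\{\xi\in W^{1,2}([s,r],\mathbf C^n):P\dot\xi+Q\xi\in W^{1,2},\ (z(s),z(r))\in\Lambda\}$, and $m^-_{[s,r]}(\Lambda)$ is its number of negative eigenvalues counted with multiplicity. For degenerate intervals ($a=c$ or $d=b$) the corresponding Dirichlet index is $0$. $\Lambda^n_D=\mathbf C^n\oplus\{0\}$, $\Lambda^n_N=\{0\}\oplus\mathbf C^n$, $\Lambda_D=\Lambda_D^n\oplus\Lambda_D^n$ (Dirichlet: $\xi$ vanishes at both ends), $\Lambda_N=\Lambda_N^n\oplus\Lambda_N^n$ (Neumann: $y$ vanishes at both ends). *)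

theory Defs
  imports "HOL-Analysis.Analysis" "HOL-Library.Function_Algebras"
begin

section \<open>Symplectic linear algebra\<close>

text \<open>
  The space \<open>\<complex>\<^sup>m\<close> is \<open>complex ^ 'm\<close> with complex scalar multiplication \<open>*s\<close>, so complex subspaces and
  complex dimension are \<open>vec.subspace\<close> and \<open>vec.dim\<close>. Direct sums are indexed by sum types: \<open>\<complex>\<^sup>2\<^sup>n\<close> is
  \<open>complex ^ ('n + 'n)\<close>, and \<open>\<complex>\<^sup>2\<^sup>n \<oplus> \<complex>\<^sup>2\<^sup>n\<close> is \<open>complex ^ (('n + 'n) + ('n + 'n))\<close>.
\<close>

definition vjoin :: "'a ^ 'k \<Rightarrow> 'a ^ 'm \<Rightarrow> 'a ^ ('k::finite + 'm::finite)" where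
  "vjoin x y = (\<chi> i. case i of Inl j \<Rightarrow> x $ j | Inr j \<Rightarrow> y $ j)"

definition vleft :: "'a ^ ('k::finite + 'm::finite) \<Rightarrow> 'a ^ 'k" where
  "vleft u = (\<chi> j. u $ Inl j)"

definition vright :: "'a ^ ('k::finite + 'm::finite) \<Rightarrow> 'a ^ 'm" where
  "vright u = (\<chi> j. u $ Inr j)"

definition dsum :: "('a ^ 'k) set \<Rightarrow> ('a ^ 'm) set \<Rightarrow> ('a ^ ('k::finite + 'm::finite)) set" where
  "dsum A B = {vjoin x y |x y. x \<in> A \<and> y \<in> B}"

text \<open>The inner product of type class \<open>real_inner\<close> on \<open>complex ^ 'm\<close> is only the real part of this one.\<close>

definition hinner :: "complex ^ 'm \<Rightarrow> complex ^ 'm \<Rightarrow> complex" where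
  "hinner u v = (\<Sum>i\<in>UNIV. u $ i * cnj (v $ i))"

definition J_mat :: "complex ^ ('n::finite + 'n) ^ ('n + 'n)" where
  "J_mat = (\<chi> i j. case (i, j) of
      (Inl k, Inr l) \<Rightarrow> if k = l then - 1 else 0
    | (Inr k, Inl l) \<Rightarrow> if k = l then 1 else 0
    | _ \<Rightarrow> 0)"

definition omega :: "complex ^ ('n::finite + 'n) \<Rightarrow> complex ^ ('n + 'n) \<Rightarrow> complex" where
  "omega u v = hinner (J_mat *v u) v"

text \<open>The form \<open>-\<omega> \<oplus> \<omega>\<close>.\<close>

definition omega2 ::
  "complex ^ (('n::finite + 'n) + ('n + 'n)) \<Rightarrow> complex ^ (('n + 'n) + ('n + 'n)) \<Rightarrow> complex" where
  "omega2 u v = - omega (vleft u) (vleft v) + omega (vright u) (vright v)"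

definition lagrangian :: "(complex ^ (('n::finite + 'n) + ('n + 'n))) set \<Rightarrow> bool" where
  "lagrangian \<Lambda> \<longleftrightarrow> vec.subspace \<Lambda> \<and> (\<forall>u\<in>\<Lambda>. \<forall>v\<in>\<Lambda>. omega2 u v = 0) \<and>
     2 * vec.dim \<Lambda> = vec.dim (UNIV :: (complex ^ (('n + 'n) + ('n + 'n))) set)"

definition Dirichlet_n :: "(complex ^ ('n::finite + 'n)) set" where
  "Dirichlet_n = dsum UNIV {0}"

definition Neumann_n :: "(complex ^ ('n::finite + 'n)) set" where
  "Neumann_n = dsum {0} UNIV"

definition Lambda_D :: "(complex ^ (('n::finite + 'n) + ('n + 'n))) set" where
  "Lambda_D = dsum Dirichlet_n Dirichlet_n"

definition Lambda_N :: "(complex ^ (('n::finite + 'n) + ('n + 'n))) set" where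
  "Lambda_N = dsum Neumann_n Neumann_n"

text \<open>The sum of subspaces is the elementwise sum of two sets, from \<open>HOL-Library.Set_Algebras\<close>.\<close>

definition nu :: "(complex ^ (('n::finite + 'n) + ('n + 'n))) set \<Rightarrow> nat" where
  "nu \<Lambda> = vec.dim ((\<Lambda> + Lambda_D) \<inter> Lambda_N)"

section \<open>Sobolev functions on an interval\<close>

definition L2 :: "real \<Rightarrow> real \<Rightarrow> (real \<Rightarrow> complex ^ 'n) set" where
  "L2 s r = {f. f \<in> borel_measurable (lebesgue_on {s..r}) \<and>
                integrable (lebesgue_on {s..r}) (\<lambda>t. (norm (f t))\<^sup>2)}"

definition has_weak_deriv ::
  "real \<Rightarrow> real \<Rightarrow> (real \<Rightarrow> complex ^ 'n) \<Rightarrow> (real \<Rightarrow> complex ^ 'n) \<Rightarrow> bool" where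
  "has_weak_deriv s r \<xi> g \<longleftrightarrow>
     g \<in> L2 s r \<and> (\<forall>t\<in>{s..r}. \<xi> t = \<xi> s + (LINT u:{s..t}|lebesgue. g u))"

text \<open>
  An element of \<open>W\<^sup>1\<^sup>,\<^sup>2([s, r], \<complex>\<^sup>n)\<close> is represented by its absolutely continuous representative on
  \<open>[s, r]\<close>, extended by zero to the whole line. This makes the representative unique, so point values
  are meaningful and linear algebra on these functions agrees with that on classes modulo null sets.
\<close>

definition W12 :: "real \<Rightarrow> real \<Rightarrow> (real \<Rightarrow> complex ^ 'n) set" where
  "W12 s r = {\<xi>. (\<forall>t. t \<notin> {s..r} \<longrightarrow> \<xi> t = 0) \<and> (\<exists>g. has_weak_deriv s r \<xi> g)}"

text \<open>Determined only up to a null set; every use below is invariant under such changes.\<close>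

definition weak_deriv ::
  "real \<Rightarrow> real \<Rightarrow> (real \<Rightarrow> complex ^ 'n) \<Rightarrow> (real \<Rightarrow> complex ^ 'n)" where
  "weak_deriv s r \<xi> = (SOME g. has_weak_deriv s r \<xi> g)"

section \<open>The Sturm--Liouville operator and its Morse index\<close>

definition cmat :: "real ^ 'n ^ 'm \<Rightarrow> complex ^ 'n ^ 'm" where
  "cmat = map_matrix complex_of_real"

text \<open>\<open>is_momentum P Q s r \<xi> y\<close>: the class of \<open>P \<xi>' + Q \<xi>\<close> lies in \<open>W\<^sup>1\<^sup>,\<^sup>2\<close>, with continuous representative \<open>y\<close>.\<close>

definition is_momentum ::
  "(real \<Rightarrow> real ^ 'n ^ 'n) \<Rightarrow> (real \<Rightarrow> real ^ 'n ^ 'n) \<Rightarrow> real \<Rightarrow> real \<Rightarrow>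
   (real \<Rightarrow> complex ^ 'n) \<Rightarrow> (real \<Rightarrow> complex ^ 'n) \<Rightarrow> bool" where
  "is_momentum P Q s r \<xi> y \<longleftrightarrow> y \<in> W12 s r \<and>
     (AE t in lebesgue_on {s..r}. y t = cmat (P t) *v weak_deriv s r \<xi> t + cmat (Q t) *v \<xi> t)"

definition momentum ::
  "(real \<Rightarrow> real ^ 'n ^ 'n) \<Rightarrow> (real \<Rightarrow> real ^ 'n ^ 'n) \<Rightarrow> real \<Rightarrow> real \<Rightarrow>
   (real \<Rightarrow> complex ^ 'n) \<Rightarrow> (real \<Rightarrow> complex ^ 'n)" where
  "momentum P Q s r \<xi> = (SOME y. is_momentum P Q s r \<xi> y)"

definition phase_curve ::
  "(real \<Rightarrow> real ^ 'n ^ 'n) \<Rightarrow> (real \<Rightarrow> real ^ 'n ^ 'n) \<Rightarrow> real \<Rightarrow> real \<Rightarrow>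
   (real \<Rightarrow> complex ^ 'n) \<Rightarrow> real \<Rightarrow> complex ^ ('n + 'n)" where
  "phase_curve P Q s r \<xi> t = vjoin (momentum P Q s r \<xi> t) (\<xi> t)"

definition SL_domain ::
  "(real \<Rightarrow> real ^ 'n ^ 'n) \<Rightarrow> (real \<Rightarrow> real ^ 'n ^ 'n) \<Rightarrow> real \<Rightarrow> real \<Rightarrow>
   (complex ^ (('n + 'n) + ('n + 'n))) set \<Rightarrow> (real \<Rightarrow> complex ^ 'n) set" where
  "SL_domain P Q s r \<Lambda> = {\<xi> \<in> W12 s r. (\<exists>y. is_momentum P Q s r \<xi> y) \<and>
     vjoin (phase_curve P Q s r \<xi> s) (phase_curve P Q s r \<xi> r) \<in> \<Lambda>}"

definition SL_op ::
  "(real \<Rightarrow> real ^ 'n ^ 'n) \<Rightarrow> (real \<Rightarrow> real ^ 'n ^ 'n) \<Rightarrow> (real \<Rightarrow> real ^ 'n ^ 'n) \<Rightarrow>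
   real \<Rightarrow> real \<Rightarrow> (real \<Rightarrow> complex ^ 'n) \<Rightarrow> (real \<Rightarrow> complex ^ 'n)" where
  "SL_op P Q R s r \<xi> = (\<lambda>t. - weak_deriv s r (momentum P Q s r \<xi>) t
     + transpose (cmat (Q t)) *v weak_deriv s r \<xi> t + cmat (R t) *v \<xi> t)"

definition SL_eigenspace ::
  "(real \<Rightarrow> real ^ 'n ^ 'n) \<Rightarrow> (real \<Rightarrow> real ^ 'n ^ 'n) \<Rightarrow> (real \<Rightarrow> real ^ 'n ^ 'n) \<Rightarrow>
   real \<Rightarrow> real \<Rightarrow> (complex ^ (('n + 'n) + ('n + 'n))) set \<Rightarrow> real \<Rightarrow> (real \<Rightarrow> complex ^ 'n) set" where
  "SL_eigenspace P Q R s r \<Lambda> \<mu> = {\<xi> \<in> SL_domain P Q s r \<Lambda>.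
     AE t in lebesgue_on {s..r}. SL_op P Q R s r \<xi> t = complex_of_real \<mu> *s \<xi> t}"

definition SL_eigenvalue ::
  "(real \<Rightarrow> real ^ 'n ^ 'n) \<Rightarrow> (real \<Rightarrow> real ^ 'n ^ 'n) \<Rightarrow> (real \<Rightarrow> real ^ 'n ^ 'n) \<Rightarrow>
   real \<Rightarrow> real \<Rightarrow> (complex ^ (('n + 'n) + ('n + 'n))) set \<Rightarrow> real \<Rightarrow> bool" where
  "SL_eigenvalue P Q R s r \<Lambda> \<mu> \<longleftrightarrow> (\<exists>\<xi>\<in>SL_eigenspace P Q R s r \<Lambda> \<mu>. \<xi> \<noteq> 0)"

text \<open>Vector-valued functions on the line as a complex vector space; \<open>cfun.dim\<close> is the complex dimension.\<close>

global_interpretation cfun: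
  vector_space "\<lambda>(c :: complex) (f :: real \<Rightarrow> complex ^ 'n) t. c *s f t"
  by unfold_locales (auto simp: fun_eq_iff vec_eq_iff algebra_simps)

text \<open>
  Eigenvalues of the self-adjoint operator are real, so it suffices to let \<open>\<mu>\<close> range over the reals.
  Eigenspaces have dimension at most \<open>2n\<close>, being contained in the solution space of a linear
  first-order system in \<open>\<complex>\<^sup>2\<^sup>n\<close>, so \<open>cfun.dim\<close> is the true dimension. The count takes values in \<open>enat\<close>,
  where the unordered sum of any family exists: an infinite count would be \<open>\<infinity>\<close>, not a junk value.
  The index of a degenerate interval is \<open>0\<close> by convention.
\<close>

definition morse_index ::
  "(real \<Rightarrow> real ^ 'n ^ 'n) \<Rightarrow> (real \<Rightarrow> real ^ 'n ^ 'n) \<Rightarrow> (real \<Rightarrow> real ^ 'n ^ 'n) \<Rightarrow>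
   real \<Rightarrow> real \<Rightarrow> (complex ^ (('n + 'n) + ('n + 'n))) set \<Rightarrow> enat" where
  "morse_index P Q R s r \<Lambda> = (if s < r
     then \<Sum>\<^sub>\<infinity>\<mu>\<in>{\<mu>. \<mu> < 0 \<and> SL_eigenvalue P Q R s r \<Lambda> \<mu>}. enat (cfun.dim (SL_eigenspace P Q R s r \<Lambda> \<mu>))
     else 0)"

end

theory Submission
  imports Defs "HOL-Complex_Analysis.Great_Picard"
begin

text \<open>
  Let \<open>V\<close> be the space of endpoint values \<open>(\<xi>(s), \<xi>(r))\<close> allowed by \<open>\<Lambda>\<^sub>0\<close>; its dimension is \<open>\<nu>(\<Lambda>\<^sub>0)\<close>.
  A linear combination of eigenfunctions for negative eigenvalues on \<open>[c, d]\<close>, \<open>[a, c]\<close> and \<open>[d, b]\<close> whose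
  \<open>[c, d]\<close>-part vanishes at \<open>c\<close> and \<open>d\<close>, which costs at most \<open>\<nu>(\<Lambda>\<^sub>0)\<close> linear conditions, can be extended by
  zero and added up to a function on \<open>[a, b]\<close> that vanishes at both ends. There the index form is negative:
  by Green's formula and the orthogonality of different eigenspaces it is \<open>\<Sum> \<mu> \<parallel>w\<^sub>\<mu>\<parallel>\<^sup>2\<close> on each piece.

  Conversely, negative eigenfunctions on \<open>[a, b]\<close> are found one after the other. As long as some function of
  negative index form is orthogonal to those already found, the form has a minimiser on the unit sphere of
  their orthogonal complement: a minimising sequence converges uniformly (Arzela--Ascoli), its derivatives
  converge in \<open>L\<^sup>2\<close> by the parallelogram law, and the du Bois-Reymond lemma shows that the limit satisfies the
  differential equation and the boundary condition.

  The analysis uses the real inner product only; complex scalars matter for counting dimensions.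
\<close>

section \<open>Linear algebra of Lagrangian subspaces\<close>

text \<open>The index counts eigenvalues, so a lower bound on \<open>[a, b]\<close> cannot simply be
  read off from a large space on which the form is negative: true eigenfunctions of the Lagrangian
  problem have to be produced there, with multiplicity. On the subintervals they are given, and only
  finite combinations of them are used. The two sides meet in trial functions vanishing at
  \<open>a\<close> and \<open>b\<close>, where the boundary term of the form is zero, whatever the
  boundary condition.

  The boundary condition reaches the analysis as an essential part, endpoint positions in
  \<open>V\<close>, and a symmetric form \<open>beta\<close> on \<open>V\<close>; the natural
  condition on the momenta is recovered from the minimiser. For the count,
  \<open>k1 + k2 + k3\<close> coefficients face \<open>nu\<close> conditions at \<open>c\<close> and
  \<open>d\<close> and one for each eigenfunction already found, so elimination succeeds while fewer
  than \<open>k1 + k2 + k3 - nu\<close> are known. Strict negativity holds because zero energy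
  forces all coefficients to vanish. As minimisation takes place in real spaces, complex
  orthogonality to a function is imposed as real orthogonality to it and to its multiple by
  \<open>\<i>\<close>.\<close>

lemma nontrivial_kernel:
  fixes A :: "'b \<Rightarrow> 'i \<Rightarrow> 'f::field"
  assumes "finite I" "finite B" "card I < card B"
  shows "\<exists>c. (\<exists>b\<in>B. c b \<noteq> 0) \<and> (\<forall>i\<in>I. (\<Sum>b\<in>B. c b * A b i) = 0)"
  using assms
proof (induction I arbitrary: B A rule: finite_induct)
  case empty
  then have "B \<noteq> {}" by auto
  then show ?case by (intro exI[of _ "\<lambda>_. 1"]) auto
next
  case (insert i I)
  show ?case
  proof (cases "\<forall>b\<in>B. A b i = 0")
    case True
    have "card I < card B" using insert by simp
    from insert.IH[OF \<open>finite B\<close> this, of A] obtain c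
      where "\<exists>b\<in>B. c b \<noteq> 0" "\<forall>i\<in>I. (\<Sum>b\<in>B. c b * A b i) = 0" by blast
    with True show ?thesis by (intro exI[of _ c]) auto
  next
    case False
    then obtain b0 where b0: "b0 \<in> B" "A b0 i \<noteq> 0" by blast
    let ?B = "B - {b0}"
    have "card I < card ?B" using insert b0 by simp
    moreover have "finite ?B" using insert by simp
    \<comment> \<open>Equation \<open>i\<close> is solved for the unknown at the pivot
      \<open>b0\<close>; substitution into the other equations gives these reduced
      coefficients.\<close>
    ultimately obtain c where c: "\<exists>b\<in>?B. c b \<noteq> 0"
      "\<forall>j\<in>I. (\<Sum>b\<in>?B. c b * (A b j - A b i / A b0 i * A b0 j)) = 0"
      using insert.IH[of ?B "\<lambda>b j. A b j - A b i / A b0 i * A b0 j"] by blast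
    define S where "S = (\<Sum>b\<in>?B. c b * A b i)"
    define d where "d = (\<lambda>b. if b = b0 then - S / A b0 i else c b)"
    have sum_d: "(\<Sum>b\<in>B. d b * A b j) = - S / A b0 i * A b0 j + (\<Sum>b\<in>?B. c b * A b j)" for j
    proof -
      have "(\<Sum>b\<in>B. d b * A b j) = d b0 * A b0 j + (\<Sum>b\<in>?B. d b * A b j)"
        using b0 insert by (simp add: sum.remove)
      also have "(\<Sum>b\<in>?B. d b * A b j) = (\<Sum>b\<in>?B. c b * A b j)"
        by (intro sum.cong) (auto simp: d_def)
      finally show ?thesis by (simp add: d_def)
    qed
    have "(\<Sum>b\<in>B. d b * A b j) = 0" if "j \<in> insert i I" for j
    proof (cases "j = i")
      case True
      then show ?thesis using b0 by (simp add: sum_d S_def)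
    next
      case False
      with that have "j \<in> I" by simp
      have "(\<Sum>b\<in>?B. c b * (A b j - A b i / A b0 i * A b0 j)) =
          (\<Sum>b\<in>?B. c b * A b j) - S / A b0 i * A b0 j"
        by (simp add: S_def sum_subtractf right_diff_distrib sum_divide_distrib sum_distrib_right
            flip: times_divide_eq_left mult.assoc)
      with c(2) \<open>j \<in> I\<close> show ?thesis by (simp add: sum_d)
    qed
    moreover have "\<exists>b\<in>B. d b \<noteq> 0" using c(1) by (auto simp: d_def)
    ultimately show ?thesis by blast
  qed
qed

text \<open>A linear condition with values in \<open>S\<close> costs only \<open>vec.dim S\<close>
  scalar conditions, its coordinates in a basis of \<open>S\<close>. In this way the endpoint
  conditions cost \<open>nu\<close> and not the dimension of the ambient space.\<close>

lemma nontrivial_kernel_vec: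
  fixes v :: "'b \<Rightarrow> complex ^ 'k" and A :: "'b \<Rightarrow> 'i \<Rightarrow> complex"
  assumes "finite I" "finite B" "vec.dim S + card I < card B" and v: "\<And>b. b \<in> B \<Longrightarrow> v b \<in> S"
  shows "\<exists>c. (\<exists>b\<in>B. c b \<noteq> 0) \<and> (\<Sum>b\<in>B. c b *s v b) = 0 \<and> (\<forall>i\<in>I. (\<Sum>b\<in>B. c b * A b i) = 0)"
proof -
  obtain E where E: "E \<subseteq> S" "vec.independent E" "S \<subseteq> vec.span E" "card E = vec.dim S"
    using vec.basis_exists .
  have finE: "finite E" using E(2) vec.finiteI_independent by blast
  have "\<exists>r. v b = (\<Sum>e\<in>E. r e *s e)" if "b \<in> B" for b
    using v[OF that] E(3) vec.span_finite[OF finE] by auto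
  then obtain r where r: "\<And>b. b \<in> B \<Longrightarrow> v b = (\<Sum>e\<in>E. r b e *s e)" by metis
  have "card (E <+> I) < card B" "finite (E <+> I)" using assms finE E(4) by (simp_all add: card_Plus)
  from nontrivial_kernel[OF this(2) \<open>finite B\<close> this(1), of "\<lambda>b. case_sum (r b) (A b)"]
  obtain c where c: "\<exists>b\<in>B. c b \<noteq> 0"
    "\<forall>i\<in>E <+> I. (\<Sum>b\<in>B. c b * case_sum (r b) (A b) i) = 0" by blast
  have "(\<Sum>b\<in>B. c b *s v b) = (\<Sum>b\<in>B. \<Sum>e\<in>E. (c b * r b e) *s e)"
    by (intro sum.cong) (simp_all add: r vec.scale_sum_right)
  also have "\<dots> = (\<Sum>e\<in>E. (\<Sum>b\<in>B. c b * r b e) *s e)"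
    by (subst sum.swap) (simp add: vec.scale_sum_left)
  also have "\<dots> = 0"
  proof (rule sum.neutral, intro ballI)
    fix e assume "e \<in> E"
    with c(2)[rule_format, of "Inl e"] show "(\<Sum>b\<in>B. c b * r b e) *s e = 0" by auto
  qed
  finally have "(\<Sum>b\<in>B. c b *s v b) = 0" .
  moreover have "(\<Sum>b\<in>B. c b * A b i) = 0" if "i \<in> I" for i
    using c(2)[rule_format, of "Inr i"] that by auto
  ultimately show ?thesis using c(1) by blast
qed

section \<open>Coordinates for direct sums and endpoint data\<close>

lemma vleft_vjoin [simp]: "vleft (vjoin x y) = x"
  and vright_vjoin [simp]: "vright (vjoin x y) = y"
  by (simp_all add: vleft_def vright_def vjoin_def vec_eq_iff)

lemma vjoin_vleft_vright [simp]: "vjoin (vleft z) (vright z) = z"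
  by (auto simp: vleft_def vright_def vjoin_def vec_eq_iff split: sum.split)

lemma vjoin_add: "vjoin x y + vjoin x' y' = vjoin (x + x') (y + y')"
  and vjoin_scale: "c *s vjoin u v = vjoin (c *s u) (c *s v)"
  and vjoin_zero: "vjoin 0 0 = 0"
  by (auto simp: vjoin_def vec_eq_iff split: sum.split)

lemma vleft_linear [simp]: "vleft (x + y) = vleft x + vleft y" "vleft (r *\<^sub>R z) = r *\<^sub>R vleft z"
    "vleft (c *s w) = c *s vleft w" "vleft (- z) = - vleft z"
  and vright_linear [simp]: "vright (x' + y') = vright x' + vright y'" "vright (r *\<^sub>R z') = r *\<^sub>R vright z'"
    "vright (c *s w') = c *s vright w'" "vright (- z') = - vright z'"
  by (simp_all add: vleft_def vright_def vec_eq_iff)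

lemma vjoin_eq_iff [simp]: "vjoin x y = vjoin x' y' \<longleftrightarrow> x = x' \<and> y = y'"
  by (metis vleft_vjoin vright_vjoin)

lemma Re_hinner: "Re (hinner u v) = u \<bullet> v"
  by (simp add: hinner_def inner_vec_def inner_complex_def)

lemma hinner_simps:
  "hinner (u + u') v = hinner u v + hinner u' v" "hinner u (v + v') = hinner u v + hinner u v'"
  "hinner (c *s u) v = c * hinner u v" "hinner u (c *s v) = cnj c * hinner u v"
  "hinner (- u) v = - hinner u v" "hinner u (- v) = - hinner u v"
  "hinner 0 v = 0" "hinner u 0 = 0"
  by (simp_all add: hinner_def sum.distrib sum_distrib_left sum_negf algebra_simps)

lemma cnj_hinner: "cnj (hinner u v) = hinner v u"
  by (simp add: hinner_def mult.commute)

lemma sum_UNIV_Plus: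
  fixes f :: "'a::finite + 'b::finite \<Rightarrow> 'c::comm_monoid_add"
  shows "(\<Sum>j\<in>UNIV. f j) = (\<Sum>k\<in>UNIV. f (Inl k)) + (\<Sum>l\<in>UNIV. f (Inr l))"
  by (subst UNIV_Plus_UNIV[symmetric], subst sum.Plus) simp_all

lemma J_mat_mult: "J_mat *v vjoin y x = vjoin (- x) (y :: complex ^ 'n)"
proof -
  have "(\<Sum>j\<in>UNIV. J_mat $ i $ j * vjoin y x $ j) = vjoin (- x) y $ i" for i
    by (cases i) (simp_all add: sum_UNIV_Plus J_mat_def vjoin_def if_distrib[of "\<lambda>z. z * _"] if_distribR
        sum.delta cong: if_cong)
  then show ?thesis by (simp add: matrix_vector_mult_def vec_eq_iff)
qed

lemma hinner_vjoin: "hinner (vjoin a b) (vjoin a' b') = hinner a a' + hinner b b'"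
  by (simp add: hinner_def sum_UNIV_Plus vjoin_def)

text \<open>Momentum comes before position and the left end before the right end, in agreement with
  \<open>phase_curve\<close>.\<close>

definition bdry :: "complex ^ 'n \<Rightarrow> complex ^ 'n \<Rightarrow> complex ^ 'n \<Rightarrow> complex ^ 'n \<Rightarrow>
    complex ^ (('n + 'n) + ('n + 'n))" where
  "bdry ys xs yr xr = vjoin (vjoin ys xs) (vjoin yr xr)"

text \<open>In these coordinates the form is the difference of the two boundary terms that Green's
  formula yields for a pair of solutions. Isotropy of a boundary condition is therefore the symmetry
  of that term.\<close>

lemma omega2_bdry: "omega2 (bdry ys xs yr xr) (bdry ys' xs' yr' xr') =
    (hinner yr xr' - hinner xr yr') - (hinner ys xs' - hinner xs ys')"
  by (simp add: omega2_def omega_def bdry_def J_mat_mult hinner_vjoin hinner_simps)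

lemma bdry_cases: obtains ys xs yr xr where "z = bdry ys xs yr xr"
  by (metis bdry_def vjoin_vleft_vright)

lemma bdry_add: "bdry a b c d + bdry a' b' c' d' = bdry (a + a') (b + b') (c + c') (d + d')"
  and bdry_scale: "k *s bdry a b c d = bdry (k *s a) (k *s b) (k *s c) (k *s d)"
  and bdry_zero: "bdry 0 0 0 0 = 0"
  by (simp_all add: bdry_def vjoin_add vjoin_scale vjoin_zero)

lemma bdry_eq_iff: "bdry a b c d = bdry a' b' c' d' \<longleftrightarrow> a = a' \<and> b = b' \<and> c = c' \<and> d = d'"
  by (auto simp: bdry_def)

lemma omega2_simps:
  "omega2 (u + u') v = omega2 u v + omega2 u' v" "omega2 u (v + v') = omega2 u v + omega2 u v'"
  "omega2 (c *s u) v = c * omega2 u v" "omega2 u (c *s v) = cnj c * omega2 u v"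
  "cnj (omega2 u v) = - omega2 v u"
proof -
  obtain a1 b1 c1 d1 where u: "u = bdry a1 b1 c1 d1" by (rule bdry_cases)
  obtain a2 b2 c2 d2 where u': "u' = bdry a2 b2 c2 d2" by (rule bdry_cases)
  obtain a3 b3 c3 d3 where v: "v = bdry a3 b3 c3 d3" by (rule bdry_cases)
  obtain a4 b4 c4 d4 where v': "v' = bdry a4 b4 c4 d4" by (rule bdry_cases)
  show "omega2 (u + u') v = omega2 u v + omega2 u' v" "omega2 u (v + v') = omega2 u v + omega2 u v'"
  "omega2 (c *s u) v = c * omega2 u v" "omega2 u (c *s v) = cnj c * omega2 u v"
  "cnj (omega2 u v) = - omega2 v u"
    by (simp_all add: u u' v v' bdry_add bdry_scale omega2_bdry hinner_simps cnj_hinner algebra_simps)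
qed

lemma omega2_nondegenerate:
  assumes "\<And>w. omega2 u w = 0" shows "u = 0"
proof -
  obtain a b c d where u: "u = bdry a b c d" by (rule bdry_cases)
  \<comment> \<open>The test vector is \<open>u\<close> rotated by \<open>J\<close>, with a sign in
    each summand chosen so that the pairing is the squared norm of \<open>u\<close>.\<close>
  have "Re (omega2 u (bdry b (- a) (- d) c)) = 0" using assms by simp
  then have "a \<bullet> a + b \<bullet> b + c \<bullet> c + d \<bullet> d = 0"
    by (simp add: u omega2_bdry hinner_simps Re_hinner)
  then have "a = 0" "b = 0" "c = 0" "d = 0"
    by (metis add_nonneg_eq_0_iff add_nonneg_nonneg inner_ge_zero inner_eq_zero_iff)+
  then show ?thesis by (simp add: u bdry_zero)
qed

text \<open>A dimension count: a basis of \<Lambda> together with \<open>z\<close> is extended to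
  the whole space, and fewer than \<open>vec.dim \<Lambda>\<close> basis vectors are added. Hence
  some nonzero vector of \<Lambda> pairs to zero with those too, and then with everything, against
  nondegeneracy.\<close>

lemma lagrangian_maximal:
  assumes L: "lagrangian \<Lambda>" and z: "\<And>v. v \<in> \<Lambda> \<Longrightarrow> omega2 z v = 0"
  shows "z \<in> \<Lambda>"
proof (rule ccontr)
  assume "z \<notin> \<Lambda>"
  have sub: "vec.subspace \<Lambda>" and iso: "\<And>u v. u \<in> \<Lambda> \<Longrightarrow> v \<in> \<Lambda> \<Longrightarrow> omega2 u v = 0"
    and dim: "2 * vec.dim \<Lambda> = vec.dim (UNIV :: (complex ^ (('a + 'a) + ('a + 'a))) set)"
    using L by (auto simp: lagrangian_def)
  obtain B where B: "B \<subseteq> \<Lambda>" "vec.independent B" "\<Lambda> \<subseteq> vec.span B" "card B = vec.dim \<Lambda>"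
    using vec.basis_exists .
  have "vec.span B \<subseteq> \<Lambda>" using B(1) sub vec.span_minimal by blast
  with \<open>z \<notin> \<Lambda>\<close> have zB: "z \<notin> vec.span B" by blast
  then have ind: "vec.independent (insert z B)" using B(2) vec.independent_insertI by blast
  obtain E where E: "insert z B \<subseteq> E" "vec.independent E" "UNIV \<subseteq> vec.span E"
    using vec.maximal_independent_subset_extend[of "insert z B" UNIV] ind by auto
  have fE: "finite E" using E(2) vec.finiteI_independent by blast
  have fB: "finite B" using B(2) vec.finiteI_independent by blast
  have "z \<notin> B" using zB vec.span_base by blast
  have cE: "card E = 2 * card B" using vec.basis_card_eq_dim[of E UNIV] E dim B(4) by simp
  let ?C = "E - insert z B"
  have "card (insert z B) \<le> card E" using E(1) fE card_mono by blast
  then have "card ?C < card B"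
    using E(1) fB \<open>z \<notin> B\<close> cE by (simp add: card_Diff_subset)
  then obtain c where c: "\<exists>b\<in>B. c b \<noteq> 0" "\<forall>i\<in>?C. (\<Sum>b\<in>B. c b * omega2 b i) = 0"
    using nontrivial_kernel[of ?C B omega2] fE fB by blast
  define u where "u = (\<Sum>b\<in>B. c b *s b)"
  have uL: "u \<in> \<Lambda>" unfolding u_def using sub B(1)
    by (intro vec.subspace_sum vec.subspace_scale) auto
  have lin: "omega2 u w = (\<Sum>b\<in>B. c b * omega2 b w)" for w
    unfolding u_def using fB
  proof (induction B rule: finite_induct)
    case empty
    have "omega2 (0 *s w) w = 0" unfolding omega2_simps by simp
    then show ?case by simp
  qed (simp add: omega2_simps)
  have "vec.subspace {w. omega2 u w = 0}"
  proof (rule vec.subspaceI)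
    have "omega2 u (0 *s u) = 0" unfolding omega2_simps by simp
    then show "0 \<in> {w. omega2 u w = 0}" by simp
  qed (simp_all add: omega2_simps)
  moreover have "E \<subseteq> {w. omega2 u w = 0}"
  proof
    fix w assume "w \<in> E"
    then consider "w = z" | "w \<in> B" | "w \<in> ?C" by blast
    then show "w \<in> {w. omega2 u w = 0}"
    proof cases
      case 1
      have "cnj (omega2 z u) = 0" using z[OF uL] by simp
      then show ?thesis using 1 by (simp add: omega2_simps)
    next
      case 2
      then show ?thesis using iso uL B(1) by blast
    next
      case 3
      then show ?thesis using c(2) lin by simp
    qed
  qed
  ultimately have "vec.span E \<subseteq> {w. omega2 u w = 0}" using vec.span_minimal by blast
  then have "omega2 u w = 0" for w using E(3) by blast
  then have "u = 0" by (rule omega2_nondegenerate)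
  then have "vec.dependent B"
    unfolding vec.dependent_finite[OF fB] using c(1) by (auto simp: u_def)
  with B(2) show False by blast
qed

text \<open>\<open>V\<close> is the projection of \<Lambda> to endpoint positions, and
  \<open>Ys\<close>, \<open>Yr\<close> come from a real linear right inverse of this projection,
  that is, a choice of momenta over each point of \<open>V\<close>. Isotropy makes the resulting
  form symmetric. Maximality shows that momenta matter only through the functional they define on
  \<open>V\<close>, which is the natural boundary condition.\<close>

lemma lagrangian_boundary:
  fixes \<Lambda> :: "(complex ^ (('n::finite + 'n) + ('n + 'n))) set"
  assumes L: "lagrangian \<Lambda>"
  obtains V :: "((complex ^ 'n) \<times> (complex ^ 'n)) set" and Ys Yr :: "(complex ^ 'n) \<times> (complex ^ 'n) \<Rightarrow> complex ^ 'n"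
  where "subspace V" "linear Ys" "linear Yr"
    "\<forall>x\<in>V. \<forall>h\<in>V. Yr x \<bullet> snd h - Ys x \<bullet> fst h = Yr h \<bullet> snd x - Ys h \<bullet> fst x"
    "\<forall>ys xs yr xr. bdry ys xs yr xr \<in> \<Lambda> \<longleftrightarrow> (xs, xr) \<in> V \<and>
       (\<forall>h\<in>V. yr \<bullet> snd h - ys \<bullet> fst h = Yr (xs, xr) \<bullet> snd h - Ys (xs, xr) \<bullet> fst h)"
proof -
  have sub: "vec.subspace \<Lambda>" and iso: "\<And>u v. u \<in> \<Lambda> \<Longrightarrow> v \<in> \<Lambda> \<Longrightarrow> omega2 u v = 0"
    using L by (auto simp: lagrangian_def)
  have scaleR: "r *\<^sub>R z = complex_of_real r *s z" for r and z :: "complex ^ 'm"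
    by (subst vec_eq_iff) (simp, simp add: scaleR_conv_of_real)
  have subR: "subspace \<Lambda>"
    by (rule subspaceI)
      (use sub in \<open>auto simp: scaleR vec.subspace_0 vec.subspace_add vec.subspace_scale\<close>)
  define p where "p = (\<lambda>z :: complex ^ (('n + 'n) + ('n + 'n)). (vright (vleft z), vright (vright z)))"
  have linp: "linear p" by (rule linearI) (simp_all add: p_def)
  obtain g where g: "range g \<subseteq> \<Lambda>" "linear g" "\<And>v. v \<in> p ` \<Lambda> \<Longrightarrow> p (g v) = v"
    using linear_exists_right_inverse_on[OF linp subR] by blast
  define Ys where "Ys = (\<lambda>x. vleft (vleft (g x)))"
  define Yr where "Yr = (\<lambda>x. vleft (vright (g x)))"
  have gx: "g x = bdry (Ys x) (fst x) (Yr x) (snd x)" if "x \<in> p ` \<Lambda>" for x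
  proof -
    have "vright (vleft (g x)) = fst x" "vright (vright (g x)) = snd x"
      using arg_cong[OF g(3)[OF that], of fst] arg_cong[OF g(3)[OF that], of snd]
      by (simp_all add: p_def)
    then show ?thesis unfolding bdry_def Ys_def Yr_def by (metis vjoin_vleft_vright)
  qed
  have p_bdry: "p (bdry ys xs yr xr) = (xs, xr)" for ys xs yr xr by (simp add: p_def bdry_def)
  show thesis
  proof (rule that[of "p ` \<Lambda>" Ys Yr]; (intro ballI allI)?)
    show "subspace (p ` \<Lambda>)" using linp subR by (rule linear_subspace_image)
    show "linear Ys" "linear Yr"
      unfolding Ys_def Yr_def using g(2) by (simp_all add: linear_iff)
    show "Yr x \<bullet> snd h - Ys x \<bullet> fst h = Yr h \<bullet> snd x - Ys h \<bullet> fst x"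
      if "x \<in> p ` \<Lambda>" "h \<in> p ` \<Lambda>" for x h
    proof -
      have "Re (omega2 (g x) (g h)) = 0" using iso g(1) by (simp add: range_subsetD)
      then show ?thesis
        unfolding gx[OF that(1)] gx[OF that(2)] omega2_bdry by (simp add: Re_hinner inner_commute)
    qed
    show "bdry ys xs yr xr \<in> \<Lambda> \<longleftrightarrow> (xs, xr) \<in> p ` \<Lambda> \<and>
       (\<forall>h\<in>p ` \<Lambda>. yr \<bullet> snd h - ys \<bullet> fst h = Yr (xs, xr) \<bullet> snd h - Ys (xs, xr) \<bullet> fst h)"
      (is "?l \<longleftrightarrow> ?r") for ys xs yr xr
    proof
      assume l: ?l
      then have x: "(xs, xr) \<in> p ` \<Lambda>" by (metis p_bdry imageI)
      moreover have "yr \<bullet> snd h - ys \<bullet> fst h = Yr (xs, xr) \<bullet> snd h - Ys (xs, xr) \<bullet> fst h"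
        if h: "h \<in> p ` \<Lambda>" for h
      proof -
        have "Re (omega2 (bdry ys xs yr xr) (g h)) = 0" "Re (omega2 (g (xs, xr)) (g h)) = 0"
          using iso g(1) l by (simp_all add: range_subsetD)
        then show ?thesis
          unfolding gx[OF h] gx[OF x] omega2_bdry by (simp add: Re_hinner inner_commute)
      qed
      ultimately show ?r by blast
    next
      assume r: ?r
      have Re0: "Re (omega2 (bdry ys xs yr xr) v) = 0" if v: "v \<in> \<Lambda>" for v
      proof -
        obtain a b c d where vb: "v = bdry a b c d" by (rule bdry_cases)
        have h: "(b, d) \<in> p ` \<Lambda>" using v vb by (metis p_bdry imageI)
        have "Re (omega2 (g (xs, xr)) v) = 0" using iso g(1) v by (simp add: range_subsetD)
        moreover have "yr \<bullet> d - ys \<bullet> b = Yr (xs, xr) \<bullet> d - Ys (xs, xr) \<bullet> b"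
          using bspec[OF conjunct2[OF r] h] by simp
        ultimately show ?thesis
          unfolding vb gx[OF conjunct1[OF r]] omega2_bdry by (simp add: Re_hinner inner_commute)
      qed
      have "omega2 (bdry ys xs yr xr) v = 0" if v: "v \<in> \<Lambda>" for v
      proof -
        \<comment> \<open>As \<Lambda> is a complex subspace, the real part of the form at
          \<open>\<i> *s v\<close> supplies the imaginary part at \<open>v\<close>.\<close>
        have "\<i> *s v \<in> \<Lambda>" using sub v vec.subspace_scale by blast
        from Re0[OF this] have "Im (omega2 (bdry ys xs yr xr) v) = 0" by (simp add: omega2_simps)
        with Re0[OF v] show ?thesis by (simp add: complex_eq_iff)
      qed
      then show ?l using L lagrangian_maximal by blast
    qed
  qed
qed

lemma bdry_in_Lambda_D: "bdry ys xs yr xr \<in> Lambda_D \<longleftrightarrow> xs = 0 \<and> xr = 0"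
  by (auto simp: Lambda_D_def Dirichlet_n_def dsum_def bdry_def)

lemma bdry_in_Lambda_N: "bdry ys xs yr xr \<in> Lambda_N \<longleftrightarrow> ys = 0 \<and> yr = 0"
  by (auto simp: Lambda_N_def Neumann_n_def dsum_def bdry_def)

text \<open>Adding a Dirichlet vector removes the momenta. Endpoint positions allowed by \<Lambda>
  thus lie in the space whose dimension is \<open>nu\<close>.\<close>

lemma bdry_in_nu_space:
  assumes "bdry ys xs yr xr \<in> \<Lambda>"
  shows "bdry 0 xs 0 xr \<in> (\<Lambda> + Lambda_D) \<inter> Lambda_N"
proof -
  have "bdry 0 xs 0 xr = bdry ys xs yr xr + bdry (- ys) 0 (- yr) 0" by (simp add: bdry_add)
  moreover have "bdry (- ys) 0 (- yr) 0 \<in> Lambda_D" by (simp add: bdry_in_Lambda_D)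
  ultimately have "bdry 0 xs 0 xr \<in> \<Lambda> + Lambda_D" using assms by (metis set_plus_intro)
  then show ?thesis by (simp add: bdry_in_Lambda_N)
qed

section \<open>Square-integrable functions\<close>

text \<open>Serves the Cauchy--Schwarz inequality and, with \<open>a = 0\<close>, the first
  variation of a minimum: there it says that the linear term vanishes. The sign of \<open>c\<close>
  is part of what is derived.\<close>

lemma quadratic_nonneg_discrim:
  fixes a b c :: real
  assumes "\<And>x. 0 \<le> a + 2 * x * b + x\<^sup>2 * c"
  shows "b\<^sup>2 \<le> a * c"
proof (cases "c = 0")
  case True
  have "b = 0"
  proof (rule ccontr)
    assume "b \<noteq> 0"
    then have "2 * (- (a + 1) / (2 * b)) * b = - (a + 1)" by simp
    with assms[of "- (a + 1) / (2 * b)"] True show False by simp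
  qed
  then show ?thesis using True by simp
next
  case False
  have "c > 0"
  proof (rule ccontr)
    assume "\<not> c > 0"
    with False have "c < 0" by simp
    \<comment> \<open>Large enough that \<open>x\<close> and \<open>- x\<close> together give a
      contradiction: the linear terms cancel in the sum, and \<open>a - (\<bar>a\<bar> + 1)\<close>
      is negative.\<close>
    define x where "x = sqrt ((\<bar>a\<bar> + 1) / - c)"
    have "x\<^sup>2 = (\<bar>a\<bar> + 1) / - c"
      unfolding x_def using \<open>c < 0\<close> by (intro real_sqrt_pow2 divide_nonneg_pos) auto
    then have "x\<^sup>2 * c = - (\<bar>a\<bar> + 1)" using \<open>c < 0\<close> by simp
    then show False using assms[of x] assms[of "- x"] by simp
  qed
  have "a + 2 * (- b / c) * b + (- b / c)\<^sup>2 * c = a - b\<^sup>2 / c"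
    using \<open>c > 0\<close> by (simp add: power2_eq_square)
  then have "b\<^sup>2 / c \<le> a" using assms[of "- b / c"] by simp
  then show ?thesis using \<open>c > 0\<close> by (simp add: pos_divide_le_eq)
qed

definition sq_integrable :: "'a measure \<Rightarrow> ('a \<Rightarrow> 'b::euclidean_space) \<Rightarrow> bool" where
  "sq_integrable M f \<longleftrightarrow> f \<in> borel_measurable M \<and> integrable M (\<lambda>x. (norm (f x))\<^sup>2)"

lemma sq_integrable_measurable [measurable_dest]: "sq_integrable M f \<Longrightarrow> f \<in> borel_measurable M"
  by (simp add: sq_integrable_def)

lemma sq_integrable_bound:
  assumes "sq_integrable M f" "g \<in> borel_measurable M" "\<And>x. x \<in> space M \<Longrightarrow> norm (g x) \<le> C * norm (f x)"
  shows "sq_integrable M g"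
  unfolding sq_integrable_def
proof
  show "integrable M (\<lambda>x. (norm (g x))\<^sup>2)"
  proof (rule Bochner_Integration.integrable_bound)
    show "integrable M (\<lambda>x. C\<^sup>2 * (norm (f x))\<^sup>2)" using assms(1) by (simp add: sq_integrable_def)
    have "(norm (g x))\<^sup>2 \<le> C\<^sup>2 * (norm (f x))\<^sup>2" if "x \<in> space M" for x
      using power_mono[OF assms(3)[OF that], of 2] by (simp add: power_mult_distrib)
    then show "AE x in M. norm ((norm (g x))\<^sup>2) \<le> norm (C\<^sup>2 * (norm (f x))\<^sup>2)" by simp
  qed (use assms(2) in measurable)
qed (fact assms(2))

lemma sq_integrable_zero [simp]: "sq_integrable M (\<lambda>x. 0)"
  by (simp add: sq_integrable_def)

lemma norm_add_sq_le: "(norm (a + b))\<^sup>2 \<le> 2 * (norm a)\<^sup>2 + 2 * (norm (b :: 'a::real_normed_vector))\<^sup>2"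
proof -
  have "(norm (a + b))\<^sup>2 \<le> (norm a + norm b)\<^sup>2" by (intro power_mono norm_triangle_ineq) auto
  also have "\<dots> \<le> 2 * (norm a)\<^sup>2 + 2 * (norm b)\<^sup>2"
    using sum_squares_bound[of "norm a" "norm b"] by (simp add: power2_sum)
  finally show ?thesis .
qed

lemma sq_integrable_add:
  assumes "sq_integrable M f" "sq_integrable M g"
  shows "sq_integrable M (\<lambda>x. f x + g x)"
  unfolding sq_integrable_def
proof
  have [measurable]: "f \<in> borel_measurable M" "g \<in> borel_measurable M"
    using assms by (auto simp: sq_integrable_def)
  show "(\<lambda>x. f x + g x) \<in> borel_measurable M" by measurable
  show "integrable M (\<lambda>x. (norm (f x + g x))\<^sup>2)"
  proof (rule Bochner_Integration.integrable_bound)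
    show "integrable M (\<lambda>x. 2 * (norm (f x))\<^sup>2 + 2 * (norm (g x))\<^sup>2)"
      using assms by (simp add: sq_integrable_def)
    show "AE x in M. norm ((norm (f x + g x))\<^sup>2) \<le> norm (2 * (norm (f x))\<^sup>2 + 2 * (norm (g x))\<^sup>2)"
      using norm_add_sq_le by auto
  qed measurable
qed

lemma sq_integrable_scaleR: "sq_integrable M f \<Longrightarrow> sq_integrable M (\<lambda>x. k *\<^sub>R f x)"
  by (rule sq_integrable_bound[of M f _ "\<bar>k\<bar>"]) (auto dest: sq_integrable_measurable)

lemma sq_integrable_minus: "sq_integrable M f \<Longrightarrow> sq_integrable M (\<lambda>x. - f x)"
  using sq_integrable_scaleR[of M f "- 1"] by simp

lemma sq_integrable_diff:
  "sq_integrable M f \<Longrightarrow> sq_integrable M g \<Longrightarrow> sq_integrable M (\<lambda>x. f x - g x)"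
  using sq_integrable_add[of M f "\<lambda>x. - g x"] sq_integrable_minus[of M g] by simp

lemma sq_integrable_norm: "sq_integrable M f \<Longrightarrow> sq_integrable M (\<lambda>x. norm (f x))"
  by (rule sq_integrable_bound[of M f _ 1]) (auto dest: sq_integrable_measurable)

section \<open>Inner products of square-integrable functions\<close>

lemma integrable_inner:
  assumes "sq_integrable M f" "sq_integrable M g"
  shows "integrable M (\<lambda>x. f x \<bullet> g x)"
proof (rule Bochner_Integration.integrable_bound)
  have [measurable]: "f \<in> borel_measurable M" "g \<in> borel_measurable M"
    using assms by (auto simp: sq_integrable_def)
  show "integrable M (\<lambda>x. (norm (f x))\<^sup>2 + (norm (g x))\<^sup>2)"
    using assms by (simp add: sq_integrable_def)
  show "(\<lambda>x. f x \<bullet> g x) \<in> borel_measurable M" by measurable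
  have "\<bar>f x \<bullet> g x\<bar> \<le> (norm (f x))\<^sup>2 + (norm (g x))\<^sup>2" for x
    using Cauchy_Schwarz_ineq2[of "f x" "g x"] sum_squares_bound[of "norm (f x)" "norm (g x)"]
      mult_nonneg_nonneg[OF norm_ge_zero[of "f x"] norm_ge_zero[of "g x"]] by linarith
  then show "AE x in M. norm (f x \<bullet> g x) \<le> norm ((norm (f x))\<^sup>2 + (norm (g x))\<^sup>2)" by auto
qed

lemma integrable_inner_self: "sq_integrable M f \<Longrightarrow> integrable M (\<lambda>x. f x \<bullet> f x)"
  by (rule integrable_inner)

lemma sq_integral_nonneg: "0 \<le> (LINT x|M. f x \<bullet> (f x :: 'b::real_inner))"
  by (rule Bochner_Integration.integral_nonneg) simp

lemma Cauchy_Schwarz_integral: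
  assumes "sq_integrable M f" "sq_integrable M g"
  shows "(LINT x|M. f x \<bullet> g x)\<^sup>2 \<le> (LINT x|M. f x \<bullet> f x) * (LINT x|M. g x \<bullet> g x)"
proof (rule quadratic_nonneg_discrim)
  fix k :: real
  have "0 \<le> (LINT x|M. (f x + k *\<^sub>R g x) \<bullet> (f x + k *\<^sub>R g x))" by (rule sq_integral_nonneg)
  also have "\<dots> = (LINT x|M. f x \<bullet> f x + 2 * k * (f x \<bullet> g x) + k\<^sup>2 * (g x \<bullet> g x))"
    by (intro Bochner_Integration.integral_cong)
      (auto simp: algebra_simps power2_eq_square inner_commute)
  also have "\<dots> = (LINT x|M. f x \<bullet> f x) + 2 * k * (LINT x|M. f x \<bullet> g x) + k\<^sup>2 * (LINT x|M. g x \<bullet> g x)"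
    using assms by (simp add: integrable_inner)
  finally show "0 \<le> (LINT x|M. f x \<bullet> f x) + 2 * k * (LINT x|M. f x \<bullet> g x) + k\<^sup>2 * (LINT x|M. g x \<bullet> g x)" .
qed

lemma (in finite_measure) sq_integrable_const: "sq_integrable M (\<lambda>x. c)"
  by (simp add: sq_integrable_def)

lemma (in finite_measure) sq_integrable_imp_integrable:
  assumes "sq_integrable M f"
  shows "integrable M f"
proof -
  have "integrable M (\<lambda>x. norm (f x) \<bullet> (1::real))"
    by (intro integrable_inner sq_integrable_norm sq_integrable_const assms)
  then show ?thesis using assms integrable_norm_iff[of f M] by (simp add: sq_integrable_def)
qed

lemma (in finite_measure) L1_le_L2:
  assumes "sq_integrable M f"
  shows "(LINT x|M. norm (f x))\<^sup>2 \<le> measure M (space M) * (LINT x|M. f x \<bullet> f x)"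
  using Cauchy_Schwarz_integral[OF sq_integrable_norm[OF assms] sq_integrable_const[of 1]]
  by (simp add: mult.commute power2_norm_eq_inner flip: power2_eq_square)

text \<open>The integrals are squared norms, so \<open>1/4\<close> means that the distances decay
  like \<open>(1/2) ^ k\<close>. On a finite measure space the integrals of the norms decay in the
  same way; their series has finite integral and therefore converges almost everywhere.\<close>

lemma (in finite_measure) L2_Cauchy_subseq_AE_convergent:
  fixes f :: "nat \<Rightarrow> 'a \<Rightarrow> 'b::euclidean_space"
  assumes sq: "\<And>n. sq_integrable M (f n)"
    and r: "\<And>k. (LINT x|M. (f (r (Suc k)) x - f (r k) x) \<bullet> (f (r (Suc k)) x - f (r k) x)) \<le> (1/4) ^ k"
  obtains g where "g \<in> borel_measurable M" "AE x in M. (\<lambda>k. f (r k) x) \<longlonglongrightarrow> g x"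
proof -
  define d where "d = (\<lambda>k x. f (r (Suc k)) x - f (r k) x)"
  have sqd: "sq_integrable M (d k)" for k unfolding d_def by (intro sq_integrable_diff sq)
  have [measurable]: "f n \<in> borel_measurable M" "d n \<in> borel_measurable M" for n
    using sq sqd by (auto dest: sq_integrable_measurable)
  \<comment> \<open>The summand 1 ensures \<open>K \<le> K * K\<close>, so that \<open>K\<close> can
    stand in for the square root of the total mass.\<close>
  define K where "K = measure M (space M) + 1"
  have K: "measure M (space M) \<le> K" "K \<ge> 1" by (auto simp: K_def)
  have d_L1: "(LINT x|M. norm (d k x)) \<le> K * (1/2) ^ k" for k
  proof (rule power2_le_imp_le)
    have "(LINT x|M. norm (d k x))\<^sup>2 \<le> measure M (space M) * (LINT x|M. d k x \<bullet> d k x)"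
      by (rule L1_le_L2[OF sqd])
    also have "\<dots> \<le> K * (1/4) ^ k"
      using r[of k] K by (intro mult_mono) (auto simp: d_def sq_integral_nonneg)
    also have "\<dots> \<le> K * K * (1/4) ^ k" using K by simp
    also have "\<dots> = (K * (1/2) ^ k)\<^sup>2"
      by (simp add: power2_eq_square power_mult_distrib[symmetric])
    finally show "(LINT x|M. norm (d k x))\<^sup>2 \<le> (K * (1/2) ^ k)\<^sup>2" .
  qed (use K in auto)
  have summ: "summable (\<lambda>k. K * (1/2::real) ^ k)" by (intro summable_mult summable_geometric) auto
  have "(\<integral>\<^sup>+x. (\<Sum>k. ennreal (norm (d k x))) \<partial>M) = (\<Sum>k. \<integral>\<^sup>+x. ennreal (norm (d k x)) \<partial>M)"
    by (rule nn_integral_suminf) measurable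
  also have "\<dots> = (\<Sum>k. ennreal (LINT x|M. norm (d k x)))"
    by (intro suminf_cong nn_integral_eq_integral integrable_norm sq_integrable_imp_integrable sqd) auto
  also have "\<dots> \<noteq> top"
    by (intro ennreal_suminf_neq_top summable_comparison_test[OF _ summ])
      (use d_L1 in \<open>auto intro!: Bochner_Integration.integral_nonneg\<close>)
  finally have "AE x in M. (\<Sum>k. ennreal (norm (d k x))) \<noteq> \<infinity>"
    by (intro nn_integral_PInf_AE) auto
  then have AE: "AE x in M. summable (\<lambda>k. norm (d k x))"
    by eventually_elim (auto intro: summable_suminf_not_top)
  show thesis
  proof (rule that[of "\<lambda>x. f (r 0) x + (\<Sum>k. d k x)"])
    show "(\<lambda>x. f (r 0) x + (\<Sum>k. d k x)) \<in> borel_measurable M" by measurable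
    show "AE x in M. (\<lambda>k. f (r k) x) \<longlonglongrightarrow> f (r 0) x + (\<Sum>k. d k x)"
      using AE
    proof eventually_elim
      case (elim x)
      have "(\<lambda>n. \<Sum>k<n. d k x) \<longlonglongrightarrow> (\<Sum>k. d k x)"
        by (rule summable_LIMSEQ[OF summable_norm_cancel[OF elim]])
      moreover have "(\<Sum>k<n. d k x) = f (r n) x - f (r 0) x" for n
        by (induction n) (simp_all add: d_def)
      ultimately have "(\<lambda>n. f (r n) x - f (r 0) x) \<longlonglongrightarrow> (\<Sum>k. d k x)" by simp
      from tendsto_add[OF tendsto_const[of "f (r 0) x"] this] show ?case by simp
    qed
  qed
qed

text \<open>Fatou's lemma carries the bound to the limit. It is required only from \<open>N\<close>
  on because it is applied to tails of a Cauchy sequence.\<close>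

lemma sq_integrable_Fatou:
  fixes h :: "nat \<Rightarrow> 'a \<Rightarrow> 'b::euclidean_space"
  assumes sq: "\<And>k. sq_integrable M (h k)" and g: "g \<in> borel_measurable M"
    and lim: "AE x in M. (\<lambda>k. h k x) \<longlonglongrightarrow> g x"
    and bound: "\<And>k. k \<ge> N \<Longrightarrow> (LINT x|M. h k x \<bullet> h k x) \<le> C"
  shows "sq_integrable M g" "(LINT x|M. g x \<bullet> g x) \<le> C"
proof -
  have [measurable]: "h k \<in> borel_measurable M" for k using sq by (auto dest: sq_integrable_measurable)
  note g[measurable]
  have C0: "0 \<le> C" using order_trans[OF sq_integral_nonneg bound[of N]] by simp
  have "(\<integral>\<^sup>+x. ennreal (g x \<bullet> g x) \<partial>M) = (\<integral>\<^sup>+x. liminf (\<lambda>k. ennreal (h k x \<bullet> h k x)) \<partial>M)"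
  proof (rule nn_integral_cong_AE)
    show "AE x in M. ennreal (g x \<bullet> g x) = liminf (\<lambda>k. ennreal (h k x \<bullet> h k x))"
      using lim
    proof eventually_elim
      case (elim x)
      then have "(\<lambda>k. ennreal (h k x \<bullet> h k x)) \<longlonglongrightarrow> ennreal (g x \<bullet> g x)"
        by (intro tendsto_ennrealI tendsto_inner)
      then show ?case by (intro lim_imp_Liminf[symmetric]) auto
    qed
  qed
  also have "\<dots> \<le> liminf (\<lambda>k. \<integral>\<^sup>+x. ennreal (h k x \<bullet> h k x) \<partial>M)"
    by (rule nn_integral_liminf) measurable
  also have "\<dots> \<le> ennreal C"
  proof (rule Liminf_le)
    show "\<forall>\<^sub>F k in sequentially. (\<integral>\<^sup>+x. ennreal (h k x \<bullet> h k x) \<partial>M) \<le> ennreal C"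
      using eventually_ge_at_top[of N]
    proof eventually_elim
      case (elim k)
      have "(\<integral>\<^sup>+x. ennreal (h k x \<bullet> h k x) \<partial>M) = ennreal (LINT x|M. h k x \<bullet> h k x)"
        by (intro nn_integral_eq_integral integrable_inner_self sq) auto
      then show ?case using bound[OF elim] by (simp add: ennreal_leI)
    qed
  qed simp
  finally have le: "(\<integral>\<^sup>+x. ennreal (g x \<bullet> g x) \<partial>M) \<le> ennreal C" .
  have int: "integrable M (\<lambda>x. g x \<bullet> g x)"
  proof (rule integrableI_bounded)
    show "(\<lambda>x. g x \<bullet> g x) \<in> borel_measurable M" by measurable
    show "(\<integral>\<^sup>+x. ennreal (norm (g x \<bullet> g x)) \<partial>M) < \<infinity>"
      using le_less_trans[OF le ennreal_less_top] by simp
  qed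
  then show "sq_integrable M g" using g by (simp add: sq_integrable_def power2_norm_eq_inner)
  have "ennreal (LINT x|M. g x \<bullet> g x) \<le> ennreal C"
    using le int by (subst (asm) nn_integral_eq_integral) auto
  then show "(LINT x|M. g x \<bullet> g x) \<le> C" using C0 by simp
qed

lemma (in finite_measure) L2_complete:
  fixes f :: "nat \<Rightarrow> 'a \<Rightarrow> 'b::euclidean_space"
  assumes sq: "\<And>n. sq_integrable M (f n)"
    and cauchy: "\<And>e. e > 0 \<Longrightarrow> \<exists>N. \<forall>m\<ge>N. \<forall>n\<ge>N. (LINT x|M. (f m x - f n x) \<bullet> (f m x - f n x)) \<le> e"
  obtains g where "sq_integrable M g" "(\<lambda>n. LINT x|M. (f n x - g x) \<bullet> (f n x - g x)) \<longlonglongrightarrow> 0"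
proof -
  have "\<exists>N. \<forall>m\<ge>N. \<forall>n\<ge>N. (LINT x|M. (f m x - f n x) \<bullet> (f m x - f n x)) \<le> (1/4) ^ k" for k :: nat
    using cauchy[of "(1/4) ^ k"] by simp
  then obtain N where N: "\<And>k m n. m \<ge> N k \<Longrightarrow> n \<ge> N k \<Longrightarrow>
      (LINT x|M. (f m x - f n x) \<bullet> (f m x - f n x)) \<le> (1/4) ^ k" by metis
  \<comment> \<open>Adding up the \<open>N i\<close> makes both \<open>r k\<close> and
    \<open>r (Suc k)\<close> at least \<open>N k\<close>, so consecutive members of the subsequence
    are as close as prescribed.\<close>
  define r where "r = (\<lambda>k. k + (\<Sum>i\<le>k. N i))"
  have r1: "r k \<ge> N j" "r k \<ge> k" if "j \<le> k" for j k
    using member_le_sum[of j "{..k}" N] that by (auto simp: r_def)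
  have r2: "r (Suc k) \<ge> N k" for k using r1(1)[of k "Suc k"] by simp
  obtain g where g: "g \<in> borel_measurable M" "AE x in M. (\<lambda>k. f (r k) x) \<longlonglongrightarrow> g x"
    using L2_Cauchy_subseq_AE_convergent[of f r, OF sq N[OF r2 r1(1)[OF order_refl]]] by blast
  \<comment> \<open>With \<open>n\<close> fixed, \<open>j\<close> tends to infinity in
    \<open>f n - f (r j)\<close>. This gives convergence of the whole sequence and not only of the
    subsequence.\<close>
  have key: "sq_integrable M (\<lambda>x. f n x - g x)" "(LINT x|M. (f n x - g x) \<bullet> (f n x - g x)) \<le> (1/4) ^ k"
    if "n \<ge> N k" for n k
  proof -
    have *: "sq_integrable M (\<lambda>x. f n x - f (r j) x)" for j by (intro sq_integrable_diff sq)
    have m: "(\<lambda>x. f n x - g x) \<in> borel_measurable M"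
      using g(1) sq by (intro borel_measurable_diff) (auto dest: sq_integrable_measurable)
    have l: "AE x in M. (\<lambda>j. f n x - f (r j) x) \<longlonglongrightarrow> f n x - g x"
      using g(2) by eventually_elim (intro tendsto_intros)
    have b: "(LINT x|M. (f n x - f (r j) x) \<bullet> (f n x - f (r j) x)) \<le> (1/4) ^ k" if "j \<ge> k" for j
      using N \<open>n \<ge> N k\<close> r1(1)[OF that] by blast
    show "sq_integrable M (\<lambda>x. f n x - g x)" "(LINT x|M. (f n x - g x) \<bullet> (f n x - g x)) \<le> (1/4) ^ k"
      using sq_integrable_Fatou[OF * m l b] by auto
  qed
  have "sq_integrable M (\<lambda>x. f (N 0) x - (f (N 0) x - g x))"
    by (intro sq_integrable_diff sq key(1)[of 0]) simp
  then have "sq_integrable M g" by simp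
  moreover have "(\<lambda>n. LINT x|M. (f n x - g x) \<bullet> (f n x - g x)) \<longlonglongrightarrow> 0"
  proof (rule LIMSEQ_I)
    fix e :: real assume "e > 0"
    then obtain k where "(1/4::real) ^ k < e" using real_arch_pow_inv[of e "1/4"] by auto
    then have "norm ((LINT x|M. (f n x - g x) \<bullet> (f n x - g x)) - 0) < e" if "n \<ge> N k" for n
      using key(2)[OF that] sq_integral_nonneg[of M "\<lambda>x. f n x - g x"] by simp
    then show "\<exists>no. \<forall>n\<ge>no. norm ((LINT x|M. (f n x - g x) \<bullet> (f n x - g x)) - 0) < e" by blast
  qed
  ultimately show thesis using that by blast
qed

lemma L2_tendsto_inner:
  assumes sq: "\<And>n. sq_integrable M (f n)" "sq_integrable M g" "sq_integrable M h"
    and lim: "(\<lambda>n. LINT x|M. (f n x - g x) \<bullet> (f n x - g x)) \<longlonglongrightarrow> 0"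
  shows "(\<lambda>n. LINT x|M. f n x \<bullet> h x) \<longlonglongrightarrow> (LINT x|M. g x \<bullet> h x)"
proof -
  have le: "(LINT x|M. (f n x - g x) \<bullet> h x)\<^sup>2 \<le>
      (LINT x|M. (f n x - g x) \<bullet> (f n x - g x)) * (LINT x|M. h x \<bullet> h x)" for n
    by (intro Cauchy_Schwarz_integral sq_integrable_diff sq)
  have lim0: "(\<lambda>n. (LINT x|M. (f n x - g x) \<bullet> (f n x - g x)) * (LINT x|M. h x \<bullet> h x)) \<longlonglongrightarrow> 0"
    by (rule tendsto_mult_left_zero[OF lim])
  have "(\<lambda>n. (LINT x|M. (f n x - g x) \<bullet> h x)\<^sup>2) \<longlonglongrightarrow> 0"
    by (rule tendsto_sandwich[OF _ _ tendsto_const lim0]) (use le in \<open>simp_all add: always_eventually\<close>)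
  from tendsto_real_sqrt[OF this] have "(\<lambda>n. LINT x|M. (f n x - g x) \<bullet> h x) \<longlonglongrightarrow> 0"
    by (simp add: tendsto_rabs_zero_iff)
  moreover have "(LINT x|M. (f n x - g x) \<bullet> h x) = (LINT x|M. f n x \<bullet> h x) - (LINT x|M. g x \<bullet> h x)" for n
    by (simp add: inner_diff_left integrable_inner sq)
  ultimately show ?thesis by (simp add: LIM_zero_iff)
qed

text \<open>The positive and the negative part of \<open>h\<close> are densities of finite measures
  that agree on all right half-lines, hence are equal; densities are unique almost everywhere. The
  comparison of measures concerns Borel sets, whence the Borel representative
  \<open>k\<close>.\<close>

lemma real_AE_zero_if_integrals_zero:
  fixes h :: "real \<Rightarrow> real"
  assumes int: "integrable lebesgue h" and zero: "\<And>x. (LINT t:{x<..}|lebesgue. h t) = 0"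
  shows "AE t in lebesgue. h t = 0"
proof -
  obtain k where k: "k \<in> borel_measurable lborel" "AE t in lborel. h t = k t"
    using completion_ex_borel_measurable_real[OF borel_measurable_integrable[OF int]] by blast
  note k(1)[measurable]
  have hk: "AE t in lebesgue. h t = k t" using k(2) by (rule AE_completion)
  have intk': "integrable lebesgue k"
    using int hk k(1) by (subst integrable_cong_AE[symmetric, of h]) (auto simp: measurable_completion)
  then have intk: "integrable lborel k" using k(1) by (simp add: integrable_completion)
  have zero': "(LINT t:{x<..}|lborel. k t) = 0" for x
  proof -
    have "(LINT t:{x<..}|lebesgue. h t) = (LINT t:{x<..}|lebesgue. k t)"
      unfolding set_lebesgue_integral_def using hk
      by (intro integral_cong_AE borel_measurable_integrable integrable_mult_indicator int intk') auto
    also have "\<dots> = (LINT t:{x<..}|lborel. k t)"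
      unfolding set_lebesgue_integral_def by (rule integral_completion) measurable
    finally show ?thesis using zero by simp
  qed
  let ?p = "\<lambda>t. ennreal (max 0 (k t))" and ?n = "\<lambda>t. ennreal (max 0 (- k t))"
  have ip: "integrable lborel (\<lambda>t. max 0 (k t))" "integrable lborel (\<lambda>t. max 0 (- k t))"
    using intk by auto
  have em: "emeasure (density lborel (\<lambda>t. ennreal (max 0 (u t)))) {x<..} =
      ennreal (LINT t:{x<..}|lborel. max 0 (u t))"
    if "integrable lborel (\<lambda>t. max 0 (u t))" for x and u :: "real \<Rightarrow> real"
  proof -
    have "emeasure (density lborel (\<lambda>t. ennreal (max 0 (u t)))) {x<..} =
        (\<integral>\<^sup>+t. ennreal (max 0 (u t)) * indicator {x<..} t \<partial>lborel)"
      using that by (subst emeasure_density) (auto dest!: borel_measurable_integrable)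
    also have "\<dots> = (\<integral>\<^sup>+t. ennreal (indicator {x<..} t *\<^sub>R max 0 (u t)) \<partial>lborel)"
      by (intro nn_integral_cong) (auto simp: indicator_def)
    also have "\<dots> = ennreal (LINT t:{x<..}|lborel. max 0 (u t))"
      unfolding set_lebesgue_integral_def
      by (intro nn_integral_eq_integral integrable_mult_indicator that) auto
    finally show ?thesis .
  qed
  have "density lborel ?p = density lborel ?n"
  proof (rule measure_eqI_lessThan)
    show "emeasure (density lborel ?p) {x<..} < \<infinity>" for x using em[OF ip(1)] by simp
    show "emeasure (density lborel ?p) {x<..} = emeasure (density lborel ?n) {x<..}" for x
    proof -
      have "(LINT t:{x<..}|lborel. k t) = (LINT t:{x<..}|lborel. max 0 (k t) - max 0 (- k t))"
        by (intro arg_cong[where f = "set_lebesgue_integral lborel _"] ext) auto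
      also have "\<dots> = (LINT t:{x<..}|lborel. max 0 (k t)) - (LINT t:{x<..}|lborel. max 0 (- k t))"
        by (intro set_integral_diff; unfold set_integrable_def; intro integrable_mult_indicator ip) auto
      finally show ?thesis using zero'[of x] em[OF ip(1)] em[OF ip(2)] by simp
    qed
  qed auto
  moreover have "(\<integral>\<^sup>+t. ?p t \<partial>lborel) \<noteq> \<infinity>"
    using ip(1) by (subst nn_integral_eq_integral) auto
  ultimately have "AE t in lborel. ?p t = ?n t"
    by (subst (asm) finite_density_unique) auto
  then have "AE t in lborel. k t = 0"
    by eventually_elim (auto simp: max_def split: if_splits)
  then have "AE t in lebesgue. k t = 0" by (rule AE_completion)
  with hk show ?thesis by eventually_elim simp
qed

section \<open>Weak derivatives\<close>

lemma L2_iff_sq_integrable: "f \<in> L2 s r \<longleftrightarrow> sq_integrable (lebesgue_on {s..r}) f"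
  by (simp add: L2_def sq_integrable_def)

lemma finite_measure_interval: "finite_measure (lebesgue_on {s..r::real})"
  by (rule finite_measure_lebesgue_on) simp

lemma measure_interval: "s \<le> r \<Longrightarrow> measure (lebesgue_on {s..r}) (space (lebesgue_on {s..r})) = r - s"
  by (simp add: measure_restrict_space)

lemma set_integral_eq_lebesgue_on:
  fixes g :: "real \<Rightarrow> 'b::{banach, second_countable_topology}"
  shows "(LINT x:{u..v}|lebesgue. g x) = (LINT x|lebesgue_on {u..v}. g x)"
  by (simp add: set_lebesgue_integral_def integral_restrict_space)

lemma integral_lebesgue_on_indicator:
  fixes g :: "real \<Rightarrow> 'b::{banach, second_countable_topology}"
  shows "(LINT x|lebesgue_on {u..v}. g x) = (LINT x|lebesgue. indicator {u..v} x *\<^sub>R g x)"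
  by (rule integral_restrict_space) simp

lemma integral_lebesgue_on_subinterval:
  fixes g :: "real \<Rightarrow> 'b::{banach, second_countable_topology}"
  assumes "{u..v} \<subseteq> {s..r}"
  shows "(LINT x|lebesgue_on {u..v}. g x) = (LINT x|lebesgue_on {s..r}. indicator {u..v} x *\<^sub>R g x)"
proof -
  have "indicator {s..r} x *\<^sub>R (indicator {u..v} x *\<^sub>R g x) = indicator {u..v} x *\<^sub>R g x" for x
    using assms by (cases "x \<in> {u..v}") (auto simp: indicator_def)
  then show ?thesis by (simp only: integral_lebesgue_on_indicator)
qed

lemma sq_integrable_interval_integrable:
  "sq_integrable (lebesgue_on {s..r::real}) g \<Longrightarrow> integrable (lebesgue_on {s..r}) g"
  by (rule finite_measure.sq_integrable_imp_integrable[OF finite_measure_interval])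

lemma sq_integrable_subinterval:
  fixes g :: "real \<Rightarrow> 'b::euclidean_space"
  assumes "sq_integrable (lebesgue_on {s..r}) g" "{u..v} \<subseteq> {s..r}"
  shows "sq_integrable (lebesgue_on {u..v}) g"
  unfolding sq_integrable_def
proof
  show "g \<in> borel_measurable (lebesgue_on {u..v})"
    using assms by (blast intro: measurable_restrict_mono dest: sq_integrable_measurable)
  show "integrable (lebesgue_on {u..v}) (\<lambda>x. (norm (g x))\<^sup>2)"
    by (rule integrable_subinterval[OF _ assms(2)]) (use assms(1) in \<open>simp add: sq_integrable_def\<close>)
qed

lemma continuous_on_imp_sq_integrable:
  fixes f :: "real \<Rightarrow> 'b::euclidean_space"
  assumes "continuous_on {s..r} f"
  shows "sq_integrable (lebesgue_on {s..r}) f"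
proof -
  have "bounded (f ` {s..r})"
    using assms by (intro compact_imp_bounded compact_continuous_image) auto
  then obtain B where B: "\<And>x. x \<in> {s..r} \<Longrightarrow> norm (f x) \<le> B"
    unfolding bounded_iff by blast
  show ?thesis
  proof (rule sq_integrable_bound)
    show "sq_integrable (lebesgue_on {s..r}) (\<lambda>x. 1::real)"
      by (rule finite_measure.sq_integrable_const[OF finite_measure_interval])
    show "f \<in> borel_measurable (lebesgue_on {s..r})"
      using assms by (intro continuous_imp_measurable_on_sets_lebesgue) auto
  qed (use B in auto)
qed

lemma has_weak_deriv_iff:
  "has_weak_deriv s r f g \<longleftrightarrow> sq_integrable (lebesgue_on {s..r}) g \<and>
     (\<forall>t\<in>{s..r}. f t = f s + (LINT u|lebesgue_on {s..t}. g u))"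
  by (simp add: has_weak_deriv_def L2_iff_sq_integrable set_integral_eq_lebesgue_on)

lemma has_weak_deriv_sq_integrable: "has_weak_deriv s r f g \<Longrightarrow> sq_integrable (lebesgue_on {s..r}) g"
  by (simp add: has_weak_deriv_iff)

lemma has_weak_derivI:
  assumes "sq_integrable (lebesgue_on {s..r}) g"
    "\<And>t. t \<in> {s..r} \<Longrightarrow> f t = f s + (LINT u|lebesgue_on {s..t}. g u)"
  shows "has_weak_deriv s r f g"
  using assms unfolding has_weak_deriv_iff by blast

lemma has_weak_derivD:
  "has_weak_deriv s r f g \<Longrightarrow> t \<in> {s..r} \<Longrightarrow> f t = f s + (LINT u|lebesgue_on {s..t}. g u)"
  unfolding has_weak_deriv_iff by blast

lemma has_weak_deriv_integrable:
  assumes "has_weak_deriv s r f g" "t \<in> {s..r}"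
  shows "integrable (lebesgue_on {s..t}) g"
  by (rule integrable_subinterval[OF sq_integrable_interval_integrable[OF
        has_weak_deriv_sq_integrable[OF assms(1)]]]) (use assms in auto)

lemma has_weak_deriv_increment:
  assumes "has_weak_deriv s r f g" "s \<le> u" "u \<le> v" "v \<le> r"
  shows "f v - f u = (LINT x|lebesgue_on {u..v}. g x)"
proof -
  have "integrable (lebesgue_on {s..r}) g"
    using has_weak_deriv_sq_integrable[OF assms(1)] by (rule sq_integrable_interval_integrable)
  then have "integrable (lebesgue_on {s..v}) g"
    by (rule integrable_subinterval) (use assms in auto)
  from integral_combine[OF this, of u] show ?thesis
    using has_weak_derivD[OF assms(1), of u] has_weak_derivD[OF assms(1), of v] assms(2-) by simp
qed

text \<open>Cauchy--Schwarz applied to the integral of the derivative. A bound on the derivatives in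
  the mean square thus makes a family equicontinuous, as the Arzela--Ascoli theorem
  requires.\<close>

lemma has_weak_deriv_Hoelder:
  assumes "has_weak_deriv s r f g" "s \<le> u" "u \<le> v" "v \<le> r"
  shows "(norm (f v - f u))\<^sup>2 \<le> (v - u) * (LINT x|lebesgue_on {s..r}. g x \<bullet> g x)"
proof -
  interpret finite_measure "lebesgue_on {u..v}" by (rule finite_measure_interval)
  have sq: "sq_integrable (lebesgue_on {s..r}) g" by (rule has_weak_deriv_sq_integrable[OF assms(1)])
  then have sq': "sq_integrable (lebesgue_on {u..v}) g" by (rule sq_integrable_subinterval) (use assms in auto)
  have "norm (f v - f u) \<le> (LINT x|lebesgue_on {u..v}. norm (g x))"
    unfolding has_weak_deriv_increment[OF assms] by (rule integral_norm_bound)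
  then have "(norm (f v - f u))\<^sup>2 \<le> (LINT x|lebesgue_on {u..v}. norm (g x))\<^sup>2"
    by (intro power_mono) auto
  also have "\<dots> \<le> (v - u) * (LINT x|lebesgue_on {u..v}. g x \<bullet> g x)"
    using L1_le_L2[OF sq'] measure_interval[OF \<open>u \<le> v\<close>] by simp
  also have "\<dots> \<le> (v - u) * (LINT x|lebesgue_on {s..r}. g x \<bullet> g x)"
    using assms integrable_inner_self[OF sq]
    by (intro mult_left_mono integral_mono_lebesgue_on_AE) auto
  finally show ?thesis .
qed

text \<open>The modulus depends on the bound \<open>G\<close> alone and so serves a whole family.
  The summand 1 keeps the quotient positive when \<open>G\<close> is 0.\<close>

lemma has_weak_deriv_modulus:
  assumes f: "has_weak_deriv s r f g" and G: "(LINT x|lebesgue_on {s..r}. g x \<bullet> g x) \<le> G"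
    and uv: "u \<in> {s..r}" "v \<in> {s..r}" and "e > 0" and d: "\<bar>v - u\<bar> < e\<^sup>2 / (G + 1)"
  shows "norm (f v - f u) < e"
proof -
  have G0: "G \<ge> 0" using order_trans[OF sq_integral_nonneg G] .
  have "(norm (f v - f u))\<^sup>2 \<le> \<bar>v - u\<bar> * (LINT x|lebesgue_on {s..r}. g x \<bullet> g x)"
    using has_weak_deriv_Hoelder[OF f, of u v] has_weak_deriv_Hoelder[OF f, of v u] uv
    by (cases "u \<le> v") (auto simp: norm_minus_commute)
  also have "\<dots> \<le> \<bar>v - u\<bar> * (G + 1)" using G by (intro mult_left_mono) auto
  also have "\<dots> < e\<^sup>2" using d G0 by (simp add: pos_less_divide_eq)
  finally show ?thesis using \<open>e > 0\<close> power2_less_imp_less[of "norm (f v - f u)" e] by simp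
qed

lemma has_weak_deriv_continuous:
  assumes "has_weak_deriv s r f g"
  shows "continuous_on {s..r} f"
  unfolding continuous_on_iff
proof (intro ballI allI impI)
  fix u and e :: real assume u: "u \<in> {s..r}" and "e > 0"
  define G where "G = (LINT x|lebesgue_on {s..r}. g x \<bullet> g x)"
  have "G \<ge> 0" unfolding G_def by (rule sq_integral_nonneg)
  then have "e\<^sup>2 / (G + 1) > 0" using \<open>e > 0\<close> by simp
  moreover have "dist (f v) (f u) < e" if "v \<in> {s..r}" "dist v u < e\<^sup>2 / (G + 1)" for v
    unfolding dist_norm
    by (rule has_weak_deriv_modulus[OF assms _ u]) (use that \<open>e > 0\<close> in \<open>auto simp: G_def dist_real_def\<close>)
  ultimately show "\<exists>d>0. \<forall>v\<in>{s..r}. dist v u < d \<longrightarrow> dist (f v) (f u) < e" by blast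
qed

lemma has_weak_deriv_sq_integrable_fun:
  "has_weak_deriv s r f g \<Longrightarrow> sq_integrable (lebesgue_on {s..r}) f"
  by (rule continuous_on_imp_sq_integrable[OF has_weak_deriv_continuous])

text \<open>Both sides of the triangle \<open>u \<le> t\<close> in Fubini's theorem give one half of the formula.\<close>

lemma integral_by_parts:
  assumes f: "has_weak_deriv s r f f'" and h: "has_weak_deriv s r h h'" and "s \<le> r"
  shows "(LINT t|lebesgue_on {s..r}. f t \<bullet> h' t) + (LINT t|lebesgue_on {s..r}. f' t \<bullet> h t) =
    f r \<bullet> h r - f s \<bullet> h s"
proof -
  let ?M = "lebesgue_on {s..r}"
  interpret finite_measure ?M by (rule finite_measure_interval)
  interpret pair_sigma_finite ?M ?M ..
  have sqf': "sq_integrable ?M f'" and sqh': "sq_integrable ?M h'"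
    using f h by (simp_all add: has_weak_deriv_sq_integrable[of s r f] has_weak_deriv_sq_integrable[of s r h])
  have sqf: "sq_integrable ?M f" and sqh: "sq_integrable ?M h"
    using f h by (simp_all add: has_weak_deriv_sq_integrable_fun[of s r _ f'] has_weak_deriv_sq_integrable_fun[of s r _ h'])
  have intf': "integrable ?M f'" and inth': "integrable ?M h'"
    using sqf' sqh' by (simp_all add: sq_integrable_interval_integrable)
  note [measurable] = borel_measurable_integrable[OF intf'] borel_measurable_integrable[OF inth']
  have idm: "(\<lambda>x. x) \<in> borel_measurable ?M"
    using id_borel_measurable_lebesgue_on by (simp add: id_def)
  have [measurable]: "fst \<in> borel_measurable (?M \<Otimes>\<^sub>M ?M)"
    by (rule measurable_compose[OF measurable_fst idm])
  have [measurable]: "snd \<in> borel_measurable (?M \<Otimes>\<^sub>M ?M)"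
    by (rule measurable_compose[OF measurable_snd idm])
  define F where "F = (\<lambda>p :: real \<times> real. if snd p \<le> fst p then f' (snd p) \<bullet> h' (fst p) else 0)"
  have F_meas: "F \<in> borel_measurable (?M \<Otimes>\<^sub>M ?M)" unfolding F_def by measurable
  have F1: "F (t, u) = (indicator {s..t} u *\<^sub>R f' u) \<bullet> h' t" if "u \<in> {s..r}" for t u
    using that by (auto simp: F_def indicator_def)
  have F2: "F (t, u) = f' u \<bullet> (indicator {u..r} t *\<^sub>R h' t)" if "t \<in> {s..r}" for t u
    using that by (auto simp: F_def indicator_def)
  have int1: "integrable ?M (\<lambda>u. indicator {s..t} u *\<^sub>R f' u)" for t
  proof -
    have "{s..t} \<inter> {s..r} \<in> sets ?M" by (simp add: sets_restrict_space_iff)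
    from integrable_mult_indicator[OF this intf'] show ?thesis
      by (subst (asm) Bochner_Integration.integrable_cong[OF refl, where g = "\<lambda>u. indicator {s..t} u *\<^sub>R f' u"])
        (auto simp: indicator_def)
  qed
  have int2: "integrable ?M (\<lambda>t. indicator {u..r} t *\<^sub>R h' t)" for u
  proof -
    have "{u..r} \<inter> {s..r} \<in> sets ?M" by (simp add: sets_restrict_space_iff)
    from integrable_mult_indicator[OF this inth'] show ?thesis
      by (subst (asm) Bochner_Integration.integrable_cong[OF refl, where g = "\<lambda>t. indicator {u..r} t *\<^sub>R h' t"])
        (auto simp: indicator_def)
  qed
  have F_int: "integrable (?M \<Otimes>\<^sub>M ?M) F"
  proof (rule Fubini_integrable[OF F_meas])
    define C where "C = (LINT u|?M. norm (f' u))"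
    have intF: "integrable ?M (\<lambda>u. F (t, u))" for t
    proof -
      have "integrable ?M (\<lambda>u. (indicator {s..t} u *\<^sub>R f' u) \<bullet> h' t)"
        using int1 by (rule integrable_inner_left)
      then show ?thesis
        by (subst Bochner_Integration.integrable_cong[OF refl F1]) auto
    qed
    then show "AE t in ?M. integrable ?M (\<lambda>u. F (t, u))" by simp
    have bnd: "(LINT u|?M. norm (F (t, u))) \<le> C * norm (h' t)" for t
    proof -
      have "(LINT u|?M. norm (F (t, u))) \<le> (LINT u|?M. norm (f' u) * norm (h' t))"
      proof (rule integral_mono)
        show "integrable ?M (\<lambda>u. norm (f' u) * norm (h' t))" using intf' by simp
        show "norm (F (t, u)) \<le> norm (f' u) * norm (h' t)" for u
          using Cauchy_Schwarz_ineq2[of "f' u" "h' t"] by (auto simp: F_def)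
      qed (use intF in auto)
      then show ?thesis by (simp add: C_def)
    qed
    show "integrable ?M (\<lambda>t. LINT u|?M. norm (F (t, u)))"
    proof (rule Bochner_Integration.integrable_bound)
      show "integrable ?M (\<lambda>t. C * norm (h' t))" using inth' by simp
      show "(\<lambda>t. LINT u|?M. norm (F (t, u))) \<in> borel_measurable ?M"
        using F_meas by measurable
      show "AE t in ?M. norm (LINT u|?M. norm (F (t, u))) \<le> norm (C * norm (h' t))"
        using order_trans[OF bnd abs_ge_self] by (simp add: abs_mult)
    qed
  qed
  have inner_u: "(LINT u|?M. F (t, u)) = (f t - f s) \<bullet> h' t" if t: "t \<in> {s..r}" for t
  proof -
    have "(LINT u|?M. F (t, u)) = (LINT u|?M. (indicator {s..t} u *\<^sub>R f' u) \<bullet> h' t)"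
      by (intro Bochner_Integration.integral_cong) (auto simp: F1)
    also have "\<dots> = (LINT u|?M. indicator {s..t} u *\<^sub>R f' u) \<bullet> h' t"
      by (rule integral_inner_left) (rule int1)
    also have "(LINT u|?M. indicator {s..t} u *\<^sub>R f' u) = f t - f s"
      using t integral_lebesgue_on_subinterval[of s t s r f'] has_weak_deriv_increment[OF f, of s t] by simp
    finally show ?thesis .
  qed
  have inner_t: "(LINT t|?M. F (t, u)) = f' u \<bullet> (h r - h u)" if u: "u \<in> {s..r}" for u
  proof -
    have "(LINT t|?M. F (t, u)) = (LINT t|?M. f' u \<bullet> (indicator {u..r} t *\<^sub>R h' t))"
      by (intro Bochner_Integration.integral_cong) (auto simp: F2)
    also have "\<dots> = f' u \<bullet> (LINT t|?M. indicator {u..r} t *\<^sub>R h' t)"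
      by (rule integral_inner_right) (rule int2)
    also have "(LINT t|?M. indicator {u..r} t *\<^sub>R h' t) = h r - h u"
      using u integral_lebesgue_on_subinterval[of u r s r h'] has_weak_deriv_increment[OF h, of u r] by simp
    finally show ?thesis .
  qed
  have "(LINT t|?M. (f t - f s) \<bullet> h' t) = (LINT t|?M. LINT u|?M. F (t, u))"
    by (intro Bochner_Integration.integral_cong) (auto simp: inner_u)
  also have "\<dots> = (LINT u|?M. LINT t|?M. F (t, u))"
    using Fubini_integral[of "\<lambda>t u. F (t, u)"] F_int by simp
  also have "\<dots> = (LINT u|?M. f' u \<bullet> (h r - h u))"
    by (intro Bochner_Integration.integral_cong) (auto simp: inner_t)
  finally have "(LINT t|?M. (f t - f s) \<bullet> h' t) = (LINT u|?M. f' u \<bullet> (h r - h u))" .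
  moreover have "(LINT t|?M. (f t - f s) \<bullet> h' t) = (LINT t|?M. f t \<bullet> h' t) - f s \<bullet> (h r - h s)"
    using inth' has_weak_deriv_increment[OF h, of s r] \<open>s \<le> r\<close>
    by (simp add: inner_diff_left integrable_inner sqf sqh')
  moreover have "(LINT u|?M. f' u \<bullet> (h r - h u)) = (f r - f s) \<bullet> h r - (LINT u|?M. f' u \<bullet> h u)"
    using intf' has_weak_deriv_increment[OF f, of s r] \<open>s \<le> r\<close>
    by (simp add: inner_diff_right integrable_inner sqf' sqh)
  ultimately show ?thesis by (simp add: algebra_simps)
qed

lemma AE_zero_if_integrals_zero:
  fixes g :: "real \<Rightarrow> 'b::euclidean_space"
  assumes int: "integrable (lebesgue_on {s..r}) g"
    and zero: "\<And>t. t \<in> {s..r} \<Longrightarrow> (LINT x|lebesgue_on {s..t}. g x) = 0"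
  shows "AE x in lebesgue_on {s..r}. g x = 0"
proof -
  have "AE x in lebesgue_on {s..r}. g x \<bullet> e = 0" for e
  proof -
    define h where "h = (\<lambda>x. indicator {s..r} x *\<^sub>R (g x \<bullet> e))"
    have inth: "integrable lebesgue h"
      unfolding h_def using int by (subst integrable_restrict_space[symmetric]) auto
    have "(LINT t:{x<..}|lebesgue. h t) = 0" for x
    proof -
      have low: "(LINT t:{..x}|lebesgue. h t) = 0" for x
      proof (cases "s \<le> x \<and> s \<le> r")
        case True
        have "(LINT t:{..x}|lebesgue. h t) = (LINT t:{s..min x r}|lebesgue. g t \<bullet> e)"
          unfolding set_lebesgue_integral_def h_def
          by (intro Bochner_Integration.integral_cong) (auto simp: indicator_def)
        also have "\<dots> = (LINT t|lebesgue_on {s..min x r}. g t \<bullet> e)"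
          by (rule set_integral_eq_lebesgue_on)
        also have "\<dots> = (LINT t|lebesgue_on {s..min x r}. g t) \<bullet> e"
          using int by (intro integral_inner_left impI integrable_subinterval[OF int]) auto
        also have "\<dots> = 0" using zero[of "min x r"] True by simp
        finally show ?thesis .
      next
        case False
        have "(LINT t:{..x}|lebesgue. h t) = integral\<^sup>L lebesgue (\<lambda>t :: real. 0)"
          unfolding set_lebesgue_integral_def h_def
          by (intro Bochner_Integration.integral_cong) (use False in \<open>auto simp: indicator_def\<close>)
        then show ?thesis by simp
      qed
      have si: "set_integrable lebesgue A h" if "A \<in> sets lebesgue" for A
        unfolding set_integrable_def using inth that by (intro integrable_mult_indicator)
      have "(LINT t:{..x} \<union> {x<..}|lebesgue. h t) =
          (LINT t:{..x}|lebesgue. h t) + (LINT t:{x<..}|lebesgue. h t)"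
        by (intro set_integral_Un si) auto
      \<comment> \<open>\<open>h\<close> vanishes beyond \<open>r\<close>, so the integral over the
        line is one up to \<open>max x r\<close>. Integrals over right half-lines are then
        differences of integrals controlled by \<open>low\<close>.\<close>
      moreover have "(LINT t:{..x} \<union> {x<..}|lebesgue. h t) = (LINT t:{..max x r}|lebesgue. h t)"
        unfolding set_lebesgue_integral_def h_def
        by (intro Bochner_Integration.integral_cong) (auto simp: indicator_def)
      ultimately show ?thesis using low[of x] low[of "max x r"] by simp
    qed
    from real_AE_zero_if_integrals_zero[OF inth this] have "AE x in lebesgue. h x = 0" .
    then show ?thesis
      by (simp add: AE_restrict_space_iff h_def) (auto elim!: eventually_mono)
  qed
  then have "AE x in lebesgue_on {s..r}. \<forall>e\<in>Basis. g x \<bullet> e = 0"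
    by (simp add: AE_ball_countable countable_finite)
  then show ?thesis by eventually_elim (auto intro: euclidean_eqI)
qed

text \<open>Makes the choice inside \<open>weak_deriv\<close> immaterial up to null sets.\<close>

lemma has_weak_deriv_unique:
  assumes "has_weak_deriv s r f g" "has_weak_deriv s r f g'"
  shows "AE t in lebesgue_on {s..r}. g t = g' t"
proof -
  have int: "integrable (lebesgue_on {s..r}) g" "integrable (lebesgue_on {s..r}) g'"
    using assms[THEN has_weak_deriv_sq_integrable] by (simp_all add: sq_integrable_interval_integrable)
  have "AE t in lebesgue_on {s..r}. g t - g' t = 0"
  proof (rule AE_zero_if_integrals_zero)
    fix t assume t: "t \<in> {s..r}"
    have "integrable (lebesgue_on {s..t}) g" "integrable (lebesgue_on {s..t}) g'"
      using int[THEN integrable_subinterval, of s t] t by simp_all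
    then show "(LINT x|lebesgue_on {s..t}. g x - g' x) = 0"
      using has_weak_deriv_increment[OF assms(1), of s t] has_weak_deriv_increment[OF assms(2), of s t] t
      by simp
  qed (use int in auto)
  then show ?thesis by simp
qed

section \<open>Operations on weak derivatives, primitives and extension by zero\<close>

lemma has_weak_deriv_add:
  assumes "has_weak_deriv s r f g" "has_weak_deriv s r f' g'"
  shows "has_weak_deriv s r (\<lambda>t. f t + f' t) (\<lambda>t. g t + g' t)"
proof -
  have "f t + f' t = f s + f' s + (LINT x|lebesgue_on {s..t}. g x + g' x)" if "t \<in> {s..r}" for t
  proof -
    have "(LINT x|lebesgue_on {s..t}. g x + g' x) =
        (LINT x|lebesgue_on {s..t}. g x) + (LINT x|lebesgue_on {s..t}. g' x)"
      by (intro Bochner_Integration.integral_add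
          has_weak_deriv_integrable[OF assms(1) that] has_weak_deriv_integrable[OF assms(2) that])
    then show ?thesis
      using has_weak_deriv_increment[OF assms(1), of s t] has_weak_deriv_increment[OF assms(2), of s t] that
      by (simp add: algebra_simps)
  qed
  then show ?thesis
    by (intro has_weak_derivI sq_integrable_add assms[THEN has_weak_deriv_sq_integrable])
qed

lemma has_weak_deriv_linear:
  fixes T :: "complex ^ 'n \<Rightarrow> complex ^ 'n"
  assumes "has_weak_deriv s r f g" "linear T"
  shows "has_weak_deriv s r (\<lambda>t. T (f t)) (\<lambda>t. T (g t))"
proof -
  have T: "bounded_linear T" using assms(2) by (simp add: linear_conv_bounded_linear)
  then obtain K where K: "\<And>x. norm (T x) \<le> norm x * K" using bounded_linear.bounded by blast
  have sq: "sq_integrable (lebesgue_on {s..r}) g" by (rule has_weak_deriv_sq_integrable[OF assms(1)])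
  have [measurable]: "T \<in> borel_measurable borel"
    by (intro borel_measurable_continuous_onI linear_continuous_on T)
  have "sq_integrable (lebesgue_on {s..r}) (\<lambda>t. T (g t))"
    using sq by (rule sq_integrable_bound[where C = K])
      (use sq K in \<open>auto simp: mult.commute dest: sq_integrable_measurable\<close>)
  moreover have "T (f t) = T (f s) + (LINT x|lebesgue_on {s..t}. T (g x))" if "t \<in> {s..r}" for t
  proof -
    have "integrable (lebesgue_on {s..t}) g"
      by (rule has_weak_deriv_integrable[OF assms(1) that])
    from integral_bounded_linear[OF T this]
    have "(LINT x|lebesgue_on {s..t}. T (g x)) = T (f t - f s)"
      using has_weak_deriv_increment[OF assms(1), of s t] that by simp
    then show ?thesis using assms(2) by (simp add: linear_diff)
  qed
  ultimately show ?thesis by (rule has_weak_derivI)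
qed

lemma linear_vec_scale: "linear (\<lambda>v :: complex ^ 'n. c *s v)"
  by (rule linearI) (simp_all add: vec_eq_iff algebra_simps)

lemma has_weak_deriv_scale:
  "has_weak_deriv s r f g \<Longrightarrow> has_weak_deriv s r (\<lambda>t. c *s f t) (\<lambda>t. c *s g t)"
  by (rule has_weak_deriv_linear[OF _ linear_vec_scale])

lemma has_weak_deriv_scaleR:
  "has_weak_deriv s r f g \<Longrightarrow> has_weak_deriv s r (\<lambda>t. k *\<^sub>R f t) (\<lambda>t. k *\<^sub>R g t)"
  by (rule has_weak_deriv_linear) (auto intro: linearI simp: algebra_simps)

lemma has_weak_deriv_zero: "has_weak_deriv s r (\<lambda>t. 0) (\<lambda>t. 0)"
  by (simp add: has_weak_deriv_iff)

lemma has_weak_deriv_sum: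
  "(\<And>i. i \<in> I \<Longrightarrow> has_weak_deriv s r (f i) (g i)) \<Longrightarrow>
     has_weak_deriv s r (\<lambda>t. \<Sum>i\<in>I. f i t) (\<lambda>t. \<Sum>i\<in>I. g i t)"
  by (induction I rule: infinite_finite_induct) (auto simp: has_weak_deriv_zero intro: has_weak_deriv_add)

text \<open>The cutoff puts the primitive into the normal form of \<open>W12\<close>, zero outside
  the interval. Test functions are built in this way.\<close>

lemma has_weak_deriv_primitive:
  fixes g :: "real \<Rightarrow> complex ^ 'n"
  assumes "sq_integrable (lebesgue_on {s..r}) g"
  shows "has_weak_deriv s r (\<lambda>t. if t \<in> {s..r} then c + (LINT x|lebesgue_on {s..t}. g x) else 0) g"
proof -
  have "(LINT x|lebesgue_on {s..s}. g x) = 0"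
    by (intro integral_eq_zero_null_sets) simp
  then show ?thesis using assms by (auto simp: has_weak_deriv_iff)
qed

lemma sq_integrable_indicator:
  fixes f :: "real \<Rightarrow> 'b::euclidean_space"
  assumes f: "sq_integrable (lebesgue_on {u..v}) f" and sub: "{u..v} \<subseteq> {s..r}"
  shows "sq_integrable (lebesgue_on {s..r}) (\<lambda>t. indicator {u..v} t *\<^sub>R f t)"
proof -
  have eq: "(\<lambda>t. indicator {u..v} t *\<^sub>R f t) = (\<lambda>t. if t \<in> {u..v} then f t else 0)"
    by (auto simp: indicator_def)
  have "(\<lambda>t. indicator {u..v} t *\<^sub>R f t) \<in> borel_measurable (lebesgue_on {s..r})"
    unfolding eq using f sub
    by (subst borel_measurable_if_lebesgue_on) (auto simp: sq_integrable_def)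
  moreover have "integrable lebesgue (\<lambda>t. indicator {u..v} t *\<^sub>R (norm (f t))\<^sup>2)"
    using f by (subst integrable_restrict_space[symmetric]) (auto simp: sq_integrable_def)
  moreover have "indicator {u..v} t *\<^sub>R (norm (f t))\<^sup>2 =
      indicator {s..r} t *\<^sub>R (norm (indicator {u..v} t *\<^sub>R f t))\<^sup>2" for t
    using sub by (cases "t \<in> {u..v}") (auto simp: indicator_def)
  ultimately show ?thesis by (simp add: sq_integrable_def integrable_restrict_space)
qed

lemma sq_integrable_extend:
  fixes f :: "real \<Rightarrow> 'b::euclidean_space"
  assumes "sq_integrable (lebesgue_on {u..v}) f" "{u..v} \<subseteq> {s..r}" and out: "\<And>t. t \<notin> {u..v} \<Longrightarrow> f t = 0"
  shows "sq_integrable (lebesgue_on {s..r}) f"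
proof -
  have "(\<lambda>t. indicator {u..v} t *\<^sub>R f t) = f" using out by (auto simp: indicator_def)
  then show ?thesis using sq_integrable_indicator[OF assms(1,2)] by simp
qed

text \<open>Zero values at both ends prevent a jump at \<open>s\<close> or \<open>r\<close>, which
  the integral of a function could not produce. The case \<open>s = r\<close> is included, so that
  empty outer pieces need no separate treatment.\<close>

lemma has_weak_deriv_extend:
  assumes f: "has_weak_deriv s r f g" and "a \<le> s" "s \<le> r" "r \<le> b"
    and out: "\<And>t. t \<notin> {s..r} \<Longrightarrow> f t = 0" and bd: "f s = 0" "f r = 0"
  shows "has_weak_deriv a b f (\<lambda>t. indicator {s..r} t *\<^sub>R g t)"
proof -
  have sq: "sq_integrable (lebesgue_on {s..r}) g" by (rule has_weak_deriv_sq_integrable[OF f])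
  have sq': "sq_integrable (lebesgue_on {a..b}) (\<lambda>t. indicator {s..r} t *\<^sub>R g t)"
    by (rule sq_integrable_indicator[OF sq]) (use assms(2-4) in auto)
  have "f a = 0" using out[of a] bd assms by (cases "a = s") auto
  have "f t = (LINT x|lebesgue_on {a..t}. indicator {s..r} x *\<^sub>R g x)" if t: "t \<in> {a..b}" for t
  proof (cases "t < s")
    case True
    then have "(LINT x|lebesgue_on {a..t}. indicator {s..r} x *\<^sub>R g x) = (LINT x|lebesgue_on {a..t}. 0)"
      by (intro Bochner_Integration.integral_cong) (auto simp: indicator_def)
    then show ?thesis using out[of t] True by simp
  next
    case False
    have "(LINT x|lebesgue_on {a..t}. indicator {s..r} x *\<^sub>R g x) = (LINT x|lebesgue_on {s..min t r}. g x)"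
    proof -
      have "indicator {a..t} x *\<^sub>R (indicator {s..r} x *\<^sub>R g x) = indicator {s..min t r} x *\<^sub>R g x" for x
        using assms by (auto simp: indicator_def)
      then show ?thesis by (simp only: integral_lebesgue_on_indicator)
    qed
    also have "\<dots> = f (min t r) - f s"
      using False assms by (intro has_weak_deriv_increment[OF f, symmetric]) auto
    also have "\<dots> = f t" using bd out[of t] by (auto simp: min_def)
    finally show ?thesis by simp
  qed
  with sq' show ?thesis by (intro has_weak_derivI) (simp_all add: \<open>f a = 0\<close>)
qed

text \<open>Let \<open>Y\<close> be a primitive of \<open>w\<close>. Integration by parts turns the
  hypothesis into orthogonality of \<open>y - Y\<close> to all derivatives of test functions. With
  the right constant of integration \<open>y - Y\<close> is itself such a derivative, hence zero
  almost everywhere.\<close>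

lemma du_Bois_Reymond:
  fixes y w :: "real \<Rightarrow> complex ^ 'n"
  assumes "s < r" and y: "sq_integrable (lebesgue_on {s..r}) y" and w: "sq_integrable (lebesgue_on {s..r}) w"
    and orth: "\<And>h k. has_weak_deriv s r h k \<Longrightarrow> h s = 0 \<Longrightarrow> h r = 0 \<Longrightarrow> (\<And>t. t \<notin> {s..r} \<Longrightarrow> h t = 0) \<Longrightarrow>
       (LINT t|lebesgue_on {s..r}. y t \<bullet> k t) + (LINT t|lebesgue_on {s..r}. w t \<bullet> h t) = 0"
  obtains Y where "has_weak_deriv s r Y w" "\<And>t. t \<notin> {s..r} \<Longrightarrow> Y t = 0"
    "AE t in lebesgue_on {s..r}. y t = Y t"
proof -
  let ?M = "lebesgue_on {s..r}"
  interpret finite_measure ?M by (rule finite_measure_interval)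
  define Y where "Y = (\<lambda>C t. if t \<in> {s..r} then C + (LINT x|lebesgue_on {s..t}. w x) else 0)"
  have Yw: "has_weak_deriv s r (Y C) w" for C unfolding Y_def by (rule has_weak_deriv_primitive[OF w])
  have sqY: "sq_integrable ?M (Y C)" for C using Yw by (rule has_weak_deriv_sq_integrable_fun)
  have intY: "integrable ?M (Y C)" for C using sqY by (rule sq_integrable_interval_integrable)
  have inty: "integrable ?M y" using y by (rule sq_integrable_interval_integrable)
  \<comment> \<open>Chosen so that \<open>y - Y C\<close> has mean zero; then its primitive
    \<open>h\<close> vanishes at \<open>r\<close> as well as at \<open>s\<close>.\<close>
  define C where "C = (1 / (r - s)) *\<^sub>R (LINT t|?M. y t - Y 0 t)"
  define k where "k = (\<lambda>t. y t - Y C t)"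
  have sqk: "sq_integrable ?M k" unfolding k_def by (intro sq_integrable_diff y sqY)
  have k0: "(LINT t|?M. k t) = 0"
  proof -
    have "(LINT t|?M. k t) = (LINT t|?M. (y t - Y 0 t) - C)"
      by (intro Bochner_Integration.integral_cong) (auto simp: k_def Y_def)
    also have "\<dots> = (LINT t|?M. y t - Y 0 t) - (LINT t|?M. C)"
      using inty intY by (intro Bochner_Integration.integral_diff) auto
    also have "(LINT t|?M. C) = (r - s) *\<^sub>R C"
      using measure_interval[of s r] \<open>s < r\<close> by simp
    also have "\<dots> = (LINT t|?M. y t - Y 0 t)" using \<open>s < r\<close> by (simp add: C_def)
    finally show ?thesis by simp
  qed
  define h where "h = (\<lambda>t. if t \<in> {s..r} then 0 + (LINT x|lebesgue_on {s..t}. k x) else 0)"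
  have hk: "has_weak_deriv s r h k" unfolding h_def by (rule has_weak_deriv_primitive[OF sqk])
  have h0: "h s = 0" "h r = 0"
  proof -
    have "(LINT x|lebesgue_on {s..s}. k x) = 0" by (intro integral_eq_zero_null_sets) simp
    then show "h s = 0" "h r = 0" using k0 \<open>s < r\<close> by (auto simp: h_def)
  qed
  have "(LINT t|?M. y t \<bullet> k t) + (LINT t|?M. w t \<bullet> h t) = 0"
    using hk h0 by (rule orth) (auto simp: h_def)
  moreover have "(LINT t|?M. Y C t \<bullet> k t) + (LINT t|?M. w t \<bullet> h t) = 0"
    using integral_by_parts[OF Yw hk, of C] h0 \<open>s < r\<close> by simp
  moreover have "(LINT t|?M. k t \<bullet> k t) = (LINT t|?M. y t \<bullet> k t) - (LINT t|?M. Y C t \<bullet> k t)"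
    unfolding k_def using sqk y sqY
    by (simp add: inner_diff_left integrable_inner sq_integrable_diff)
  ultimately have "(LINT t|?M. k t \<bullet> k t) = 0" by simp
  then have "AE t in ?M. k t \<bullet> k t = 0"
    using integrable_inner_self[OF sqk] by (subst (asm) integral_nonneg_eq_0_iff_AE) auto
  then have "AE t in ?M. y t = Y C t" by eventually_elim (simp add: k_def)
  moreover have "Y C t = 0" if "t \<notin> {s..r}" for t using that by (auto simp: Y_def)
  ultimately show thesis using that[OF Yw, of C] by blast
qed

section \<open>The index form and the eigenspaces\<close>

lemma bilinear_cmat_mult: "bilinear (\<lambda>(A :: real ^ 'n ^ 'n) (x :: complex ^ 'n). cmat A *v x)"
  unfolding bilinear_def
proof (intro conjI allI linearI)
  fix A B :: "real ^ 'n ^ 'n" and x y :: "complex ^ 'n" and k :: real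
  show "cmat A *v (x + y) = cmat A *v x + cmat A *v y" by (rule matrix_vector_right_distrib)
  show "cmat (A + B) *v x = cmat A *v x + cmat B *v x"
    by (simp add: cmat_def map_matrix_def matrix_vector_mult_def vec_eq_iff sum.distrib algebra_simps)
  show "cmat A *v (k *\<^sub>R x) = k *\<^sub>R (cmat A *v x)"
    by (simp add: cmat_def map_matrix_def matrix_vector_mult_def vec_eq_iff scaleR_sum_right)
  show "cmat (k *\<^sub>R A) *v x = k *\<^sub>R (cmat A *v x)"
    by (simp add: cmat_def map_matrix_def matrix_vector_mult_def vec_eq_iff scaleR_sum_right)
       (simp add: scaleR_conv_of_real mult.assoc)
qed

lemma transpose_cmat: "transpose (cmat A) = cmat (transpose A)"
  by (simp add: cmat_def map_matrix_def transpose_def vec_eq_iff)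

lemma cmat_mult_nth: "(cmat A *v x) $ i = (\<Sum>j\<in>UNIV. A $ i $ j *\<^sub>R x $ j)"
  by (simp add: cmat_def map_matrix_def matrix_vector_mult_def scaleR_conv_of_real)

lemma inner_cmat: "(cmat A *v x) \<bullet> y = (\<Sum>i\<in>UNIV. \<Sum>j\<in>UNIV. A $ i $ j * (x $ j \<bullet> y $ i))"
  by (simp add: inner_vec_def cmat_mult_nth inner_sum_left)

lemma inner_cmat_transpose:
  fixes A :: "real ^ 'n ^ 'n"
  shows "(cmat A *v x) \<bullet> y = x \<bullet> (cmat (transpose A) *v y)"
proof -
  have "(cmat A *v x) \<bullet> y = (\<Sum>j\<in>UNIV. \<Sum>i\<in>UNIV. A $ i $ j * (x $ j \<bullet> y $ i))"
    unfolding inner_cmat by (rule sum.swap)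
  also have "\<dots> = (cmat (transpose A) *v y) \<bullet> x"
    unfolding inner_cmat by (simp add: transpose_def inner_commute)
  finally show ?thesis by (simp add: inner_commute)
qed

text \<open>The real inner product has no cross terms between real and imaginary parts, so for a
  real matrix the quadratic form is the sum of its values at both.\<close>

lemma inner_cmat_pos:
  fixes A :: "real ^ 'n ^ 'n"
  assumes pos: "\<And>v. v \<noteq> 0 \<Longrightarrow> v \<bullet> (A *v v) > 0" and "x \<noteq> 0"
  shows "(cmat A *v x) \<bullet> x > 0"
proof -
  define u where "u = (\<chi> i. Re (x $ i))"
  define v where "v = (\<chi> i. Im (x $ i))"
  have *: "w \<bullet> (A *v w) = (\<Sum>i\<in>UNIV. \<Sum>j\<in>UNIV. A $ i $ j * (w $ j * w $ i))" for w
    by (simp add: inner_vec_def matrix_vector_mult_def sum_distrib_left mult_ac)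
  have "(cmat A *v x) \<bullet> x = u \<bullet> (A *v u) + v \<bullet> (A *v v)"
    unfolding inner_cmat * sum.distrib[symmetric]
    by (simp add: u_def v_def inner_complex_def distrib_left)
  moreover have "u \<noteq> 0 \<or> v \<noteq> 0" using \<open>x \<noteq> 0\<close> by (auto simp: u_def v_def vec_eq_iff complex_eq_iff)
  moreover have "w \<bullet> (A *v w) \<ge> 0" for w
    using pos[of w] by (cases "w = 0") (simp_all add: less_imp_le)
  ultimately show ?thesis using pos[of u] pos[of v] by (metis add_nonneg_pos add_pos_nonneg)
qed

lemma cmat_vec_scale: "cmat A *v (k *s x) = k *s (cmat A *v x)"
  by (simp add: cmat_def map_matrix_def matrix_vector_mult_def vec_eq_iff sum_distrib_left algebra_simps)

text \<open>\<open>mom\<close> and \<open>force\<close> are the derivatives of the quadratic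
  Lagrangian in velocity and in position, so the operator is \<open>force\<close> minus the
  derivative of \<open>mom\<close>. In both, the velocity \<open>g\<close> precedes the position
  \<open>x\<close>.\<close>

definition mom :: "(real \<Rightarrow> real ^ 'n ^ 'n) \<Rightarrow> (real \<Rightarrow> real ^ 'n ^ 'n) \<Rightarrow> real \<Rightarrow>
    complex ^ 'n \<Rightarrow> complex ^ 'n \<Rightarrow> complex ^ 'n" where
  "mom P Q t g x = cmat (P t) *v g + cmat (Q t) *v x"

definition force :: "(real \<Rightarrow> real ^ 'n ^ 'n) \<Rightarrow> (real \<Rightarrow> real ^ 'n ^ 'n) \<Rightarrow> real \<Rightarrow>
    complex ^ 'n \<Rightarrow> complex ^ 'n \<Rightarrow> complex ^ 'n" where
  "force Q R t g x = cmat (transpose (Q t)) *v g + cmat (R t) *v x"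

lemma mom_simps:
  "mom P Q t 0 0 = 0" "mom P Q t (g + g') (x + x') = mom P Q t g x + mom P Q t g' x'"
  "mom P Q t (k *s g) (k *s x) = k *s mom P Q t g x"
  and force_simps:
  "force Q R t 0 0 = 0" "force Q R t (g + g') (x + x') = force Q R t g x + force Q R t g' x'"
  "force Q R t (k *s g) (k *s x) = k *s force Q R t g x"
  by (simp_all add: mom_def force_def matrix_vector_right_distrib cmat_vec_scale
      vec.scale_right_distrib algebra_simps)

text \<open>The polarised integrand of the second variation, with position before velocity. The
  derivative is a separate argument because a weak derivative is fixed only up to null sets.\<close>

definition Idens :: "(real \<Rightarrow> real ^ 'n ^ 'n) \<Rightarrow> (real \<Rightarrow> real ^ 'n ^ 'n) \<Rightarrow> (real \<Rightarrow> real ^ 'n ^ 'n) \<Rightarrow> real \<Rightarrow>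
    complex ^ 'n \<Rightarrow> complex ^ 'n \<Rightarrow> complex ^ 'n \<Rightarrow> complex ^ 'n \<Rightarrow> real" where
  "Idens P Q R t x g h k = mom P Q t g x \<bullet> k + force Q R t g x \<bullet> h"

text \<open>The quadratic form with the interval as a parameter, so that several intervals can occur
  in one statement.\<close>

abbreviation energy where
  "energy P Q R s r f g \<equiv> LINT t|lebesgue_on {s..r}. Idens P Q R t (f t) (g t) (f t) (g t)"

lemma Idens_add_left: "Idens P Q R t (x + x') (g + g') h k = Idens P Q R t x g h k + Idens P Q R t x' g' h k"
  by (simp add: Idens_def mom_simps force_simps inner_add_left)

lemma Idens_add_right: "Idens P Q R t x g (h + h') (k + k') = Idens P Q R t x g h k + Idens P Q R t x g h' k'"
  by (simp add: Idens_def inner_add_right)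

lemma Idens_scale_right: "Idens P Q R t x g (a *\<^sub>R h) (a *\<^sub>R k) = a * Idens P Q R t x g h k"
  by (simp add: Idens_def algebra_simps)

lemma Idens_zero: "Idens P Q R t 0 0 h k = 0" "Idens P Q R t x g 0 0 = 0"
  by (simp_all add: Idens_def mom_simps force_simps)

lemma Idens_sym:
  assumes "transpose (P t) = P t" "transpose (R t) = R t"
  shows "Idens P Q R t x g h k = Idens P Q R t h k x g"
proof -
  have "(cmat (P t) *v g) \<bullet> k = (cmat (P t) *v k) \<bullet> g" "(cmat (R t) *v x) \<bullet> h = (cmat (R t) *v h) \<bullet> x"
    "(cmat (Q t) *v x) \<bullet> k = (cmat (transpose (Q t)) *v k) \<bullet> x"
    "(cmat (transpose (Q t)) *v g) \<bullet> h = (cmat (Q t) *v h) \<bullet> g"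
    using inner_cmat_transpose[of "P t" g k] inner_cmat_transpose[of "R t" x h]
      inner_cmat_transpose[of "Q t" x k] inner_cmat_transpose[of "Q t" h g] assms
    by (simp_all add: inner_commute)
  then show ?thesis by (simp add: Idens_def mom_def force_def inner_add_left)
qed

text \<open>The set where the functions differ inside the interval is open and null, hence empty;
  continuity covers the endpoints. This pins down the momentum, whose endpoint values enter the
  boundary condition.\<close>

lemma AE_eq_continuous_imp_eq:
  fixes f g :: "real \<Rightarrow> 'b::euclidean_space"
  assumes "s < r" "continuous_on {s..r} f" "continuous_on {s..r} g"
    and ae: "AE t in lebesgue_on {s..r}. f t = g t" and "t \<in> {s..r}"
  shows "f t = g t"
proof -
  let ?S = "{t \<in> {s<..<r}. f t - g t \<noteq> 0}"
  have cd: "continuous_on {s..r} (\<lambda>t. f t - g t)" using assms by (intro continuous_on_diff)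
  then have "continuous_on {s<..<r} (\<lambda>t. f t - g t)" by (rule continuous_on_subset) auto
  then have "open ({s<..<r} \<inter> (\<lambda>t. f t - g t) -` (- {0}))"
    by (intro continuous_open_preimage) auto
  moreover have "{s<..<r} \<inter> (\<lambda>t. f t - g t) -` (- {0}) = ?S" by auto
  ultimately have "open ?S" by simp
  moreover have "negligible ?S"
  proof -
    have "AE t in lebesgue. t \<notin> ?S"
      using ae by (simp add: AE_restrict_space_iff) (auto elim!: eventually_mono)
    then have "?S \<in> null_sets lebesgue"
      using \<open>open ?S\<close> by (subst AE_iff_null_sets) (auto simp: lebesgue_openin)
    then show ?thesis by (simp add: negligible_iff_null_sets)
  qed
  ultimately have S: "?S = {}" using open_not_negligible by blast
  have cl: "closure {s<..<r} = {s..r}" using \<open>s < r\<close> by simp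
  have "f t - g t = 0"
    by (rule continuous_constant_on_closure[of "{s<..<r}"]) (use S cl cd \<open>t \<in> {s..r}\<close> in auto)
  then show ?thesis by simp
qed

lemma continuous_sq_integral_zero:
  fixes f :: "real \<Rightarrow> 'b::euclidean_space"
  assumes "s < r" "continuous_on {s..r} f" "(LINT t|lebesgue_on {s..r}. f t \<bullet> f t) \<le> 0" "t \<in> {s..r}"
  shows "f t = 0"
proof -
  have "integrable (lebesgue_on {s..r}) (\<lambda>t. f t \<bullet> f t)"
    by (intro integrable_inner_self continuous_on_imp_sq_integrable assms)
  moreover have "(LINT t|lebesgue_on {s..r}. f t \<bullet> f t) = 0"
    using assms(3) sq_integral_nonneg[of "lebesgue_on {s..r}" f] by (rule antisym)
  ultimately have "AE t in lebesgue_on {s..r}. f t \<bullet> f t = 0"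
    by (subst (asm) integral_nonneg_eq_0_iff_AE) auto
  then have "AE t in lebesgue_on {s..r}. f t = 0" by simp
  from AE_eq_continuous_imp_eq[OF assms(1,2) continuous_on_const this assms(4)] show ?thesis .
qed

text \<open>The eigenvalue equation as a first-order system with explicit witnesses in place of the
  choices made by \<open>weak_deriv\<close> and \<open>momentum\<close>. In this form it is visibly
  closed under linear combinations.\<close>

definition SL_solution where
  "SL_solution P Q R s r \<mu> \<xi> g y y' \<longleftrightarrow>
     has_weak_deriv s r \<xi> g \<and> has_weak_deriv s r y y' \<and>
     (\<forall>t. t \<notin> {s..r} \<longrightarrow> \<xi> t = 0) \<and> (\<forall>t. t \<notin> {s..r} \<longrightarrow> y t = 0) \<and>
     (AE t in lebesgue_on {s..r}. y t = mom P Q t (g t) (\<xi> t)) \<and>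
     (AE t in lebesgue_on {s..r}. y' t = force Q R t (g t) (\<xi> t) - complex_of_real \<mu> *s \<xi> t)"

lemma SL_solutionD:
  assumes "SL_solution P Q R s r \<mu> \<xi> g y y'"
  shows "has_weak_deriv s r \<xi> g" "has_weak_deriv s r y y'"
    "\<And>t. t \<notin> {s..r} \<Longrightarrow> \<xi> t = 0" "\<And>t. t \<notin> {s..r} \<Longrightarrow> y t = 0"
    "AE t in lebesgue_on {s..r}. y t = mom P Q t (g t) (\<xi> t)"
    "AE t in lebesgue_on {s..r}. y' t = force Q R t (g t) (\<xi> t) - complex_of_real \<mu> *s \<xi> t"
  using assms unfolding SL_solution_def by blast+

lemma weak_deriv_some:
  assumes "has_weak_deriv s r \<xi> g"
  shows "has_weak_deriv s r \<xi> (weak_deriv s r \<xi>)"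
  unfolding weak_deriv_def by (rule someI[where P = "has_weak_deriv s r \<xi>", OF assms])

text \<open>The chosen derivatives agree with the witnesses almost everywhere. The chosen momentum
  agrees with \<open>y\<close> everywhere, since both are continuous on the interval and zero
  outside it.\<close>

lemma SL_eigenspace_iff:
  assumes "s < r"
  shows "\<xi> \<in> SL_eigenspace P Q R s r \<Lambda> \<mu> \<longleftrightarrow>
    (\<exists>g y y'. SL_solution P Q R s r \<mu> \<xi> g y y' \<and> bdry (y s) (\<xi> s) (y r) (\<xi> r) \<in> \<Lambda>)"
proof
  assume xi: "\<xi> \<in> SL_eigenspace P Q R s r \<Lambda> \<mu>"
  define g where "g = weak_deriv s r \<xi>"
  define y where "y = momentum P Q s r \<xi>"
  define y' where "y' = weak_deriv s r y"
  have W: "\<xi> \<in> W12 s r" and ex: "\<exists>y. is_momentum P Q s r \<xi> y"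
    and bd: "vjoin (phase_curve P Q s r \<xi> s) (phase_curve P Q s r \<xi> r) \<in> \<Lambda>"
    and eq: "AE t in lebesgue_on {s..r}. SL_op P Q R s r \<xi> t = complex_of_real \<mu> *s \<xi> t"
    using xi by (auto simp: SL_eigenspace_def SL_domain_def)
  have ym: "is_momentum P Q s r \<xi> y" unfolding y_def momentum_def by (rule someI_ex[OF ex])
  have "has_weak_deriv s r \<xi> g" using W weak_deriv_some unfolding W12_def g_def by blast
  moreover have "has_weak_deriv s r y y'"
    using ym weak_deriv_some unfolding is_momentum_def W12_def y'_def by blast
  moreover have "\<forall>t. t \<notin> {s..r} \<longrightarrow> \<xi> t = 0" using W unfolding W12_def by blast
  moreover have "\<forall>t. t \<notin> {s..r} \<longrightarrow> y t = 0" using ym unfolding is_momentum_def W12_def by blast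
  moreover have "AE t in lebesgue_on {s..r}. y t = mom P Q t (g t) (\<xi> t)"
    using ym unfolding is_momentum_def mom_def g_def by blast
  moreover have "AE t in lebesgue_on {s..r}. y' t = force Q R t (g t) (\<xi> t) - complex_of_real \<mu> *s \<xi> t"
    using eq
  proof eventually_elim
    case (elim t)
    have "SL_op P Q R s r \<xi> t = - y' t + force Q R t (g t) (\<xi> t)"
      by (simp add: SL_op_def force_def g_def y'_def y_def transpose_cmat)
    then show ?case using elim by (simp add: algebra_simps)
  qed
  ultimately have "SL_solution P Q R s r \<mu> \<xi> g y y'" unfolding SL_solution_def by blast
  moreover have "bdry (y s) (\<xi> s) (y r) (\<xi> r) \<in> \<Lambda>"
    using bd by (simp add: phase_curve_def bdry_def y_def)
  ultimately show "\<exists>g y y'. SL_solution P Q R s r \<mu> \<xi> g y y' \<and> bdry (y s) (\<xi> s) (y r) (\<xi> r) \<in> \<Lambda>" by blast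
next
  assume "\<exists>g y y'. SL_solution P Q R s r \<mu> \<xi> g y y' \<and> bdry (y s) (\<xi> s) (y r) (\<xi> r) \<in> \<Lambda>"
  then obtain g y y' where sol: "SL_solution P Q R s r \<mu> \<xi> g y y'"
    and bd: "bdry (y s) (\<xi> s) (y r) (\<xi> r) \<in> \<Lambda>" by blast
  note sol = SL_solutionD[OF sol]
  have W: "\<xi> \<in> W12 s r" unfolding W12_def using sol(1,3) by blast
  have g: "AE t in lebesgue_on {s..r}. g t = weak_deriv s r \<xi> t"
    using has_weak_deriv_unique[OF sol(1) weak_deriv_some[OF sol(1)]] .
  have "AE t in lebesgue_on {s..r}. y t = cmat (P t) *v weak_deriv s r \<xi> t + cmat (Q t) *v \<xi> t"
    using sol(5) g by eventually_elim (simp add: mom_def)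
  moreover have "y \<in> W12 s r" unfolding W12_def using sol(2,4) by blast
  ultimately have "is_momentum P Q s r \<xi> y" unfolding is_momentum_def by blast
  then have mm: "is_momentum P Q s r \<xi> (momentum P Q s r \<xi>)" (is "is_momentum _ _ _ _ _ ?m")
    unfolding momentum_def by (rule someI[where P = "is_momentum P Q s r \<xi>"])
  obtain m' where m': "has_weak_deriv s r ?m m'" and m0: "\<And>t. t \<notin> {s..r} \<Longrightarrow> ?m t = 0"
    using mm unfolding is_momentum_def W12_def by blast
  have "AE t in lebesgue_on {s..r}. ?m t = cmat (P t) *v weak_deriv s r \<xi> t + cmat (Q t) *v \<xi> t"
    using mm unfolding is_momentum_def by blast
  then have "AE t in lebesgue_on {s..r}. ?m t = y t"
    using sol(5) g by eventually_elim (simp add: mom_def)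
  then have "?m t = y t" if "t \<in> {s..r}" for t
    using AE_eq_continuous_imp_eq[OF assms has_weak_deriv_continuous[OF m'] has_weak_deriv_continuous[OF sol(2)]] that
    by blast
  then have my: "?m = y" using m0 sol(4) by (intro ext) metis
  have "AE t in lebesgue_on {s..r}. y' t = weak_deriv s r y t"
    using has_weak_deriv_unique[OF sol(2) weak_deriv_some[OF sol(2)]] .
  then have "AE t in lebesgue_on {s..r}. SL_op P Q R s r \<xi> t = complex_of_real \<mu> *s \<xi> t"
    using g sol(6)
  proof eventually_elim
    case (elim t)
    have "SL_op P Q R s r \<xi> t = - y' t + force Q R t (g t) (\<xi> t)"
      using elim(1,2) by (simp add: SL_op_def my force_def transpose_cmat)
    then show ?case using elim(3) by simp
  qed
  then show "\<xi> \<in> SL_eigenspace P Q R s r \<Lambda> \<mu>"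
    using W mm bd unfolding SL_eigenspace_def SL_domain_def
    by (auto simp: phase_curve_def my bdry_def)
qed

lemma SL_solution_add:
  assumes "SL_solution P Q R s r \<mu> \<xi> g y y'" "SL_solution P Q R s r \<mu> \<xi>2 g2 y2 y2'"
  shows "SL_solution P Q R s r \<mu> (\<lambda>t. \<xi> t + \<xi>2 t) (\<lambda>t. g t + g2 t) (\<lambda>t. y t + y2 t) (\<lambda>t. y' t + y2' t)"
  unfolding SL_solution_def
proof (intro conjI)
  note a = SL_solutionD[OF assms(1)] and b = SL_solutionD[OF assms(2)]
  show "AE t in lebesgue_on {s..r}. y t + y2 t = mom P Q t (g t + g2 t) (\<xi> t + \<xi>2 t)"
    using a(5) b(5) by eventually_elim (simp add: mom_simps)
  show "AE t in lebesgue_on {s..r}. y' t + y2' t =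
      force Q R t (g t + g2 t) (\<xi> t + \<xi>2 t) - complex_of_real \<mu> *s (\<xi> t + \<xi>2 t)"
    using a(6) b(6) by eventually_elim (simp add: force_simps vec.scale_right_distrib)
  show "has_weak_deriv s r (\<lambda>t. \<xi> t + \<xi>2 t) (\<lambda>t. g t + g2 t)" "has_weak_deriv s r (\<lambda>t. y t + y2 t) (\<lambda>t. y' t + y2' t)"
    using a(1,2) b(1,2) by (simp_all add: has_weak_deriv_add)
qed (use SL_solutionD(3,4)[OF assms(1)] SL_solutionD(3,4)[OF assms(2)] in auto)

lemma SL_solution_scale:
  assumes "SL_solution P Q R s r \<mu> \<xi> g y y'"
  shows "SL_solution P Q R s r \<mu> (\<lambda>t. k *s \<xi> t) (\<lambda>t. k *s g t) (\<lambda>t. k *s y t) (\<lambda>t. k *s y' t)"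
  unfolding SL_solution_def
proof (intro conjI)
  note a = SL_solutionD[OF assms(1)]
  show "AE t in lebesgue_on {s..r}. k *s y t = mom P Q t (k *s g t) (k *s \<xi> t)"
    using a(5) by eventually_elim (simp add: mom_simps)
  show "AE t in lebesgue_on {s..r}. k *s y' t = force Q R t (k *s g t) (k *s \<xi> t) - complex_of_real \<mu> *s (k *s \<xi> t)"
    using a(6) by eventually_elim (simp add: force_simps vec.scale_right_diff_distrib mult.commute)
  show "has_weak_deriv s r (\<lambda>t. k *s \<xi> t) (\<lambda>t. k *s g t)" "has_weak_deriv s r (\<lambda>t. k *s y t) (\<lambda>t. k *s y' t)"
    using a(1,2) by (simp_all add: has_weak_deriv_scale)
qed (use SL_solutionD(3,4)[OF assms(1)] in auto)

lemma SL_solution_zero: "SL_solution P Q R s r \<mu> (\<lambda>t. 0) (\<lambda>t. 0) (\<lambda>t. 0) (\<lambda>t. 0)"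
  by (simp add: SL_solution_def has_weak_deriv_zero mom_simps force_simps)

lemma cfun_sum_apply: "(\<Sum>i\<in>I. f i) t = (\<Sum>i\<in>I. f i t)" for f :: "'i \<Rightarrow> real \<Rightarrow> complex ^ 'n"
  by (induction I rule: infinite_finite_induct) auto

lemma SL_eigenspace_subspace:
  fixes P Q R :: "real \<Rightarrow> real ^ 'n ^ 'n"
  assumes "s < r" "vec.subspace \<Lambda>"
  shows "cfun.subspace (SL_eigenspace P Q R s r \<Lambda> \<mu>)"
proof (rule cfun.subspaceI)
  show "0 \<in> SL_eigenspace P Q R s r \<Lambda> \<mu>"
    unfolding SL_eigenspace_iff[OF assms(1)]
    using SL_solution_zero[of P Q R s r \<mu>] vec.subspace_0[OF assms(2)]
    by (intro exI[of _ "\<lambda>t. 0"]) (simp add: zero_fun_def bdry_zero)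
next
  fix f h assume "f \<in> SL_eigenspace P Q R s r \<Lambda> \<mu>" "h \<in> SL_eigenspace P Q R s r \<Lambda> \<mu>"
  then obtain g y y' g2 y2 y2' where
    a: "SL_solution P Q R s r \<mu> f g y y'" "bdry (y s) (f s) (y r) (f r) \<in> \<Lambda>"
    and b: "SL_solution P Q R s r \<mu> h g2 y2 y2'" "bdry (y2 s) (h s) (y2 r) (h r) \<in> \<Lambda>"
    unfolding SL_eigenspace_iff[OF assms(1)] by blast
  show "f + h \<in> SL_eigenspace P Q R s r \<Lambda> \<mu>"
    unfolding SL_eigenspace_iff[OF assms(1)]
    using SL_solution_add[OF a(1) b(1)] vec.subspace_add[OF assms(2) a(2) b(2)]
    by (intro exI conjI) (auto simp: plus_fun_def bdry_add)
next
  fix k f assume "f \<in> SL_eigenspace P Q R s r \<Lambda> \<mu>"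
  then obtain g y y' where
    a: "SL_solution P Q R s r \<mu> f g y y'" "bdry (y s) (f s) (y r) (f r) \<in> \<Lambda>"
    unfolding SL_eigenspace_iff[OF assms(1)] by blast
  show "(\<lambda>t. k *s f t) \<in> SL_eigenspace P Q R s r \<Lambda> \<mu>"
    unfolding SL_eigenspace_iff[OF assms(1)]
    using SL_solution_scale[OF a(1), of k] vec.subspace_scale[OF assms(2) a(2), of k]
    by (intro exI conjI) (auto simp: bdry_scale)
qed

text \<open>The interval belongs to the locale because the locale is instantiated both on
  \<open>[a, b]\<close> and on each nondegenerate subinterval.\<close>

locale SL_system =
  fixes P Q R :: "real \<Rightarrow> real ^ 'n ^ 'n" and s r :: real
  assumes less: "s < r"
    and contP: "continuous_on {s..r} P" and contQ: "continuous_on {s..r} Q" and contR: "continuous_on {s..r} R"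
    and symP: "\<And>t. t \<in> {s..r} \<Longrightarrow> transpose (P t) = P t"
    and posP: "\<And>t v. t \<in> {s..r} \<Longrightarrow> v \<noteq> 0 \<Longrightarrow> v \<bullet> (P t *v v) > 0"
    and symR: "\<And>t. t \<in> {s..r} \<Longrightarrow> transpose (R t) = R t"
begin

abbreviation "M \<equiv> lebesgue_on {s..r}"

lemma contQT: "continuous_on {s..r} (\<lambda>t. transpose (Q t))"
  unfolding transpose_def using contQ
  by (intro continuous_on_vec_lambda continuous_intros)

lemma cmat_bound:
  fixes A :: "real \<Rightarrow> real ^ 'n ^ 'n"
  assumes "continuous_on {s..r} A"
  obtains K where "K \<ge> 0" "\<And>t x. t \<in> {s..r} \<Longrightarrow> norm (cmat (A t) *v x) \<le> K * norm x"
proof -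
  obtain B where B: "B > 0" "\<And>(A :: real ^ 'n ^ 'n) x. norm (cmat A *v x) \<le> B * norm A * norm x"
    using bilinear_bounded_pos[OF bilinear_cmat_mult] by blast
  have "bounded (A ` {s..r})"
    using assms by (intro compact_imp_bounded compact_continuous_image) auto
  then obtain C where C: "C > 0" "\<And>t. t \<in> {s..r} \<Longrightarrow> norm (A t) \<le> C"
    unfolding bounded_pos by blast
  show thesis
  proof (rule that[of "B * C"])
    show "norm (cmat (A t) *v x) \<le> B * C * norm x" if "t \<in> {s..r}" for t x
    proof -
      have "norm (cmat (A t) *v x) \<le> B * norm (A t) * norm x" by (rule B(2))
      also have "\<dots> \<le> B * C * norm x"
        using B(1) C(2)[OF that] by (intro mult_right_mono mult_left_mono) auto
      finally show ?thesis .
    qed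
  qed (use B(1) C(1) in auto)
qed

lemma sq_integrable_cmat:
  fixes A :: "real \<Rightarrow> real ^ 'n ^ 'n"
  assumes "continuous_on {s..r} A" "sq_integrable M g"
  shows "sq_integrable M (\<lambda>t. cmat (A t) *v g t)"
proof -
  obtain K where K: "K \<ge> 0" "\<And>t x. t \<in> {s..r} \<Longrightarrow> norm (cmat (A t) *v x) \<le> K * norm x"
    using cmat_bound[OF assms(1)] by blast
  have m: "(\<lambda>t. cmat (A t) *v g t) \<in> borel_measurable M"
    by (rule borel_measurable_bilinear[OF bilinear_cmat_mult])
      (use assms in \<open>auto intro: continuous_imp_measurable_on_sets_lebesgue dest: sq_integrable_measurable\<close>)
  show ?thesis by (rule sq_integrable_bound[OF assms(2) m, where C = K]) (use K in simp)
qed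

lemma sq_integrable_mom: "sq_integrable M g \<Longrightarrow> sq_integrable M f \<Longrightarrow> sq_integrable M (\<lambda>t. mom P Q t (g t) (f t))"
  unfolding mom_def by (intro sq_integrable_add sq_integrable_cmat contP contQ)

lemma sq_integrable_force: "sq_integrable M g \<Longrightarrow> sq_integrable M f \<Longrightarrow> sq_integrable M (\<lambda>t. force Q R t (g t) (f t))"
  unfolding force_def by (intro sq_integrable_add sq_integrable_cmat contQT contR)

text \<open>The constant is the minimum of the form on the product of the interval and the unit
  sphere, positive by compactness; homogeneity does the rest.\<close>

lemma elliptic:
  obtains c where "c > 0" "\<And>t x. t \<in> {s..r} \<Longrightarrow> (cmat (P t) *v x) \<bullet> x \<ge> c * (norm x)\<^sup>2"
proof -
  let ?K = "{s..r} \<times> sphere (0 :: complex ^ 'n) 1"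
  let ?F = "\<lambda>p. (cmat (P (fst p)) *v snd p) \<bullet> snd p"
  have "continuous_on ?K (\<lambda>p. cmat (P (fst p)) *v snd p)"
    by (rule bilinear_continuous_on_compose[OF _ _ bilinear_cmat_mult])
      (auto intro!: continuous_intros continuous_on_compose2[OF contP])
  then have "continuous_on ?K ?F" by (intro continuous_intros)
  moreover have "compact ?K" by (intro compact_Times) auto
  moreover have "?K \<noteq> {}"
  proof -
    obtain e :: "complex ^ 'n" where "norm e = 1" using vector_choose_size[of 1] by auto
    then have "(s, e) \<in> ?K" using less by simp
    then show ?thesis by blast
  qed
  ultimately obtain p where p: "p \<in> ?K" "\<And>q. q \<in> ?K \<Longrightarrow> ?F p \<le> ?F q"
    using continuous_attains_inf[of ?K ?F] by blast
  have "?F p > 0"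
    using p(1) posP by (intro inner_cmat_pos) (auto simp: mem_Times_iff)
  moreover have "(cmat (P t) *v x) \<bullet> x \<ge> ?F p * (norm x)\<^sup>2" if "t \<in> {s..r}" for t x
  proof (cases "x = 0")
    case False
    define e where "e = (1 / norm x) *\<^sub>R x"
    have "?F p \<le> (cmat (P t) *v e) \<bullet> e"
      using p(2)[of "(t, e)"] that False by (simp add: e_def)
    then have "?F p * (norm x)\<^sup>2 \<le> ((cmat (P t) *v e) \<bullet> e) * (norm x)\<^sup>2" by (intro mult_right_mono) auto
    also have "\<dots> = (cmat (P t) *v (norm x *\<^sub>R e)) \<bullet> (norm x *\<^sub>R e)"
      using bilinear_rmul[OF bilinear_cmat_mult, of "P t"] by (simp add: power2_eq_square)
    also have "norm x *\<^sub>R e = x" using False by (simp add: e_def)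
    finally show ?thesis .
  qed (simp add: matrix_vector_mult_0_right)
  ultimately show thesis using that by blast
qed

text \<open>A pointwise Garding inequality: half of the elliptic constant is spent on absorbing the
  mixed terms.\<close>

lemma Idens_coercive:
  obtains c K where "c > 0" "K > 0"
    "\<And>t x g. t \<in> {s..r} \<Longrightarrow> Idens P Q R t x g x g \<ge> c * (norm g)\<^sup>2 - K * (norm x)\<^sup>2"
proof -
  obtain c where c: "c > 0" "\<And>t x. t \<in> {s..r} \<Longrightarrow> (cmat (P t) *v x) \<bullet> x \<ge> c * (norm x)\<^sup>2"
    by (rule elliptic) blast
  obtain q where q: "q \<ge> 0" "\<And>t x. t \<in> {s..r} \<Longrightarrow> norm (cmat (Q t) *v x) \<le> q * norm x"
    by (rule cmat_bound[OF contQ]) blast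
  obtain \<rho> where \<rho>: "\<rho> \<ge> 0" "\<And>t x. t \<in> {s..r} \<Longrightarrow> norm (cmat (R t) *v x) \<le> \<rho> * norm x"
    by (rule cmat_bound[OF contR]) blast
  show thesis
  \<comment> \<open>The coefficient \<open>2 * q\<^sup>2 / c\<close> arises from completing the
    square in \<open>(c * norm g - 2 * q * norm x)\<^sup>2 / (2 * c)\<close>. The summand 1 makes
    the second constant positive.\<close>
  proof (rule that[of "c / 2" "2 * q\<^sup>2 / c + \<rho> + 1"])
    fix t and x g :: "complex ^ 'n" assume t: "t \<in> {s..r}"
    have Qt: "(cmat (transpose (Q t)) *v g) \<bullet> x = (cmat (Q t) *v x) \<bullet> g"
      using inner_cmat_transpose[of "Q t" x g] by (simp add: inner_commute)
    have "\<bar>(cmat (Q t) *v x) \<bullet> g\<bar> \<le> norm (cmat (Q t) *v x) * norm g" by (rule Cauchy_Schwarz_ineq2)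
    also have "\<dots> \<le> q * norm x * norm g" using q(2)[OF t] by (intro mult_right_mono) auto
    finally have 1: "(cmat (Q t) *v x) \<bullet> g \<ge> - (q * norm x * norm g)" by linarith
    have "\<bar>(cmat (R t) *v x) \<bullet> x\<bar> \<le> norm (cmat (R t) *v x) * norm x" by (rule Cauchy_Schwarz_ineq2)
    also have "\<dots> \<le> \<rho> * norm x * norm x" using \<rho>(2)[OF t] by (intro mult_right_mono) auto
    finally have 2: "(cmat (R t) *v x) \<bullet> x \<ge> - (\<rho> * (norm x)\<^sup>2)" by (simp add: power2_eq_square)
    have "0 \<le> (c * norm g - 2 * q * norm x)\<^sup>2 / (2 * c)" using c(1) by simp
    also have "\<dots> = (c / 2) * (norm g)\<^sup>2 - 2 * (q * norm x * norm g) + 2 * q\<^sup>2 / c * (norm x)\<^sup>2"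
      using c(1) by (simp add: power2_eq_square field_simps)
    finally have 3: "2 * (q * norm x * norm g) \<le> (c / 2) * (norm g)\<^sup>2 + 2 * q\<^sup>2 / c * (norm x)\<^sup>2" by simp
    have "Idens P Q R t x g x g =
        (cmat (P t) *v g) \<bullet> g + 2 * ((cmat (Q t) *v x) \<bullet> g) + (cmat (R t) *v x) \<bullet> x"
      by (simp add: Idens_def mom_def force_def inner_add_left Qt)
    moreover have "(2 * q\<^sup>2 / c + \<rho> + 1) * (norm x)\<^sup>2 = 2 * q\<^sup>2 / c * (norm x)\<^sup>2 + \<rho> * (norm x)\<^sup>2 + (norm x)\<^sup>2"
      by (simp add: algebra_simps)
    ultimately show "c / 2 * (norm g)\<^sup>2 - (2 * q\<^sup>2 / c + \<rho> + 1) * (norm x)\<^sup>2 \<le> Idens P Q R t x g x g"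
      using 1 2 3 c(2)[OF t, of g] zero_le_power2[of "norm x"] by linarith
  qed (use c(1) q(1) \<rho>(1) in \<open>auto intro!: add_nonneg_pos\<close>)
qed

definition Iform where
  "Iform f g h k = (LINT t|M. Idens P Q R t (f t) (g t) (h t) (k t))"

lemma Idens_integrable:
  assumes "sq_integrable M f" "sq_integrable M g" "sq_integrable M h" "sq_integrable M k"
  shows "integrable M (\<lambda>t. Idens P Q R t (f t) (g t) (h t) (k t))"
  unfolding Idens_def
  by (intro Bochner_Integration.integrable_add integrable_inner sq_integrable_mom sq_integrable_force assms)

lemma Iform_sym: "Iform f g h k = Iform h k f g"
  unfolding Iform_def by (intro Bochner_Integration.integral_cong Idens_sym symP symR) auto

lemma Iform_add_left:
  assumes "sq_integrable M f" "sq_integrable M g" "sq_integrable M f'" "sq_integrable M g'"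
    "sq_integrable M h" "sq_integrable M k"
  shows "Iform (\<lambda>t. f t + f' t) (\<lambda>t. g t + g' t) h k = Iform f g h k + Iform f' g' h k"
  unfolding Iform_def Idens_add_left
  by (intro Bochner_Integration.integral_add Idens_integrable assms)

lemma Iform_add_right:
  assumes "sq_integrable M f" "sq_integrable M g" "sq_integrable M f'" "sq_integrable M g'"
    "sq_integrable M h" "sq_integrable M k"
  shows "Iform h k (\<lambda>t. f t + f' t) (\<lambda>t. g t + g' t) = Iform h k f g + Iform h k f' g'"
  unfolding Iform_def Idens_add_right
  by (intro Bochner_Integration.integral_add Idens_integrable assms)

lemma Iform_scale_right: "Iform h k (\<lambda>t. a *\<^sub>R f t) (\<lambda>t. a *\<^sub>R g t) = a * Iform h k f g"
  unfolding Iform_def Idens_scale_right by simp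

text \<open>Integration by parts for the momentum \<open>y\<close>. The test function
  \<open>h\<close> need not vanish at the ends, and all influence of the boundary condition sits in
  the last term.\<close>

lemma Green:
  assumes sol: "SL_solution P Q R s r \<mu> \<xi> g y y'" and h: "has_weak_deriv s r h k"
  shows "Iform \<xi> g h k = \<mu> * (LINT t|M. \<xi> t \<bullet> h t) + (y r \<bullet> h r - y s \<bullet> h s)"
proof -
  note a = SL_solutionD[OF sol]
  have sq: "sq_integrable M \<xi>" "sq_integrable M g" "sq_integrable M y" "sq_integrable M y'"
    "sq_integrable M h" "sq_integrable M k"
    using a(1,2) h has_weak_deriv_sq_integrable has_weak_deriv_sq_integrable_fun by blast+
  have int: "integrable M (\<lambda>t. y t \<bullet> k t)" "integrable M (\<lambda>t. y' t \<bullet> h t)" "integrable M (\<lambda>t. \<xi> t \<bullet> h t)"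
    by (intro integrable_inner sq)+
  have "Iform \<xi> g h k = (LINT t|M. y t \<bullet> k t + y' t \<bullet> h t + \<mu> * (\<xi> t \<bullet> h t))"
    unfolding Iform_def
  proof (rule integral_cong_AE)
    show "AE t in M. Idens P Q R t (\<xi> t) (g t) (h t) (k t) = y t \<bullet> k t + y' t \<bullet> h t + \<mu> * (\<xi> t \<bullet> h t)"
      using a(5,6)
    proof eventually_elim
      case (elim t)
      have "complex_of_real \<mu> *s \<xi> t = \<mu> *\<^sub>R \<xi> t" by (simp add: vec_eq_iff) (simp add: scaleR_conv_of_real)
      with elim(2) have "force Q R t (g t) (\<xi> t) = y' t + \<mu> *\<^sub>R \<xi> t" by simp
      then show ?case using elim(1) by (simp add: Idens_def inner_add_left)
    qed
  qed (use int Idens_integrable[OF sq(1,2,5,6)] in auto)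
  also have "\<dots> = (LINT t|M. y t \<bullet> k t) + (LINT t|M. y' t \<bullet> h t) + \<mu> * (LINT t|M. \<xi> t \<bullet> h t)"
    using int by simp
  also have "(LINT t|M. y t \<bullet> k t) + (LINT t|M. y' t \<bullet> h t) = y r \<bullet> h r - y s \<bullet> h s"
    using integral_by_parts[OF a(2) h] less by simp
  finally show ?thesis by simp
qed

end

section \<open>Uniqueness and negative combinations of eigenfunctions\<close>

lemma AE_subinterval:
  assumes "AE t in lebesgue_on {s..r}. p t" "{u..v} \<subseteq> {s..r::real}"
  shows "AE t in lebesgue_on {u..v}. p t"
proof -
  have "AE t in lebesgue. t \<in> {s..r} \<longrightarrow> p t" using assms(1) by (simp add: AE_restrict_space_iff)
  then have "AE t in lebesgue. t \<in> {u..v} \<longrightarrow> p t"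
    by eventually_elim (use assms(2) in blast)
  then show ?thesis by (simp add: AE_restrict_space_iff)
qed

lemma integral_exp:
  fixes k :: real
  assumes "k > 0" "s \<le> t"
  shows "(LINT u|lebesgue_on {s..t}. exp (k * (u - s))) = (exp (k * (t - s)) - 1) / k"
proof -
  have "((\<lambda>u. exp (k * (u - s))) has_integral exp (k * (t - s)) / k - exp (k * (s - s)) / k) {s..t}"
    using assms
    by (intro fundamental_theorem_of_calculus)
      (auto intro!: derivative_eq_intros simp flip: has_real_derivative_iff_has_vector_derivative)
  moreover have "integrable (lebesgue_on {s..t}) (\<lambda>u. exp (k * (u - s)))"
    by (intro sq_integrable_interval_integrable continuous_on_imp_sq_integrable continuous_intros)
  ultimately show ?thesis
    by (simp add: lebesgue_integral_eq_integral integral_unique diff_divide_distrib)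
qed

lemma Gronwall_zero:
  fixes w :: "real \<Rightarrow> real"
  assumes "s \<le> r" and w: "continuous_on {s..r} w" and "K > 0"
    and le: "\<And>t. t \<in> {s..r} \<Longrightarrow> w t \<le> K * (LINT u|lebesgue_on {s..t}. w u)" and "t \<in> {s..r}"
  shows "w t \<le> 0"
proof -
  \<comment> \<open>in the sup norm with weight \<open>e\<close> the integral operator contracts by one half\<close>
  define e where "e = (\<lambda>t. exp (2 * K * (t - s)))"
  have e: "e t > 0" for t by (simp add: e_def)
  have "continuous_on {s..r} (\<lambda>t. w t / e t)"
    unfolding e_def using w by (intro continuous_intros) auto
  then obtain t0 where t0: "t0 \<in> {s..r}" "\<And>t. t \<in> {s..r} \<Longrightarrow> w t / e t \<le> w t0 / e t0"
    using continuous_attains_sup[of "{s..r}" "\<lambda>t. w t / e t"] \<open>t \<in> {s..r}\<close> by fastforce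
  define W where "W = w t0 / e t0"
  have W: "w t \<le> W * e t" if "t \<in> {s..r}" for t
    using t0(2)[OF that] e[of t] by (simp add: W_def pos_divide_le_eq)
  have "W \<le> 0"
  proof (rule ccontr)
    assume "\<not> W \<le> 0"
    then have Wp: "W > 0" by simp
    have sub: "{s..t0} \<subseteq> {s..r}" using t0(1) by auto
    have "(LINT u|lebesgue_on {s..t0}. w u) \<le> (LINT u|lebesgue_on {s..t0}. W * e u)"
    proof (rule integral_mono)
      show "integrable (lebesgue_on {s..t0}) w"
        by (intro sq_integrable_interval_integrable continuous_on_imp_sq_integrable continuous_on_subset[OF w sub])
      show "integrable (lebesgue_on {s..t0}) (\<lambda>u. W * e u)"
        unfolding e_def
        by (intro sq_integrable_interval_integrable continuous_on_imp_sq_integrable continuous_intros)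
    qed (use W sub in auto)
    also have "\<dots> = W * ((e t0 - 1) / (2 * K))"
      using integral_exp[of "2 * K" s t0] \<open>K > 0\<close> t0(1) by (simp add: e_def)
    finally have "K * (LINT u|lebesgue_on {s..t0}. w u) \<le> K * (W * ((e t0 - 1) / (2 * K)))"
      using \<open>K > 0\<close> by (intro mult_left_mono) auto
    also have "\<dots> = W * (e t0 - 1) / 2" using \<open>K > 0\<close> by simp
    finally have "w t0 \<le> W * (e t0 - 1) / 2" using le[OF t0(1)] by simp
    moreover have "w t0 = W * e t0" using e[of t0] by (simp add: W_def)
    moreover have "W * (e t0 - 1) / 2 < W * e t0" using Wp e[of t0] by (simp add: field_simps add_pos_pos)
    ultimately show False by simp
  qed
  then show ?thesis using W[OF \<open>t \<in> {s..r}\<close>] e[of t] by (meson mult_nonpos_nonneg less_imp_le order_trans)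
qed

lemma SL_solution_sum:
  assumes "\<And>i. i \<in> I \<Longrightarrow> SL_solution P Q R s r \<mu> (f i) (g i) (y i) (y' i)"
  shows "SL_solution P Q R s r \<mu> (\<lambda>t. \<Sum>i\<in>I. f i t) (\<lambda>t. \<Sum>i\<in>I. g i t)
    (\<lambda>t. \<Sum>i\<in>I. y i t) (\<lambda>t. \<Sum>i\<in>I. y' i t)"
  using assms
proof (induction I rule: infinite_finite_induct)
  case (insert x F)
  then show ?case
    using SL_solution_add[of P Q R s r \<mu> "f x" "g x" "y x" "y' x"] by simp
qed (simp_all add: SL_solution_zero)

context SL_system
begin

text \<open>Once the derivative \<open>g\<close> is estimated by \<open>y\<close> and \<xi>, the
  system is first order with bounded coefficients, and the Gronwall argument applies to the sum
  \<open>w\<close> of the two norms.\<close>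

lemma SL_solution_unique:
  assumes sol: "SL_solution P Q R s r \<mu> \<xi> g y y'" and init: "\<xi> s = 0" "y s = 0"
  shows "\<xi> = (\<lambda>t. 0)"
proof -
  note a = SL_solutionD[OF sol]
  obtain c where c: "c > 0" "\<And>t x. t \<in> {s..r} \<Longrightarrow> (cmat (P t) *v x) \<bullet> x \<ge> c * (norm x)\<^sup>2"
    by (rule elliptic) blast
  obtain q where q: "q \<ge> 0" "\<And>t x. t \<in> {s..r} \<Longrightarrow> norm (cmat (Q t) *v x) \<le> q * norm x"
    by (rule cmat_bound[OF contQ]) blast
  obtain q' where q': "q' \<ge> 0" "\<And>t x. t \<in> {s..r} \<Longrightarrow> norm (cmat (transpose (Q t)) *v x) \<le> q' * norm x"
    by (rule cmat_bound[OF contQT]) blast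
  obtain \<rho> where \<rho>: "\<rho> \<ge> 0" "\<And>t x. t \<in> {s..r} \<Longrightarrow> norm (cmat (R t) *v x) \<le> \<rho> * norm x"
    by (rule cmat_bound[OF contR]) blast
  define w where "w = (\<lambda>t. norm (y t) + norm (\<xi> t))"
  define K1 where "K1 = (1 + q) / c"
  define K2 where "K2 = q' * K1 + \<rho> + \<bar>\<mu>\<bar>"
  have K: "K1 > 0" "K2 \<ge> 0" using c(1) q(1) q'(1) \<rho>(1) by (auto simp: K1_def K2_def)
  have w0: "w t \<ge> 0" for t by (simp add: w_def)
  have cw: "continuous_on {s..r} w"
    unfolding w_def using a(1,2) by (intro continuous_intros) (auto dest: has_weak_deriv_continuous)
  have in_M: "AE t in M. t \<in> {s..r}" by (rule AE_I2) simp
  \<comment> \<open>In place of inverting \<open>P\<close>, the relation for the momentum is paired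
    with \<open>g\<close> and ellipticity is used; then one factor \<open>norm (g t)\<close> is
    cancelled.\<close>
  have g_le: "AE t in M. norm (g t) \<le> K1 * w t"
    using a(5) in_M
  proof eventually_elim
    case (elim t)
    have "c * (norm (g t))\<^sup>2 \<le> (cmat (P t) *v g t) \<bullet> g t" using c(2) elim(2) .
    also have "cmat (P t) *v g t = y t - cmat (Q t) *v \<xi> t" using elim(1) by (simp add: mom_def)
    also have "\<dots> \<bullet> g t \<le> norm (y t - cmat (Q t) *v \<xi> t) * norm (g t)" by (rule norm_cauchy_schwarz)
    also have "\<dots> \<le> ((1 + q) * w t) * norm (g t)"
    proof (rule mult_right_mono)
      have "norm (y t - cmat (Q t) *v \<xi> t) \<le> norm (y t) + norm (cmat (Q t) *v \<xi> t)"
        by (rule norm_triangle_ineq4)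
      also have "\<dots> \<le> norm (y t) + q * norm (\<xi> t)" using q(2)[OF elim(2)] by simp
      also have "\<dots> \<le> (1 + q) * w t" using q(1) by (simp add: w_def algebra_simps)
      finally show "norm (y t - cmat (Q t) *v \<xi> t) \<le> (1 + q) * w t" .
    qed simp
    finally have *: "c * norm (g t) * norm (g t) \<le> ((1 + q) * w t) * norm (g t)"
      by (simp add: power2_eq_square)
    have "c * norm (g t) \<le> (1 + q) * w t"
    proof (cases "g t = 0")
      case True
      then show ?thesis using q(1) w0 by simp
    next
      case False
      then show ?thesis using * by (simp add: mult_le_cancel_right)
    qed
    then show ?case using c(1) by (simp add: K1_def pos_le_divide_eq mult.commute)
  qed
  have y'_le: "AE t in M. norm (y' t) \<le> K2 * w t"
    using a(6) in_M g_le
  proof eventually_elim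
    case (elim t)
    have "norm (complex_of_real \<mu> *s \<xi> t) = \<bar>\<mu>\<bar> * norm (\<xi> t)"
    proof -
      have "complex_of_real \<mu> *s \<xi> t = \<mu> *\<^sub>R \<xi> t"
        by (simp add: vec_eq_iff) (simp add: scaleR_conv_of_real)
      then show ?thesis by simp
    qed
    then have "norm (y' t) \<le> norm (cmat (transpose (Q t)) *v g t) + norm (cmat (R t) *v \<xi> t) + \<bar>\<mu>\<bar> * norm (\<xi> t)"
      using norm_triangle_ineq4[of "force Q R t (g t) (\<xi> t)" "complex_of_real \<mu> *s \<xi> t"]
        norm_triangle_ineq[of "cmat (transpose (Q t)) *v g t" "cmat (R t) *v \<xi> t"] elim(1)
      by (simp add: force_def)
    also have "\<dots> \<le> q' * (K1 * w t) + \<rho> * w t + \<bar>\<mu>\<bar> * w t"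
    proof -
      have "norm (cmat (transpose (Q t)) *v g t) \<le> q' * (K1 * w t)"
        using q'(2)[OF elim(2), of "g t"] mult_left_mono[OF elim(3) q'(1)] by linarith
      moreover have xw: "norm (\<xi> t) \<le> w t" by (simp add: w_def)
      moreover have "norm (cmat (R t) *v \<xi> t) \<le> \<rho> * w t"
        using \<rho>(2)[OF elim(2), of "\<xi> t"] mult_left_mono[OF xw \<rho>(1)] by linarith
      moreover have "\<bar>\<mu>\<bar> * norm (\<xi> t) \<le> \<bar>\<mu>\<bar> * w t" using xw by (intro mult_left_mono) auto
      ultimately show ?thesis by linarith
    qed
    also have "\<dots> = K2 * w t" by (simp add: K2_def algebra_simps)
    finally show ?case .
  qed
  have bound: "norm (f t) \<le> k * (LINT u|lebesgue_on {s..t}. w u)"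
    if f: "has_weak_deriv s r f f'" "f s = 0" and le: "AE t in M. norm (f' t) \<le> k * w t" and t: "t \<in> {s..r}"
    for f f' k t
  proof -
    have sub: "{s..t} \<subseteq> {s..r}" using t by auto
    have if': "integrable (lebesgue_on {s..t}) f'" using has_weak_deriv_integrable[OF f(1) t] .
    have iw: "integrable (lebesgue_on {s..t}) w"
      by (intro sq_integrable_interval_integrable continuous_on_imp_sq_integrable continuous_on_subset[OF cw sub])
    have "norm (f t) = norm (LINT u|lebesgue_on {s..t}. f' u)"
      using has_weak_derivD[OF f(1) t] f(2) by simp
    also have "\<dots> \<le> (LINT u|lebesgue_on {s..t}. norm (f' u))" by (rule integral_norm_bound)
    also have "\<dots> \<le> (LINT u|lebesgue_on {s..t}. k * w u)"
      using if' iw AE_subinterval[OF le sub] by (intro integral_mono_AE) auto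
    also have "\<dots> = k * (LINT u|lebesgue_on {s..t}. w u)" by simp
    finally show ?thesis .
  qed
  have "w t \<le> (K1 + K2) * (LINT u|lebesgue_on {s..t}. w u)" if "t \<in> {s..r}" for t
    using bound[OF a(1) init(1) g_le that] bound[OF a(2) init(2) y'_le that]
    by (simp add: w_def algebra_simps)
  then have "w t \<le> 0" if "t \<in> {s..r}" for t
    using Gronwall_zero[OF _ cw, of "K1 + K2" t] K less that by simp
  then have "\<xi> t = 0" if "t \<in> {s..r}" for t
    using that norm_ge_zero[of "y t"] by (smt (verit) w_def norm_le_zero_iff)
  then show ?thesis using a(3) by (intro ext) blast
qed

text \<open>A solution is determined by its momentum and position at \<open>s\<close>, a vector with
  2n entries. Among more than 2n eigenfunctions some nontrivial combination has zero initial data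
  and so is zero.\<close>

lemma eigenspace_independent_card_le:
  assumes L: "vec.subspace \<Lambda>" and B: "finite B" "cfun.independent B" "B \<subseteq> SL_eigenspace P Q R s r \<Lambda> \<mu>"
  shows "card B \<le> CARD('n + 'n)"
proof (rule ccontr)
  assume "\<not> card B \<le> CARD('n + 'n)"
  then have card: "card (UNIV :: ('n + 'n) set) < card B" by simp
  have "\<exists>g y y'. SL_solution P Q R s r \<mu> b g y y'" if "b \<in> B" for b
    using B(3) that SL_eigenspace_iff[OF less] by blast
  then obtain g y y' where sol: "\<And>b. b \<in> B \<Longrightarrow> SL_solution P Q R s r \<mu> b (g b) (y b) (y' b)" by metis
  obtain c where c: "\<exists>b\<in>B. c b \<noteq> 0"
    "\<forall>i\<in>UNIV. (\<Sum>b\<in>B. c b * vjoin (y b s) (b s) $ i) = 0"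
    using nontrivial_kernel[OF _ B(1) card, of "\<lambda>b i. vjoin (y b s) (b s) $ i"] by auto
  have sol_sum: "SL_solution P Q R s r \<mu> (\<lambda>t. \<Sum>b\<in>B. c b *s b t) (\<lambda>t. \<Sum>b\<in>B. c b *s g b t)
      (\<lambda>t. \<Sum>b\<in>B. c b *s y b t) (\<lambda>t. \<Sum>b\<in>B. c b *s y' b t)"
    by (intro SL_solution_sum SL_solution_scale sol)
  have "(\<Sum>b\<in>B. c b *s y b s) $ i = 0" for i
    using c(2)[rule_format, of "Inl i"] by (simp add: vjoin_def)
  then have y0: "(\<Sum>b\<in>B. c b *s y b s) = 0" by (simp add: vec_eq_iff)
  have "(\<Sum>b\<in>B. c b *s b s) $ i = 0" for i
    using c(2)[rule_format, of "Inr i"] by (simp add: vjoin_def)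
  then have x0: "(\<Sum>b\<in>B. c b *s b s) = 0" by (simp add: vec_eq_iff)
  have z: "(\<lambda>t. \<Sum>b\<in>B. c b *s b t) = (\<lambda>t. 0)"
    by (rule SL_solution_unique[OF sol_sum x0 y0])
  have "(\<Sum>b\<in>B. (\<lambda>t. c b *s b t)) = 0"
  proof
    fix t
    show "(\<Sum>b\<in>B. (\<lambda>t. c b *s b t)) t = 0 t" using fun_cong[OF z, of t] by (simp add: cfun_sum_apply)
  qed
  then have "cfun.dependent B"
    unfolding cfun.dependent_finite[OF B(1)] using c(1) by blast
  with B(2) show False by blast
qed

text \<open>A basis \<open>E\<close> is first shown to be finite: for an infinite one,
  \<open>cfun.dim\<close> would be the default cardinality 0 and bound nothing.\<close>

lemma eigenspace_independent_card_le_dim: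
  assumes L: "vec.subspace \<Lambda>" and B: "cfun.independent B" "B \<subseteq> SL_eigenspace P Q R s r \<Lambda> \<mu>"
  shows "card B \<le> cfun.dim (SL_eigenspace P Q R s r \<Lambda> \<mu>)"
proof -
  obtain E where E: "E \<subseteq> SL_eigenspace P Q R s r \<Lambda> \<mu>" "cfun.independent E"
    "SL_eigenspace P Q R s r \<Lambda> \<mu> \<subseteq> cfun.span E" "card E = cfun.dim (SL_eigenspace P Q R s r \<Lambda> \<mu>)"
    using cfun.basis_exists .
  have "finite E"
  proof (rule ccontr)
    assume "infinite E"
    then obtain E' where E': "E' \<subseteq> E" "finite E'" "card E' = Suc CARD('n + 'n)"
      using infinite_arbitrarily_large by metis
    have "card E' \<le> CARD('n + 'n)"
      using E' E(1,2) cfun.independent_mono by (intro eigenspace_independent_card_le[OF L]) auto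
    with E'(3) show False by simp
  qed
  then show ?thesis using cfun.independent_span_bound[of E B] B E(3,4) by auto
qed

text \<open>Isotropy makes the two boundary terms of Green's formula equal, and symmetry of the form
  then leaves the same integral multiplied by \<mu> and by \<nu>.\<close>

lemma eigenfunctions_orthogonal:
  assumes iso: "\<And>u v. u \<in> \<Lambda> \<Longrightarrow> v \<in> \<Lambda> \<Longrightarrow> omega2 u v = 0" and "\<mu> \<noteq> \<nu>"
    and f: "f \<in> SL_eigenspace P Q R s r \<Lambda> \<mu>" and h: "h \<in> SL_eigenspace P Q R s r \<Lambda> \<nu>"
  shows "(LINT t|M. f t \<bullet> h t) = 0"
proof -
  obtain g y y' where a: "SL_solution P Q R s r \<mu> f g y y'" "bdry (y s) (f s) (y r) (f r) \<in> \<Lambda>"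
    using f unfolding SL_eigenspace_iff[OF less] by blast
  obtain k z z' where b: "SL_solution P Q R s r \<nu> h k z z'" "bdry (z s) (h s) (z r) (h r) \<in> \<Lambda>"
    using h unfolding SL_eigenspace_iff[OF less] by blast
  have "Re (omega2 (bdry (y s) (f s) (y r) (f r)) (bdry (z s) (h s) (z r) (h r))) = 0"
    using iso[OF a(2) b(2)] by simp
  then have bd: "y r \<bullet> h r - y s \<bullet> h s = z r \<bullet> f r - z s \<bullet> f s"
    by (simp add: omega2_bdry Re_hinner inner_commute)
  have "Iform f g h k = \<mu> * (LINT t|M. f t \<bullet> h t) + (y r \<bullet> h r - y s \<bullet> h s)"
    by (rule Green[OF a(1) SL_solutionD(1)[OF b(1)]])
  moreover have "Iform h k f g = \<nu> * (LINT t|M. f t \<bullet> h t) + (z r \<bullet> f r - z s \<bullet> f s)"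
    using Green[OF b(1) SL_solutionD(1)[OF a(1)]] by (simp add: inner_commute)
  ultimately have "\<mu> * (LINT t|M. f t \<bullet> h t) = \<nu> * (LINT t|M. f t \<bullet> h t)"
    using bd Iform_sym[of f g h k] by linarith
  then show ?thesis using \<open>\<mu> \<noteq> \<nu>\<close> by simp
qed

lemma Iform_sum_left:
  assumes "\<And>i. i \<in> I \<Longrightarrow> has_weak_deriv s r (f i) (g i)" "has_weak_deriv s r h k"
  shows "Iform (\<lambda>t. \<Sum>i\<in>I. f i t) (\<lambda>t. \<Sum>i\<in>I. g i t) h k = (\<Sum>i\<in>I. Iform (f i) (g i) h k)"
  using assms(1)
proof (induction I rule: infinite_finite_induct)
  case (insert x F)
  have w: "has_weak_deriv s r (\<lambda>t. \<Sum>i\<in>F. f i t) (\<lambda>t. \<Sum>i\<in>F. g i t)"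
    using insert.prems by (intro has_weak_deriv_sum) auto
  have "Iform (\<lambda>t. f x t + (\<Sum>i\<in>F. f i t)) (\<lambda>t. g x t + (\<Sum>i\<in>F. g i t)) h k =
      Iform (f x) (g x) h k + Iform (\<lambda>t. \<Sum>i\<in>F. f i t) (\<lambda>t. \<Sum>i\<in>F. g i t) h k"
    using insert.prems[of x] w assms(2)
    by (intro Iform_add_left has_weak_deriv_sq_integrable has_weak_deriv_sq_integrable_fun[of s r "f x" "g x"]
        has_weak_deriv_sq_integrable_fun[OF w] has_weak_deriv_sq_integrable_fun[OF assms(2)]) auto
  then show ?case using insert by simp
qed (simp_all add: Iform_def Idens_zero)

lemma integral_inner_sum_right:
  assumes "sq_integrable M h" "\<And>i. i \<in> I \<Longrightarrow> sq_integrable M (f i)"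
  shows "(LINT t|M. h t \<bullet> (\<Sum>i\<in>I. f i t)) = (\<Sum>i\<in>I. LINT t|M. h t \<bullet> f i t)"
  unfolding inner_sum_right by (intro Bochner_Integration.integral_sum integrable_inner assms)

text \<open>There is one summand for each eigenvalue, so orthogonality of different eigenspaces
  makes the form diagonal without orthonormal bases inside them. The boundary condition
  \<open>bd\<close> concerns the sum, which is the test function in Green's formula; single summands
  may be nonzero at the ends.\<close>

lemma negative_combination:
  assumes iso: "\<And>u v. u \<in> \<Lambda> \<Longrightarrow> v \<in> \<Lambda> \<Longrightarrow> omega2 u v = 0" and F: "finite F"
    and w: "\<And>\<mu>. \<mu> \<in> F \<Longrightarrow> \<mu> < 0 \<and> w \<mu> \<in> SL_eigenspace P Q R s r \<Lambda> \<mu>"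
    and bd: "(\<Sum>\<mu>\<in>F. w \<mu> s) = 0" "(\<Sum>\<mu>\<in>F. w \<mu> r) = 0"
  obtains g where "has_weak_deriv s r (\<lambda>t. \<Sum>\<mu>\<in>F. w \<mu> t) g"
    "Iform (\<lambda>t. \<Sum>\<mu>\<in>F. w \<mu> t) g (\<lambda>t. \<Sum>\<mu>\<in>F. w \<mu> t) g \<le> 0"
    "Iform (\<lambda>t. \<Sum>\<mu>\<in>F. w \<mu> t) g (\<lambda>t. \<Sum>\<mu>\<in>F. w \<mu> t) g = 0 \<Longrightarrow> \<forall>\<mu>\<in>F. w \<mu> = 0"
proof -
  have "\<exists>g y y'. SL_solution P Q R s r \<mu> (w \<mu>) g y y'" if "\<mu> \<in> F" for \<mu>
    using w[OF that] SL_eigenspace_iff[OF less] by blast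
  then obtain g y y' where sol: "\<And>\<mu>. \<mu> \<in> F \<Longrightarrow> SL_solution P Q R s r \<mu> (w \<mu>) (g \<mu>) (y \<mu>) (y' \<mu>)" by metis
  have wd: "has_weak_deriv s r (w \<mu>) (g \<mu>)" if "\<mu> \<in> F" for \<mu> using SL_solutionD(1)[OF sol[OF that]] .
  define W where "W = (\<lambda>t. \<Sum>\<mu>\<in>F. w \<mu> t)"
  define G where "G = (\<lambda>t. \<Sum>\<mu>\<in>F. g \<mu> t)"
  have WG: "has_weak_deriv s r W G" unfolding W_def G_def by (rule has_weak_deriv_sum) (rule wd)
  have sq: "sq_integrable M (w \<mu>)" if "\<mu> \<in> F" for \<mu> by (rule has_weak_deriv_sq_integrable_fun[OF wd[OF that]])
  have "Iform W G W G = (\<Sum>\<mu>\<in>F. Iform (w \<mu>) (g \<mu>) W G)"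
    unfolding W_def G_def by (rule Iform_sum_left[OF wd WG[unfolded W_def G_def]])
  also have "\<dots> = (\<Sum>\<mu>\<in>F. \<mu> * (LINT t|M. w \<mu> t \<bullet> w \<mu> t))"
  proof (rule sum.cong[OF refl])
    fix \<mu> assume \<mu>: "\<mu> \<in> F"
    have "Iform (w \<mu>) (g \<mu>) W G = \<mu> * (LINT t|M. w \<mu> t \<bullet> W t)"
      using Green[OF sol[OF \<mu>] WG] bd by (simp add: W_def)
    also have "(LINT t|M. w \<mu> t \<bullet> W t) = (\<Sum>\<nu>\<in>F. LINT t|M. w \<mu> t \<bullet> w \<nu> t)"
      unfolding W_def by (rule integral_inner_sum_right[OF sq[OF \<mu>] sq])
    also have "\<dots> = (\<Sum>\<nu>\<in>F. if \<nu> = \<mu> then LINT t|M. w \<mu> t \<bullet> w \<mu> t else 0)"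
    proof (rule sum.cong[OF refl])
      fix \<nu> assume "\<nu> \<in> F"
      then show "(LINT t|M. w \<mu> t \<bullet> w \<nu> t) = (if \<nu> = \<mu> then LINT t|M. w \<mu> t \<bullet> w \<mu> t else 0)"
        using eigenfunctions_orthogonal[where \<mu> = \<mu> and \<nu> = \<nu> and f = "w \<mu>" and h = "w \<nu>", OF iso] w \<mu> by auto
    qed
    also have "\<dots> = (LINT t|M. w \<mu> t \<bullet> w \<mu> t)" using F \<mu> by simp
    finally show "Iform (w \<mu>) (g \<mu>) W G = \<mu> * (LINT t|M. w \<mu> t \<bullet> w \<mu> t)" .
  qed
  finally have I: "Iform W G W G = (\<Sum>\<mu>\<in>F. \<mu> * (LINT t|M. w \<mu> t \<bullet> w \<mu> t))" .
  have neg: "\<mu> * (LINT t|M. w \<mu> t \<bullet> w \<mu> t) \<le> 0" if "\<mu> \<in> F" for \<mu>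
    using w[OF that] sq_integral_nonneg[of M "w \<mu>"] by (simp add: mult_nonpos_nonneg)
  have "\<forall>\<mu>\<in>F. w \<mu> = 0" if z: "Iform W G W G = 0"
  proof
    fix \<mu> assume \<mu>: "\<mu> \<in> F"
    have "(\<Sum>\<mu>\<in>F. - (\<mu> * (LINT t|M. w \<mu> t \<bullet> w \<mu> t))) = 0" using z I by (simp add: sum_negf)
    then have "- (\<mu> * (LINT t|M. w \<mu> t \<bullet> w \<mu> t)) = 0"
      using sum_nonneg_eq_0_iff[OF F, of "\<lambda>\<mu>. - (\<mu> * (LINT t|M. w \<mu> t \<bullet> w \<mu> t))"] neg \<mu> by simp
    then have "(LINT t|M. w \<mu> t \<bullet> w \<mu> t) \<le> 0" using w[OF \<mu>] by auto
    then have "w \<mu> t = 0" if "t \<in> {s..r}" for t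
      using continuous_sq_integral_zero[OF less has_weak_deriv_continuous[OF wd[OF \<mu>]] _ that] by blast
    then show "w \<mu> = 0" using SL_solutionD(3)[OF sol[OF \<mu>]] by (intro ext) (metis zero_fun_def)
  qed
  moreover have "Iform W G W G \<le> 0" unfolding I using neg by (rule sum_nonpos)
  ultimately show thesis using that WG unfolding W_def by blast
qed

lemma Idens_extend:
  assumes "s \<le> u" "v \<le> r" and out: "\<And>t. t \<notin> {u..v} \<Longrightarrow> f t = 0"
  shows "Iform f (\<lambda>t. indicator {u..v} t *\<^sub>R g t) f (\<lambda>t. indicator {u..v} t *\<^sub>R g t) =
    energy P Q R u v f g"
proof -
  have "{u..v} \<subseteq> {s..r}" using assms by auto
  from integral_lebesgue_on_subinterval[OF this, of "\<lambda>t. Idens P Q R t (f t) (g t) (f t) (g t)"]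
  have "energy P Q R u v f g =
    (LINT t|M. indicator {u..v} t *\<^sub>R Idens P Q R t (f t) (g t) (f t) (g t))" .
  also have "\<dots> = (LINT t|M. Idens P Q R t (f t) (indicator {u..v} t *\<^sub>R g t) (f t) (indicator {u..v} t *\<^sub>R g t))"
    using out by (intro Bochner_Integration.integral_cong) (auto simp: indicator_def Idens_zero)
  finally show ?thesis by (simp add: Iform_def)
qed

text \<open>The supports overlap at most in \<open>c\<close> and \<open>d\<close>, so the mixed
  terms vanish almost everywhere and the energies add up.\<close>

lemma glue_three:
  assumes "s \<le> c" "c \<le> d" "d \<le> r"
    and wd: "has_weak_deriv s c f1 g1" "has_weak_deriv c d f2 g2" "has_weak_deriv d r f3 g3"
    and out: "\<And>t. t \<notin> {s..c} \<Longrightarrow> f1 t = 0" "\<And>t. t \<notin> {c..d} \<Longrightarrow> f2 t = 0" "\<And>t. t \<notin> {d..r} \<Longrightarrow> f3 t = 0"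
    and bd: "f1 s = 0" "f1 c = 0" "f2 c = 0" "f2 d = 0" "f3 d = 0" "f3 r = 0"
  obtains G where "has_weak_deriv s r (\<lambda>t. f1 t + f2 t + f3 t) G"
    "Iform (\<lambda>t. f1 t + f2 t + f3 t) G (\<lambda>t. f1 t + f2 t + f3 t) G =
      energy P Q R s c f1 g1 +
      energy P Q R c d f2 g2 +
      energy P Q R d r f3 g3"
proof -
  define h1 where "h1 = (\<lambda>t. indicator {s..c} t *\<^sub>R g1 t)"
  define h2 where "h2 = (\<lambda>t. indicator {c..d} t *\<^sub>R g2 t)"
  define h3 where "h3 = (\<lambda>t. indicator {d..r} t *\<^sub>R g3 t)"
  have w1: "has_weak_deriv s r f1 h1"
    unfolding h1_def by (rule has_weak_deriv_extend[OF wd(1) _ _ _ out(1)]) (use assms(1-3) bd in auto)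
  have w2: "has_weak_deriv s r f2 h2"
    unfolding h2_def by (rule has_weak_deriv_extend[OF wd(2) _ _ _ out(2)]) (use assms(1-3) bd in auto)
  have w3: "has_weak_deriv s r f3 h3"
    unfolding h3_def by (rule has_weak_deriv_extend[OF wd(3) _ _ _ out(3)]) (use assms(1-3) bd in auto)
  let ?W = "\<lambda>t. f1 t + f2 t + f3 t" and ?G = "\<lambda>t. h1 t + h2 t + h3 t"
  have WG: "has_weak_deriv s r ?W ?G" by (intro has_weak_deriv_add w1 w2 w3)
  have int: "integrable M (\<lambda>t. Idens P Q R t (f t) (g t) (f t) (g t))" if "has_weak_deriv s r f g" for f g
    by (intro Idens_integrable has_weak_deriv_sq_integrable[OF that] has_weak_deriv_sq_integrable_fun[OF that])
  \<comment> \<open>At these two points the closed intervals meet, and several of the cut-off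
    derivatives may be nonzero there.\<close>
  have "AE t in lebesgue. t \<notin> {c, d}" by (rule AE_not_in) (auto intro: finite_imp_null_set_lborel[THEN null_sets_completionI])
  then have "AE t in lebesgue. t \<in> {s..r} \<longrightarrow> t \<notin> {c, d}" by (rule eventually_mono) blast
  moreover have "(AE t in M. t \<notin> {c, d}) \<longleftrightarrow> (AE t in lebesgue. t \<in> {s..r} \<longrightarrow> t \<notin> {c, d})"
    by (rule AE_restrict_space_iff) simp
  ultimately have cd: "AE t in M. t \<notin> {c, d}" by (simp only:)
  have "Iform ?W ?G ?W ?G = (LINT t|M. Idens P Q R t (f1 t) (h1 t) (f1 t) (h1 t) +
      Idens P Q R t (f2 t) (h2 t) (f2 t) (h2 t) + Idens P Q R t (f3 t) (h3 t) (f3 t) (h3 t))"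
    unfolding Iform_def
  proof (rule integral_cong_AE)
    show "AE t in M. Idens P Q R t (?W t) (?G t) (?W t) (?G t) =
        Idens P Q R t (f1 t) (h1 t) (f1 t) (h1 t) + Idens P Q R t (f2 t) (h2 t) (f2 t) (h2 t) +
        Idens P Q R t (f3 t) (h3 t) (f3 t) (h3 t)"
      using cd
    proof eventually_elim
      case (elim t)
      consider "t < c" | "c < t" "t < d" | "d < t" using elim by force
      then show ?case
      proof cases
        case 1
        then have "f2 t = 0" "h2 t = 0" "f3 t = 0" "h3 t = 0"
          using out(2)[of t] out(3)[of t] \<open>c \<le> d\<close> by (auto simp: h2_def h3_def)
        then show ?thesis by (simp add: Idens_zero)
      next
        case 2
        then have "f1 t = 0" "h1 t = 0" "f3 t = 0" "h3 t = 0"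
          using out(1)[of t] out(3)[of t] by (auto simp: h1_def h3_def)
        then show ?thesis by (simp add: Idens_zero)
      next
        case 3
        then have "f2 t = 0" "h2 t = 0" "f1 t = 0" "h1 t = 0"
          using out(2)[of t] out(1)[of t] \<open>c \<le> d\<close> by (auto simp: h2_def h1_def)
        then show ?thesis by (simp add: Idens_zero)
      qed
    qed
  qed (use int[OF WG] int[OF w1] int[OF w2] int[OF w3] in auto)
  also have "\<dots> = Iform f1 h1 f1 h1 + Iform f2 h2 f2 h2 + Iform f3 h3 f3 h3"
    using int[OF w1] int[OF w2] int[OF w3] by (simp add: Iform_def)
  also have "Iform f1 h1 f1 h1 = energy P Q R s c f1 g1"
    unfolding h1_def using assms(1-3) by (intro Idens_extend out) auto
  also have "Iform f2 h2 f2 h2 = energy P Q R c d f2 g2"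
    unfolding h2_def using assms(1-3) by (intro Idens_extend out) auto
  also have "Iform f3 h3 f3 h3 = energy P Q R d r f3 g3"
    unfolding h3_def using assms(1-3) by (intro Idens_extend out) auto
  finally show thesis using that WG by blast
qed

end

section \<open>The form of a Lagrangian boundary condition\<close>

text \<open>The estimate of \<open>f t\<close> by \<open>f x\<close> and the increment is averaged
  over \<open>x\<close> in \<open>{u..v}\<close>. The length of that interval is free: when it is
  short, a boundary value costs only a small multiple of the energy of the derivative.\<close>

lemma has_weak_deriv_point_bound:
  assumes f: "has_weak_deriv s r f g" and "s \<le> u" "u \<le> t" "t \<le> v" "v \<le> r"
  shows "(v - u) * (norm (f t))\<^sup>2 \<le>
    2 * (LINT x|lebesgue_on {s..r}. f x \<bullet> f x) + 2 * (v - u)\<^sup>2 * (LINT x|lebesgue_on {s..r}. g x \<bullet> g x)"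
proof -
  define G where "G = (LINT x|lebesgue_on {s..r}. g x \<bullet> g x)"
  have G: "G \<ge> 0" unfolding G_def by (rule sq_integral_nonneg)
  have sub: "{u..v} \<subseteq> {s..r}" and uv: "u \<le> v" using assms by auto
  have sqf: "sq_integrable (lebesgue_on {s..r}) f" by (rule has_weak_deriv_sq_integrable_fun[OF f])
  have if2: "integrable (lebesgue_on {u..v}) (\<lambda>x. f x \<bullet> f x)"
    by (intro integrable_inner_self sq_integrable_subinterval[OF sqf sub])
  have fin: "finite_measure (lebesgue_on {u..v})" by (rule finite_measure_interval)
  have ptw: "(norm (f t))\<^sup>2 \<le> 2 * (f x \<bullet> f x) + 2 * ((v - u) * G)" if x: "x \<in> {u..v}" for x
  proof -
    have "(norm (f t - f x))\<^sup>2 \<le> (v - u) * G"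
    proof (cases "x \<le> t")
      case True
      then have "(norm (f t - f x))\<^sup>2 \<le> (t - x) * G"
        unfolding G_def using x assms by (intro has_weak_deriv_Hoelder[OF f]) auto
      also have "\<dots> \<le> (v - u) * G" using x assms G by (intro mult_right_mono) auto
      finally show ?thesis .
    next
      case False
      then have "(norm (f x - f t))\<^sup>2 \<le> (x - t) * G"
        unfolding G_def using x assms by (intro has_weak_deriv_Hoelder[OF f]) auto
      also have "\<dots> \<le> (v - u) * G" using x assms G by (intro mult_right_mono) auto
      finally show ?thesis by (simp add: norm_minus_commute)
    qed
    moreover have "(norm (f x + (f t - f x)))\<^sup>2 \<le> 2 * (norm (f x))\<^sup>2 + 2 * (norm (f t - f x))\<^sup>2"
      by (rule norm_add_sq_le)
    ultimately show ?thesis by (simp add: power2_norm_eq_inner)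
  qed
  have "(v - u) * (norm (f t))\<^sup>2 = (LINT x|lebesgue_on {u..v}. (norm (f t))\<^sup>2)"
    using measure_interval[OF uv] by simp
  also have "\<dots> \<le> (LINT x|lebesgue_on {u..v}. 2 * (f x \<bullet> f x) + 2 * ((v - u) * G))"
    using if2 fin ptw by (intro integral_mono) (auto simp: finite_measure.integrable_const)
  also have "\<dots> = 2 * (LINT x|lebesgue_on {u..v}. f x \<bullet> f x) + (v - u) * (2 * ((v - u) * G))"
    using if2 fin measure_interval[OF uv] by (simp add: finite_measure.integrable_const)
  also have "(LINT x|lebesgue_on {u..v}. f x \<bullet> f x) \<le> (LINT x|lebesgue_on {s..r}. f x \<bullet> f x)"
    using integrable_inner_self[OF sqf] sub by (intro integral_mono_lebesgue_on_AE) auto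
  finally show ?thesis by (simp add: G_def power2_eq_square algebra_simps)
qed

text \<open>Holds the data extracted from a Lagrangian subspace. The variational argument is carried
  out with these alone, and \<Lambda> reappears when eigenfunctions are identified.\<close>

locale SL_boundary = SL_system P Q R s r
  for P Q R :: "real \<Rightarrow> real ^ 'n ^ 'n" and s r +
  fixes V :: "((complex ^ 'n) \<times> (complex ^ 'n)) set"
    and Ys Yr :: "(complex ^ 'n) \<times> (complex ^ 'n) \<Rightarrow> complex ^ 'n"
  assumes subV: "subspace V" and linYs: "linear Ys" and linYr: "linear Yr"
    and symY: "\<And>x h. x \<in> V \<Longrightarrow> h \<in> V \<Longrightarrow> Yr x \<bullet> snd h - Ys x \<bullet> fst h = Yr h \<bullet> snd x - Ys h \<bullet> fst x"
begin

text \<open>The boundary term that turns the index form into the form of the operator with boundary condition \<open>\<Lambda>\<close>.\<close>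

definition beta where "beta x h = Yr x \<bullet> snd h - Ys x \<bullet> fst h"

definition trace where "trace f = (f s, f r)" for f :: "real \<Rightarrow> complex ^ 'n"

definition bform where "bform f g h k = Iform f g h k - beta (trace f) (trace h)"

text \<open>Only the essential condition on the positions is imposed. The momentum need not have
  endpoint values here; its condition is a consequence of the weak equation.\<close>

definition form_dom where
  "form_dom f g \<longleftrightarrow> has_weak_deriv s r f g \<and> (\<forall>t. t \<notin> {s..r} \<longrightarrow> f t = 0) \<and> trace f \<in> V"

abbreviation sqnorm where "sqnorm f \<equiv> (LINT t|M. f t \<bullet> f t)"

lemma form_domD:
  assumes "form_dom f g"
  shows "has_weak_deriv s r f g" "\<And>t. t \<notin> {s..r} \<Longrightarrow> f t = 0" "trace f \<in> V"
    "sq_integrable M f" "sq_integrable M g"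
  using assms has_weak_deriv_sq_integrable has_weak_deriv_sq_integrable_fun
  unfolding form_dom_def by blast+

lemma trace_comb: "trace (\<lambda>t. f t + a *\<^sub>R h t) = trace f + a *\<^sub>R trace h"
  by (simp add: trace_def)

lemma form_dom_comb:
  assumes "form_dom f g" "form_dom h k"
  shows "form_dom (\<lambda>t. f t + a *\<^sub>R h t) (\<lambda>t. g t + a *\<^sub>R k t)"
  unfolding form_dom_def
proof (intro conjI)
  show "has_weak_deriv s r (\<lambda>t. f t + a *\<^sub>R h t) (\<lambda>t. g t + a *\<^sub>R k t)"
    by (intro has_weak_deriv_add has_weak_deriv_scaleR form_domD assms)
  show "trace (\<lambda>t. f t + a *\<^sub>R h t) \<in> V"
    unfolding trace_comb by (intro subspace_add subspace_scale subV form_domD(3)[OF assms(1)] form_domD(3)[OF assms(2)])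
qed (use form_domD(2)[OF assms(1)] form_domD(2)[OF assms(2)] in auto)

lemma beta_comb_right: "beta x (u + a *\<^sub>R h) = beta x u + a * beta x h"
  by (simp add: beta_def algebra_simps)

lemma beta_sym: "x \<in> V \<Longrightarrow> h \<in> V \<Longrightarrow> beta x h = beta h x"
  unfolding beta_def by (rule symY)

lemma bform_comb_right:
  assumes "form_dom u v" "form_dom f g" "form_dom h k"
  shows "bform u v (\<lambda>t. f t + a *\<^sub>R h t) (\<lambda>t. g t + a *\<^sub>R k t) = bform u v f g + a * bform u v h k"
proof -
  have "Iform u v (\<lambda>t. f t + a *\<^sub>R h t) (\<lambda>t. g t + a *\<^sub>R k t) =
      Iform u v f g + Iform u v (\<lambda>t. a *\<^sub>R h t) (\<lambda>t. a *\<^sub>R k t)"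
    by (intro Iform_add_right sq_integrable_scaleR
        form_domD(4,5)[OF assms(1)] form_domD(4,5)[OF assms(2)] form_domD(4,5)[OF assms(3)])
  then show ?thesis
    by (simp add: bform_def trace_comb beta_comb_right Iform_scale_right algebra_simps)
qed

lemma bform_sym:
  assumes "form_dom f g" "form_dom h k"
  shows "bform f g h k = bform h k f g"
  unfolding bform_def using Iform_sym[of f g h k] beta_sym[OF form_domD(3)[OF assms(1)] form_domD(3)[OF assms(2)]]
  by linarith

lemma bform_expand:
  assumes "form_dom f g" "form_dom h k"
  shows "bform (\<lambda>t. f t + a *\<^sub>R h t) (\<lambda>t. g t + a *\<^sub>R k t) (\<lambda>t. f t + a *\<^sub>R h t) (\<lambda>t. g t + a *\<^sub>R k t) =
    bform f g f g + 2 * a * bform f g h k + a\<^sup>2 * bform h k h k"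
proof -
  note c = form_dom_comb[OF assms, of a]
  have "bform (\<lambda>t. f t + a *\<^sub>R h t) (\<lambda>t. g t + a *\<^sub>R k t) (\<lambda>t. f t + a *\<^sub>R h t) (\<lambda>t. g t + a *\<^sub>R k t) =
     bform f g (\<lambda>t. f t + a *\<^sub>R h t) (\<lambda>t. g t + a *\<^sub>R k t) +
     a * bform h k (\<lambda>t. f t + a *\<^sub>R h t) (\<lambda>t. g t + a *\<^sub>R k t)"
    using bform_comb_right[OF c assms, of a] bform_sym[OF c assms(1)] bform_sym[OF c assms(2)] by simp
  then show ?thesis
    using bform_comb_right[OF assms(1) assms, of a] bform_comb_right[OF assms(2) assms, of a] bform_sym[OF assms]
    by (simp add: power2_eq_square algebra_simps)
qed

lemma sqnorm_expand:
  assumes "sq_integrable M f" "sq_integrable M h"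
  shows "sqnorm (\<lambda>t. f t + a *\<^sub>R h t) = sqnorm f + 2 * a * (LINT t|M. f t \<bullet> h t) + a\<^sup>2 * sqnorm h"
proof -
  have "sqnorm (\<lambda>t. f t + a *\<^sub>R h t) = (LINT t|M. f t \<bullet> f t + 2 * a * (f t \<bullet> h t) + a\<^sup>2 * (h t \<bullet> h t))"
    by (intro Bochner_Integration.integral_cong) (auto simp: algebra_simps power2_eq_square inner_commute)
  also have "\<dots> = sqnorm f + 2 * a * (LINT t|M. f t \<bullet> h t) + a\<^sup>2 * sqnorm h"
    using assms by (simp add: integrable_inner)
  finally show ?thesis .
qed

lemma beta_bound: obtains C where "C > 0" "\<And>x. \<bar>beta x x\<bar> \<le> C * ((norm (fst x))\<^sup>2 + (norm (snd x))\<^sup>2)"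
proof -
  obtain B1 where B1: "B1 > 0" "\<And>x. norm (Ys x) \<le> B1 * norm x"
    using linear_bounded_pos[OF linYs] by blast
  obtain B2 where B2: "B2 > 0" "\<And>x. norm (Yr x) \<le> B2 * norm x"
    using linear_bounded_pos[OF linYr] by blast
  show thesis
  proof (rule that[of "B1 + B2"])
    fix x :: "(complex ^ 'n) \<times> (complex ^ 'n)"
    have n: "norm (fst x) \<le> norm x" "norm (snd x) \<le> norm x" by (cases x; simp add: norm_Pair real_le_rsqrt)+
    have "\<bar>Yr x \<bullet> snd x\<bar> \<le> B2 * norm x * norm x"
      using order_trans[OF Cauchy_Schwarz_ineq2[of "Yr x" "snd x"] mult_mono[OF B2(2) n(2)]] B2(1) by simp
    moreover have "\<bar>Ys x \<bullet> fst x\<bar> \<le> B1 * norm x * norm x"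
      using order_trans[OF Cauchy_Schwarz_ineq2[of "Ys x" "fst x"] mult_mono[OF B1(2) n(1)]] B1(1) by simp
    ultimately have "\<bar>beta x x\<bar> \<le> (B1 + B2) * (norm x)\<^sup>2"
      unfolding beta_def by (simp add: power2_eq_square algebra_simps)
    also have "(norm x)\<^sup>2 = (norm (fst x))\<^sup>2 + (norm (snd x))\<^sup>2"
      by (cases x) (simp add: norm_Pair)
    finally show "\<bar>beta x x\<bar> \<le> (B1 + B2) * ((norm (fst x))\<^sup>2 + (norm (snd x))\<^sup>2)" .
  qed (use B1 B2 in auto)
qed

text \<open>The boundary term is quadratic in the two endpoint values, and the point bound on a
  short interval absorbs it into half of the coercive part of the index form.\<close>

lemma bform_coercive:
  obtains c K where "c > 0" "K > 0" "\<And>f g. has_weak_deriv s r f g \<Longrightarrow> bform f g f g \<ge> c * sqnorm g - K * sqnorm f"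
proof -
  obtain c K where cK: "c > 0" "K > 0"
    "\<And>t x g. t \<in> {s..r} \<Longrightarrow> Idens P Q R t x g x g \<ge> c * (norm g)\<^sup>2 - K * (norm x)\<^sup>2"
    by (rule Idens_coercive) blast
  obtain C where C: "C > 0" "\<And>x. \<bar>beta x x\<bar> \<le> C * ((norm (fst x))\<^sup>2 + (norm (snd x))\<^sup>2)"
    by (rule beta_bound) blast
  \<comment> \<open>\<open>8 * C * \<delta> \<le> c\<close> is what is needed: the two endpoints
    together contribute \<open>4 * \<delta>\<close> times the energy of the derivative, multiplied
    by \<open>C\<close>, and this must not exceed half of \<open>c\<close>.\<close>
  define \<delta> where "\<delta> = min (r - s) (c / (8 * C))"
  have \<delta>: "\<delta> > 0" "\<delta> \<le> r - s" "8 * C * \<delta> \<le> c"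
    using less cK(1) C(1) by (auto simp: \<delta>_def min_def field_simps)
  show thesis
  proof (rule that[of "c / 2" "K + 4 * C / \<delta>"])
    fix f g :: "real \<Rightarrow> complex ^ 'n" assume f: "has_weak_deriv s r f g"
    have sq: "sq_integrable M f" "sq_integrable M g"
      using f has_weak_deriv_sq_integrable has_weak_deriv_sq_integrable_fun by blast+
    have n0: "sqnorm f \<ge> 0" "sqnorm g \<ge> 0" by (rule sq_integral_nonneg)+
    have "c * sqnorm g - K * sqnorm f = (LINT t|M. c * (g t \<bullet> g t) - K * (f t \<bullet> f t))"
      using sq by (simp add: integrable_inner_self)
    also have "\<dots> \<le> Iform f g f g"
      unfolding Iform_def
    proof (rule integral_mono)
      show "integrable M (\<lambda>t. c * (g t \<bullet> g t) - K * (f t \<bullet> f t))"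
        using sq by (simp add: integrable_inner_self)
      show "integrable M (\<lambda>t. Idens P Q R t (f t) (g t) (f t) (g t))" by (intro Idens_integrable sq)
      show "c * (g t \<bullet> g t) - K * (f t \<bullet> f t) \<le> Idens P Q R t (f t) (g t) (f t) (g t)" if "t \<in> space M" for t
        using cK(3)[of t "g t" "f t"] that by (simp add: power2_norm_eq_inner)
    qed
    finally have I: "c * sqnorm g - K * sqnorm f \<le> Iform f g f g" .
    have "\<delta> * (norm (f s))\<^sup>2 \<le> 2 * sqnorm f + 2 * \<delta>\<^sup>2 * sqnorm g"
      using has_weak_deriv_point_bound[OF f, of s s "s + \<delta>"] \<delta> by simp
    moreover have "\<delta> * (norm (f r))\<^sup>2 \<le> 2 * sqnorm f + 2 * \<delta>\<^sup>2 * sqnorm g"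
      using has_weak_deriv_point_bound[OF f, of "r - \<delta>" r r] \<delta> by simp
    ultimately have "\<delta> * ((norm (f s))\<^sup>2 + (norm (f r))\<^sup>2) \<le> \<delta> * (4 / \<delta> * sqnorm f + 4 * \<delta> * sqnorm g)"
      using \<delta>(1) by (simp add: distrib_left power2_eq_square)
    then have tr: "(norm (f s))\<^sup>2 + (norm (f r))\<^sup>2 \<le> 4 / \<delta> * sqnorm f + 4 * \<delta> * sqnorm g"
      using \<delta>(1) by (simp only: mult_le_cancel_left_pos)
    have "\<bar>beta (trace f) (trace f)\<bar> \<le> C * ((norm (f s))\<^sup>2 + (norm (f r))\<^sup>2)"
      using C(2)[of "trace f"] by (simp add: trace_def)
    also have "\<dots> \<le> C * (4 / \<delta> * sqnorm f + 4 * \<delta> * sqnorm g)"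
      using tr C(1) by (intro mult_left_mono) auto
    also have "\<dots> = 4 * C / \<delta> * sqnorm f + (8 * C * \<delta>) / 2 * sqnorm g" by (simp add: algebra_simps)
    also have "\<dots> \<le> 4 * C / \<delta> * sqnorm f + c / 2 * sqnorm g"
      using \<delta>(3) n0 by (intro add_left_mono mult_right_mono) auto
    finally have "beta (trace f) (trace f) \<le> 4 * C / \<delta> * sqnorm f + c / 2 * sqnorm g" by linarith
    moreover have "c * sqnorm g = c / 2 * sqnorm g + c / 2 * sqnorm g" by simp
    ultimately show "c / 2 * sqnorm g - (K + 4 * C / \<delta>) * sqnorm f \<le> bform f g f g"
      using I unfolding bform_def distrib_right by linarith
  qed (use cK C \<delta> in \<open>auto intro!: add_pos_pos\<close>)
qed

text \<open>The constraint is real orthogonality; complex orthogonality is obtained by also putting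
  the multiples by \<open>\<i>\<close> into \<Phi>.\<close>

definition admissible where
  "admissible \<Phi> f g \<longleftrightarrow> form_dom f g \<and> (\<forall>\<phi>\<in>\<Phi>. (LINT t|M. f t \<bullet> \<phi> t) = 0)"

lemma admissible_comb:
  assumes \<Phi>: "\<And>\<phi>. \<phi> \<in> \<Phi> \<Longrightarrow> sq_integrable M \<phi>" and "admissible \<Phi> f g" "admissible \<Phi> h k"
  shows "admissible \<Phi> (\<lambda>t. f t + a *\<^sub>R h t) (\<lambda>t. g t + a *\<^sub>R k t)"
proof -
  have fd: "form_dom f g" "form_dom h k" using assms by (auto simp: admissible_def)
  have "(LINT t|M. (f t + a *\<^sub>R h t) \<bullet> \<phi> t) = 0" if "\<phi> \<in> \<Phi>" for \<phi>
  proof -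
    have "(LINT t|M. (f t + a *\<^sub>R h t) \<bullet> \<phi> t) = (LINT t|M. f t \<bullet> \<phi> t) + a * (LINT t|M. h t \<bullet> \<phi> t)"
      using form_domD(4)[OF fd(1)] form_domD(4)[OF fd(2)] \<Phi>[OF that]
      by (simp add: inner_add_left integrable_inner)
    then show ?thesis using assms(2,3) that by (simp add: admissible_def)
  qed
  then show ?thesis using form_dom_comb[OF fd] by (simp add: admissible_def)
qed

lemma form_dom_zero: "form_dom (\<lambda>t. 0) (\<lambda>t. 0)"
  by (simp add: form_dom_def has_weak_deriv_zero trace_def subspace_0[OF subV] flip: zero_prod_def)

lemma admissible_zero: "admissible \<Phi> (\<lambda>t. 0) (\<lambda>t. 0)"
  by (simp add: admissible_def form_dom_zero)

text \<open>By symmetry the coefficients are moved to the fixed pair \<open>h\<close>,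
  \<open>k\<close>, so that \<open>F n\<close> and \<open>G n\<close> are merely integrated against
  fixed square-integrable functions. The boundary part needs convergence at the two
  endpoints.\<close>

lemma bform_tendsto:
  assumes fd: "\<And>n. form_dom (F n) (G n)" "form_dom f g" "form_dom h k"
    and lim: "(\<lambda>n. sqnorm (\<lambda>t. F n t - f t)) \<longlonglongrightarrow> 0" "(\<lambda>n. sqnorm (\<lambda>t. G n t - g t)) \<longlonglongrightarrow> 0"
    and pt: "(\<lambda>n. F n s) \<longlonglongrightarrow> f s" "(\<lambda>n. F n r) \<longlonglongrightarrow> f r"
  shows "(\<lambda>n. bform (F n) (G n) h k) \<longlonglongrightarrow> bform f g h k"
proof -
  note sq = form_domD(4)[OF fd(1)] form_domD(5)[OF fd(1)] form_domD(4)[OF fd(2)] form_domD(5)[OF fd(2)]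
    form_domD(4)[OF fd(3)] form_domD(5)[OF fd(3)]
  have sqm: "sq_integrable M (\<lambda>t. mom P Q t (k t) (h t))" "sq_integrable M (\<lambda>t. force Q R t (k t) (h t))"
    by (intro sq_integrable_mom sq_integrable_force sq)+
  have eq: "Iform u v h k = (LINT t|M. v t \<bullet> mom P Q t (k t) (h t)) + (LINT t|M. u t \<bullet> force Q R t (k t) (h t))"
    if "sq_integrable M u" "sq_integrable M v" for u v
  proof -
    have "Iform u v h k = Iform h k u v" by (rule Iform_sym)
    then show ?thesis
      using that sqm by (simp add: Iform_def Idens_def integrable_inner inner_commute)
  qed
  have "(\<lambda>n. (LINT t|M. G n t \<bullet> mom P Q t (k t) (h t)) + (LINT t|M. F n t \<bullet> force Q R t (k t) (h t)))
      \<longlonglongrightarrow> (LINT t|M. g t \<bullet> mom P Q t (k t) (h t)) + (LINT t|M. f t \<bullet> force Q R t (k t) (h t))"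
    by (intro tendsto_add L2_tendsto_inner sq sqm lim)
  then have I: "(\<lambda>n. Iform (F n) (G n) h k) \<longlonglongrightarrow> Iform f g h k" by (simp add: eq sq)
  have tr: "(\<lambda>n. trace (F n)) \<longlonglongrightarrow> trace f" unfolding trace_def by (intro tendsto_Pair pt)
  have "(\<lambda>n. beta (trace (F n)) (trace h)) \<longlonglongrightarrow> beta (trace f) (trace h)"
    unfolding beta_def
    using linYs linYr by (intro tendsto_intros bounded_linear.tendsto[OF _ tr]) (simp_all add: linear_conv_bounded_linear)
  with I show ?thesis unfolding bform_def by (intro tendsto_diff)
qed

lemma sqnorm_add_le:
  assumes "sq_integrable M f" "sq_integrable M h"
  shows "sqnorm (\<lambda>t. f t + h t) \<le> 2 * sqnorm f + 2 * sqnorm h"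
proof -
  have "sqnorm (\<lambda>t. f t + h t) \<le> (LINT t|M. 2 * (f t \<bullet> f t) + 2 * (h t \<bullet> h t))"
  proof (rule integral_mono)
    show "(f t + h t) \<bullet> (f t + h t) \<le> 2 * (f t \<bullet> f t) + 2 * (h t \<bullet> h t)" for t
      using norm_add_sq_le[of "f t" "h t"] by (simp add: power2_norm_eq_inner)
  qed (use assms in \<open>simp_all add: integrable_inner_self sq_integrable_add\<close>)
  also have "\<dots> = 2 * sqnorm f + 2 * sqnorm h" using assms by (simp add: integrable_inner_self)
  finally show ?thesis .
qed

lemma sqnorm_diff_le:
  assumes "sq_integrable M f" "sq_integrable M h"
  shows "sqnorm (\<lambda>t. f t - h t) \<le> 2 * sqnorm f + 2 * sqnorm h"
  using sqnorm_add_le[OF assms(1) sq_integrable_minus[OF assms(2)]] by simp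

lemma uniform_imp_sqnorm_tendsto:
  assumes cont: "\<And>n. continuous_on {s..r} (F n)" "continuous_on {s..r} f"
    and unif: "\<And>e. e > 0 \<Longrightarrow> \<exists>N. \<forall>n\<ge>N. \<forall>t\<in>{s..r}. norm (F n t - f t) < e"
  shows "(\<lambda>n. sqnorm (\<lambda>t. F n t - f t :: 'b::euclidean_space)) \<longlonglongrightarrow> 0"
proof (rule LIMSEQ_I)
  fix e :: real assume "e > 0"
  define d where "d = sqrt (e / (2 * (r - s)))"
  have dl: "(sqrt (e / (2 * l)))\<^sup>2 * l = e / 2" if "l > 0" for l using that \<open>e > 0\<close> by simp
  have d: "d > 0" "d\<^sup>2 * (r - s) = e / 2"
    using \<open>e > 0\<close> less unfolding d_def by (simp, intro dl) simp
  obtain N where N: "\<And>n t. n \<ge> N \<Longrightarrow> t \<in> {s..r} \<Longrightarrow> norm (F n t - f t) < d" using unif[OF d(1)] by blast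
  have "norm (sqnorm (\<lambda>t. F n t - f t) - 0) < e" if "n \<ge> N" for n
  proof -
    have "sqnorm (\<lambda>t. F n t - f t) \<le> (LINT t|M. d\<^sup>2)"
    proof (rule integral_mono)
      show "integrable M (\<lambda>t. (F n t - f t) \<bullet> (F n t - f t))"
        by (intro integrable_inner_self continuous_on_imp_sq_integrable continuous_on_diff cont)
      show "integrable M (\<lambda>t. d\<^sup>2)" by (rule finite_measure.integrable_const[OF finite_measure_interval])
      show "(F n t - f t) \<bullet> (F n t - f t) \<le> d\<^sup>2" if "t \<in> space M" for t
      proof -
        have "(norm (F n t - f t))\<^sup>2 \<le> d\<^sup>2"
          using N[OF \<open>n \<ge> N\<close>, of t] that by (intro power_mono) auto
        then show ?thesis by (simp add: power2_norm_eq_inner)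
      qed
    qed
    also have "\<dots> = e / 2" using d measure_interval[of s r] less by (simp add: mult.commute)
    finally show ?thesis
      using \<open>e > 0\<close> sq_integral_nonneg[of M "\<lambda>t. F n t - f t"] unfolding real_norm_def by linarith
  qed
  then show "\<exists>no. \<forall>n\<ge>no. norm (sqnorm (\<lambda>t. F n t - f t) - 0) < e" by blast
qed

text \<open>The Hoelder estimate for the primitive of \<open>G n - g\<close> bounds, at each
  \<open>t\<close>, the error in the integral representation.\<close>

lemma weak_deriv_limit:
  assumes wd: "\<And>n. has_weak_deriv s r (F n) (G n)" and g: "sq_integrable M g"
    and lim: "(\<lambda>n. sqnorm (\<lambda>t. G n t - g t)) \<longlonglongrightarrow> 0"
    and pt: "\<And>t. t \<in> {s..r} \<Longrightarrow> (\<lambda>n. F n t) \<longlonglongrightarrow> f t"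
  shows "has_weak_deriv s r f g"
proof (rule has_weak_derivI[OF g])
  fix t assume t: "t \<in> {s..r}"
  let ?I = "LINT u|lebesgue_on {s..t}. g u"
  have ig: "integrable (lebesgue_on {s..t}) g"
    using t by (intro sq_integrable_interval_integrable sq_integrable_subinterval[OF g]) auto
  have le: "(norm (F n t - F n s - ?I))\<^sup>2 \<le> (t - s) * sqnorm (\<lambda>u. G n u - g u)" for n
  proof -
    have sq: "sq_integrable M (\<lambda>u. G n u - g u)"
      by (intro sq_integrable_diff has_weak_deriv_sq_integrable[OF wd] g)
    define H where "H = (\<lambda>t. if t \<in> {s..r} then 0 + (LINT u|lebesgue_on {s..t}. G n u - g u) else 0)"
    have H: "has_weak_deriv s r H (\<lambda>u. G n u - g u)" unfolding H_def by (rule has_weak_deriv_primitive[OF sq])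
    have "H t - H s = (LINT u|lebesgue_on {s..t}. G n u - g u)"
      using t by (intro has_weak_deriv_increment[OF H]) auto
    also have "\<dots> = F n t - F n s - ?I"
      using has_weak_deriv_integrable[OF wd[of n] t] ig has_weak_derivD[OF wd[of n] t] by simp
    finally have "F n t - F n s - ?I = H t - H s" ..
    then show ?thesis using t has_weak_deriv_Hoelder[OF H, of s t] by simp
  qed
  have "(\<lambda>n. (norm (F n t - F n s - ?I))\<^sup>2) \<longlonglongrightarrow> (norm (f t - f s - ?I))\<^sup>2"
    using t less by (intro tendsto_intros pt) auto
  moreover have "(\<lambda>n. (t - s) * sqnorm (\<lambda>u. G n u - g u)) \<longlonglongrightarrow> 0"
    by (rule tendsto_mult_right_zero[OF lim])
  ultimately have "(norm (f t - f s - ?I))\<^sup>2 \<le> 0"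
    by (rule LIMSEQ_le) (use le in blast)
  then have "f t - f s - ?I = 0" by simp
  then show "f t = f s + ?I" by (simp add: algebra_simps)
qed

lemma bform_zero: "bform (\<lambda>t. 0) (\<lambda>t. 0) h k = 0"
  using linear_0[OF linYs] linear_0[OF linYr]
  by (simp add: bform_def Iform_def Idens_zero trace_def beta_def flip: zero_prod_def)

lemma bform_scale:
  assumes "form_dom f g"
  shows "bform (\<lambda>t. a *\<^sub>R f t) (\<lambda>t. a *\<^sub>R g t) (\<lambda>t. a *\<^sub>R f t) (\<lambda>t. a *\<^sub>R g t) = a\<^sup>2 * bform f g f g"
  using bform_expand[OF form_dom_zero assms, of a] by (simp add: bform_zero)

lemma admissible_scale:
  assumes "\<And>\<phi>. \<phi> \<in> \<Phi> \<Longrightarrow> sq_integrable M \<phi>" "admissible \<Phi> f g"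
  shows "admissible \<Phi> (\<lambda>t. a *\<^sub>R f t) (\<lambda>t. a *\<^sub>R g t)"
  using admissible_comb[OF assms(1) admissible_zero assms(2), of a] by simp

text \<open>The conclusion is the weak Euler--Lagrange equation on admissible functions, with the
  infimum \<open>m\<close> as multiplier. The function \<open>w\<close> makes \<open>m\<close>
  negative, and coercivity keeps it finite.\<close>

lemma minimiser_exists:
  assumes \<Phi>: "\<And>\<phi>. \<phi> \<in> \<Phi> \<Longrightarrow> sq_integrable M \<phi>"
    and w: "admissible \<Phi> w gw" "bform w gw w gw < 0"
  obtains m f g where "m < 0" "admissible \<Phi> f g" "sqnorm f > 0"
    "\<forall>h k. admissible \<Phi> h k \<longrightarrow> bform f g h k = m * (LINT t|M. f t \<bullet> h t)"
proof -
  obtain c K where cK: "c > 0" "K > 0"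
    "\<And>f g. has_weak_deriv s r f g \<Longrightarrow> bform f g f g \<ge> c * sqnorm g - K * sqnorm f"
    by (rule bform_coercive) blast
  have fdA: "form_dom f g" if "admissible \<Phi> f g" for f g using that by (simp add: admissible_def)
  have lower: "bform f g f g \<ge> - K * sqnorm f" if "form_dom f g" for f g
    using cK(3)[OF form_domD(1)[OF that]] mult_nonneg_nonneg[OF less_imp_le[OF cK(1)] sq_integral_nonneg[of M g]]
    by linarith
  define S where "S = {bform f g f g | f g. admissible \<Phi> f g \<and> sqnorm f = 1}"
  have normalise: "bform f g f g / sqnorm f \<in> S" if fg: "admissible \<Phi> f g" and n: "sqnorm f > 0" for f g
  proof -
    define a where "a = 1 / sqrt (sqnorm f)"
    have a2: "a\<^sup>2 = 1 / sqnorm f" using n by (simp add: a_def power_divide)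
    have "sqnorm (\<lambda>t. a *\<^sub>R f t) = a\<^sup>2 * sqnorm f" by (simp add: power2_eq_square mult.assoc)
    then have "sqnorm (\<lambda>t. a *\<^sub>R f t) = 1" using a2 n by simp
    then show ?thesis
      unfolding S_def using admissible_scale[OF \<Phi> fg, of a] bform_scale[OF fdA[OF fg], of a] a2 by force
  qed
  have bdd: "bdd_below S"
  proof (rule bdd_belowI)
    fix x assume "x \<in> S"
    then obtain f g where "x = bform f g f g" "admissible \<Phi> f g" "sqnorm f = 1" unfolding S_def by blast
    then show "- K \<le> x" using lower[OF fdA, of f g] by simp
  qed
  have wn: "sqnorm w > 0"
  proof -
    have "- K * sqnorm w < 0" using lower[OF fdA[OF w(1)]] w(2) by linarith
    then show ?thesis using cK(2) by (simp add: zero_less_mult_iff)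
  qed
  define m where "m = Inf S"
  have "m \<le> bform w gw w gw / sqnorm w" unfolding m_def by (rule cInf_lower[OF normalise[OF w(1) wn] bdd])
  then have m: "m < 0" using w(2) wn by (smt (verit) divide_neg_pos)
  have mlower: "bform f g f g \<ge> m * sqnorm f" if fg: "admissible \<Phi> f g" for f g
  proof (cases "sqnorm f > 0")
    case True
    have "m \<le> bform f g f g / sqnorm f" unfolding m_def by (rule cInf_lower[OF normalise[OF fg True] bdd])
    then show ?thesis using True by (simp add: pos_le_divide_eq)
  next
    case False
    then have "sqnorm f = 0" using sq_integral_nonneg[of M f] by linarith
    then show ?thesis using lower[OF fdA[OF fg]] by simp
  qed
  have "\<exists>p. admissible \<Phi> (fst p) (snd p) \<and> sqnorm (fst p) = 1 \<and>
      bform (fst p) (snd p) (fst p) (snd p) < m + 1 / (real n + 1)" for n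
  proof -
    have "\<exists>x\<in>S. x < m + 1 / (real n + 1)"
      using normalise[OF w(1) wn] unfolding m_def by (intro cInf_lessD) auto
    then show ?thesis unfolding S_def by force
  qed
  then have "\<exists>p. \<forall>n. admissible \<Phi> (fst (p n)) (snd (p n)) \<and> sqnorm (fst (p n)) = 1 \<and>
      bform (fst (p n)) (snd (p n)) (fst (p n)) (snd (p n)) < m + 1 / (real n + 1)"
    by (intro choice allI)
  then obtain p where p: "\<And>n. admissible \<Phi> (fst (p n)) (snd (p n)) \<and> sqnorm (fst (p n)) = 1 \<and>
      bform (fst (p n)) (snd (p n)) (fst (p n)) (snd (p n)) < m + 1 / (real n + 1)" by blast
  define F0 where "F0 = (\<lambda>n. fst (p n))"
  define G0 where "G0 = (\<lambda>n. snd (p n))"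
  have FG0: "admissible \<Phi> (F0 n) (G0 n)" "sqnorm (F0 n) = 1"
    "bform (F0 n) (G0 n) (F0 n) (G0 n) < m + 1 / (real n + 1)" for n
    using p[of n] by (simp_all add: F0_def G0_def)
  have wd0: "has_weak_deriv s r (F0 n) (G0 n)" for n by (rule form_domD(1)[OF fdA[OF FG0(1)]])
  \<comment> \<open>Coercivity on the unit sphere: an energy below \<open>m + 1\<close> bounds the
    squared norm of the derivative.\<close>
  define B where "B = (m + 1 + K) / c"
  have B: "sqnorm (G0 n) \<le> B" for n
  proof -
    have "1 / (real n + 1) \<le> 1" by simp
    then have "c * sqnorm (G0 n) \<le> m + 1 + K" using cK(3)[OF wd0[of n]] FG0(3)[of n] unfolding FG0(2) by linarith
    then show ?thesis using cK(1) by (simp add: B_def pos_le_divide_eq mult.commute)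
  qed
  have B0: "B \<ge> 0" using order_trans[OF sq_integral_nonneg B] .
  obtain f0 \<kappa> where f0: "continuous_on {s..r} f0" "strict_mono (\<kappa> :: nat \<Rightarrow> nat)"
    "\<And>e. 0 < e \<Longrightarrow> \<exists>N. \<forall>n x. n \<ge> N \<and> x \<in> {s..r} \<longrightarrow> norm (F0 (\<kappa> n) x - f0 x) < e"
  \<comment> \<open>The uniform bound is the point bound averaged over the whole interval.\<close>
  proof (rule Arzela_Ascoli[of "{s..r}" F0 "sqrt ((2 + 2 * (r - s)\<^sup>2 * B) / (r - s))"])
    show "norm (F0 n x) \<le> sqrt ((2 + 2 * (r - s)\<^sup>2 * B) / (r - s))" if "x \<in> {s..r}" for n x
    proof (rule real_le_rsqrt)
      have "(r - s) * (norm (F0 n x))\<^sup>2 \<le> 2 * sqnorm (F0 n) + 2 * (r - s)\<^sup>2 * sqnorm (G0 n)"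
        using that by (intro has_weak_deriv_point_bound[OF wd0]) auto
      also have "\<dots> \<le> 2 + 2 * (r - s)\<^sup>2 * B"
        using mult_left_mono[OF B[of n], of "2 * (r - s)\<^sup>2"] FG0(2)[of n] by simp
      finally show "(norm (F0 n x))\<^sup>2 \<le> (2 + 2 * (r - s)\<^sup>2 * B) / (r - s)"
        using less by (simp add: pos_le_divide_eq mult.commute)
    qed
    show "\<exists>d>0. \<forall>n y. y \<in> {s..r} \<and> norm (x - y) < d \<longrightarrow> norm (F0 n x - F0 n y) < e"
      if "x \<in> {s..r}" "0 < e" for x e
    proof (intro exI[of _ "e\<^sup>2 / (B + 1)"] conjI allI impI)
      show "0 < e\<^sup>2 / (B + 1)" using that B0 by simp
      show "norm (F0 n x - F0 n y) < e" if "y \<in> {s..r} \<and> norm (x - y) < e\<^sup>2 / (B + 1)" for n y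
        using has_weak_deriv_modulus[OF wd0 B, of y x e] that \<open>x \<in> {s..r}\<close> \<open>0 < e\<close> by simp
    qed
  qed (use that in auto)
  define F where "F = (\<lambda>n. F0 (\<kappa> n))"
  define G where "G = (\<lambda>n. G0 (\<kappa> n))"
  define f where "f = (\<lambda>t. if t \<in> {s..r} then f0 t else 0)"
  have A: "admissible \<Phi> (F n) (G n)" "sqnorm (F n) = 1" "form_dom (F n) (G n)" for n
    using FG0(1,2) fdA by (auto simp: F_def G_def)
  note fd = form_domD[OF A(3)]
  define \<epsilon> where "\<epsilon> = (\<lambda>n. bform (F n) (G n) (F n) (G n) - m)"
  have \<epsilon>0: "\<epsilon> n \<ge> 0" for n using mlower[OF A(1)[of n]] A(2)[of n] by (simp add: \<epsilon>_def)
  have \<epsilon>1: "\<epsilon> n \<le> 1 / (real n + 1)" for n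
  proof -
    have "n \<le> \<kappa> n" using f0(2) by (rule seq_suble)
    then have "1 / (real (\<kappa> n) + 1) \<le> 1 / (real n + 1)" by (intro divide_left_mono) auto
    then show ?thesis using FG0(3)[of "\<kappa> n"] by (simp add: \<epsilon>_def F_def G_def)
  qed
  have \<epsilon>lim: "\<epsilon> \<longlonglongrightarrow> 0"
  proof (rule tendsto_sandwich[OF _ _ tendsto_const])
    show "(\<lambda>n. 1 / (real n + 1)) \<longlonglongrightarrow> 0"
      using LIMSEQ_inverse_real_of_nat by (simp add: inverse_eq_divide add.commute)
  qed (use \<epsilon>0 \<epsilon>1 in \<open>auto intro: always_eventually\<close>)
  have contf: "continuous_on {s..r} f" using f0(1) by (rule continuous_on_eq) (simp add: f_def)
  have sqf: "sq_integrable M f" by (rule continuous_on_imp_sq_integrable[OF contf])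
  have unif: "\<exists>N. \<forall>n\<ge>N. \<forall>t\<in>{s..r}. norm (F n t - f t) < e" if e: "e > 0" for e
  proof -
    obtain N where "\<forall>n x. n \<ge> N \<and> x \<in> {s..r} \<longrightarrow> norm (F0 (\<kappa> n) x - f0 x) < e" using f0(3)[OF e] by blast
    then show ?thesis by (intro exI[of _ N]) (auto simp: F_def f_def)
  qed
  have Flim: "(\<lambda>n. sqnorm (\<lambda>t. F n t - f t)) \<longlonglongrightarrow> 0"
    by (rule uniform_imp_sqnorm_tendsto[OF has_weak_deriv_continuous[OF fd(1)] contf unif])
  have pt: "(\<lambda>n. F n t) \<longlonglongrightarrow> f t" if t: "t \<in> {s..r}" for t
    by (rule LIMSEQ_I) (use unif t in blast)
  \<comment> \<open>parallelogram law, with the sum of two almost minimisers bounded from below by \<open>m\<close>\<close>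
  have Gdiff: "c * sqnorm (\<lambda>t. G p t - G q t) \<le>
      (2 * \<epsilon> p + 2 * K * sqnorm (\<lambda>t. F p t - f t)) + (2 * \<epsilon> q + 2 * K * sqnorm (\<lambda>t. F q t - f t))" for p q
  proof -
    note plus = bform_expand[OF A(3)[of p] A(3)[of q], of 1]
    note minus = bform_expand[OF A(3)[of p] A(3)[of q], of "- 1"]
    note nplus = sqnorm_expand[OF fd(4)[of p] fd(4)[of q], of 1]
    note nminus = sqnorm_expand[OF fd(4)[of p] fd(4)[of q], of "- 1"]
    have "admissible \<Phi> (\<lambda>t. F p t + 1 *\<^sub>R F q t) (\<lambda>t. G p t + 1 *\<^sub>R G q t)"
      by (rule admissible_comb[OF \<Phi> A(1) A(1)])
    from mlower[OF this] have "m * sqnorm (\<lambda>t. F p t + 1 *\<^sub>R F q t) \<le>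
        bform (F p) (G p) (F p) (G p) + 2 * bform (F p) (G p) (F q) (G q) + bform (F q) (G q) (F q) (G q)"
      unfolding plus by simp
    \<comment> \<open>Since \<open>m\<close> is negative, the norm of the sum has to be bounded from
      above; for two unit vectors the squared norm is at most 4.\<close>
    moreover have "m * 4 \<le> m * sqnorm (\<lambda>t. F p t + 1 *\<^sub>R F q t)"
    proof (rule mult_left_mono_neg)
      have "sqnorm (\<lambda>t. F p t + (- 1) *\<^sub>R F q t) \<ge> 0" by (rule sq_integral_nonneg)
      then show "sqnorm (\<lambda>t. F p t + 1 *\<^sub>R F q t) \<le> 4"
        unfolding nplus nminus A(2) by simp
    qed (use m in simp)
    ultimately have "bform (\<lambda>t. F p t + (- 1) *\<^sub>R F q t) (\<lambda>t. G p t + (- 1) *\<^sub>R G q t)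
        (\<lambda>t. F p t + (- 1) *\<^sub>R F q t) (\<lambda>t. G p t + (- 1) *\<^sub>R G q t) \<le> 2 * \<epsilon> p + 2 * \<epsilon> q"
      unfolding minus \<epsilon>_def by simp
    then have b: "bform (\<lambda>t. F p t - F q t) (\<lambda>t. G p t - G q t) (\<lambda>t. F p t - F q t) (\<lambda>t. G p t - G q t)
        \<le> 2 * \<epsilon> p + 2 * \<epsilon> q" by simp
    have "form_dom (\<lambda>t. F p t + (- 1) *\<^sub>R F q t) (\<lambda>t. G p t + (- 1) *\<^sub>R G q t)"
      by (rule form_dom_comb[OF A(3) A(3)])
    then have "has_weak_deriv s r (\<lambda>t. F p t - F q t) (\<lambda>t. G p t - G q t)" using form_domD(1) by fastforce
    from cK(3)[OF this] b have "c * sqnorm (\<lambda>t. G p t - G q t) \<le>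
        2 * \<epsilon> p + 2 * \<epsilon> q + K * sqnorm (\<lambda>t. F p t - F q t)" by linarith
    moreover have "sqnorm (\<lambda>t. F p t - F q t) \<le> 2 * sqnorm (\<lambda>t. F p t - f t) + 2 * sqnorm (\<lambda>t. F q t - f t)"
      using sqnorm_diff_le[OF sq_integrable_diff[OF fd(4)[of p] sqf] sq_integrable_diff[OF fd(4)[of q] sqf]]
      by simp
    then have "K * sqnorm (\<lambda>t. F p t - F q t) \<le>
        K * (2 * sqnorm (\<lambda>t. F p t - f t) + 2 * sqnorm (\<lambda>t. F q t - f t))"
      using cK(2) by (intro mult_left_mono) auto
    ultimately show ?thesis by (simp add: algebra_simps)
  qed
  define A' where "A' = (\<lambda>n. 2 * \<epsilon> n + 2 * K * sqnorm (\<lambda>t. F n t - f t))"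
  have A'lim: "A' \<longlonglongrightarrow> 0"
    unfolding A'_def using tendsto_add[OF tendsto_mult_right_zero[OF \<epsilon>lim, of 2] tendsto_mult_right_zero[OF Flim, of "2 * K"]]
    by simp
  obtain g where g: "sq_integrable M g" "(\<lambda>n. sqnorm (\<lambda>t. G n t - g t)) \<longlonglongrightarrow> 0"
  proof (rule finite_measure.L2_complete[OF finite_measure_interval fd(5)])
    fix e :: real assume "e > 0"
    then have "\<forall>\<^sub>F n in sequentially. A' n < c * e / 2"
      using A'lim cK(1) by (intro order_tendstoD(2)) auto
    then obtain N where N: "\<And>n. n \<ge> N \<Longrightarrow> A' n < c * e / 2" unfolding eventually_sequentially by blast
    have "sqnorm (\<lambda>t. G p t - G q t) \<le> e" if "p \<ge> N" "q \<ge> N" for p q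
    proof -
      have "c * sqnorm (\<lambda>t. G p t - G q t) \<le> c * e"
        using Gdiff[of p q] N[OF that(1)] N[OF that(2)] unfolding A'_def by linarith
      then show ?thesis using cK(1) by simp
    qed
    then show "\<exists>N. \<forall>p\<ge>N. \<forall>q\<ge>N. sqnorm (\<lambda>t. G p t - G q t) \<le> e" by blast
  qed (use that in blast)
  have wdf: "has_weak_deriv s r f g" by (rule weak_deriv_limit[OF fd(1) g pt])
  have ends: "(\<lambda>n. F n s) \<longlonglongrightarrow> f s" "(\<lambda>n. F n r) \<longlonglongrightarrow> f r" using pt less by auto
  have "trace f \<in> V"
  proof (rule closed_sequentially[OF closed_subspace[OF subV]])
    show "trace (F n) \<in> V" for n by (rule fd(3))
    show "(\<lambda>n. trace (F n)) \<longlonglongrightarrow> trace f" unfolding trace_def by (intro tendsto_Pair ends)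
  qed
  then have fdf: "form_dom f g" using wdf by (auto simp: form_dom_def f_def)
  have "(LINT t|M. f t \<bullet> \<phi> t) = 0" if "\<phi> \<in> \<Phi>" for \<phi>
  proof -
    have "(\<lambda>n. LINT t|M. F n t \<bullet> \<phi> t) \<longlonglongrightarrow> (LINT t|M. f t \<bullet> \<phi> t)"
      by (intro L2_tendsto_inner fd(4) sqf \<Phi> that Flim)
    moreover have "(LINT t|M. F n t \<bullet> \<phi> t) = 0" for n using A(1) that by (simp add: admissible_def)
    ultimately show ?thesis using LIMSEQ_unique[OF _ tendsto_const] by fastforce
  qed
  then have Af: "admissible \<Phi> f g" using fdf by (simp add: admissible_def)
  have "sqnorm f > 0"
  proof -
    \<comment> \<open>The limit cannot be zero, as the \<open>F n\<close> are unit vectors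
      converging to it in the mean square.\<close>
    have "1 \<le> 2 * sqnorm (\<lambda>t. F n t - f t) + 2 * sqnorm f" for n
      using sqnorm_add_le[OF sq_integrable_diff[OF fd(4)[of n] sqf] sqf] A(2)[of n] by simp
    moreover have "(\<lambda>n. 2 * sqnorm (\<lambda>t. F n t - f t) + 2 * sqnorm f) \<longlonglongrightarrow> 0 + 2 * sqnorm f"
      by (intro tendsto_add tendsto_mult_right_zero Flim tendsto_const)
    ultimately have "1 \<le> 0 + 2 * sqnorm f" by (intro LIMSEQ_le_const) auto
    then show ?thesis by linarith
  qed
  moreover have "bform f g h k = m * (LINT t|M. f t \<bullet> h t)" if hk: "admissible \<Phi> h k" for h k
  proof -
    note fdh = fdA[OF hk]
    define L where "L = bform f g h k - m * (LINT t|M. f t \<bullet> h t)"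
    define q where "q = bform h k h k - m * sqnorm h"
    have lim1: "(\<lambda>n. bform (F n) (G n) h k) \<longlonglongrightarrow> bform f g h k"
      by (rule bform_tendsto[OF A(3) fdf fdh Flim g(2) ends])
    have lim2: "(\<lambda>n. LINT t|M. F n t \<bullet> h t) \<longlonglongrightarrow> (LINT t|M. f t \<bullet> h t)"
      by (intro L2_tendsto_inner fd(4) sqf form_domD(4)[OF fdh] Flim)
    \<comment> \<open>The lower bound \<open>m\<close> is applied to \<open>F n\<close> plus
      \<open>x\<close> times \<open>h\<close> before passing to the limit. All limits are then
      linear in \<open>F n\<close>, and it need not be known beforehand that \<open>f\<close>
      attains the infimum.\<close>
    have "0 \<le> 0 + 2 * x * L + x\<^sup>2 * q" for x
    proof (rule LIMSEQ_le_const)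
      show "(\<lambda>n. \<epsilon> n + 2 * x * (bform (F n) (G n) h k - m * (LINT t|M. F n t \<bullet> h t)) + x\<^sup>2 * q)
          \<longlonglongrightarrow> 0 + 2 * x * L + x\<^sup>2 * q"
        unfolding L_def by (intro tendsto_intros \<epsilon>lim lim1 lim2)
      have "0 \<le> \<epsilon> n + 2 * x * (bform (F n) (G n) h k - m * (LINT t|M. F n t \<bullet> h t)) + x\<^sup>2 * q" for n
      proof -
        from mlower[OF admissible_comb[OF \<Phi> A(1)[of n] hk, of x]]
        have "m * (1 + 2 * x * (LINT t|M. F n t \<bullet> h t) + x\<^sup>2 * sqnorm h) \<le>
            bform (F n) (G n) (F n) (G n) + 2 * x * bform (F n) (G n) h k + x\<^sup>2 * bform h k h k"
          unfolding bform_expand[OF A(3) fdh] sqnorm_expand[OF fd(4) form_domD(4)[OF fdh]] A(2) .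
        then show ?thesis unfolding \<epsilon>_def q_def by (simp add: algebra_simps)
      qed
      then show "\<exists>N. \<forall>n\<ge>N. 0 \<le> \<epsilon> n + 2 * x * (bform (F n) (G n) h k - m * (LINT t|M. F n t \<bullet> h t)) + x\<^sup>2 * q"
        by blast
    qed
    from quadratic_nonneg_discrim[OF this] have "L = 0" by simp
    then show ?thesis by (simp add: L_def)
  qed
  ultimately show thesis using that[OF m Af] by blast
qed

end

section \<open>Construction of negative eigenfunctions\<close>

lemma inner_ii: "(\<i> *s u) \<bullet> v = - (u \<bullet> (\<i> *s v))" "(\<i> *s u) \<bullet> (\<i> *s v) = u \<bullet> (v :: complex ^ 'n)"
  "u \<bullet> (\<i> *s u) = 0"
  by (simp_all add: inner_vec_def inner_complex_def sum_negf[symmetric] algebra_simps)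

lemma vec_scale_eq_scaleR: "c *s v = Re c *\<^sub>R v + Im c *\<^sub>R (\<i> *s (v :: complex ^ 'n))"
proof -
  have "(c *s v) $ j = (Re c *\<^sub>R v + Im c *\<^sub>R (\<i> *s v)) $ j" for j
    by (simp add: complex_eq_iff)
  then show ?thesis by (simp add: vec_eq_iff)
qed

lemma sq_integrable_vec_scale:
  fixes f :: "'a \<Rightarrow> complex ^ 'n"
  assumes "sq_integrable M f"
  shows "sq_integrable M (\<lambda>t. c *s f t)"
proof -
  have bl: "bounded_linear (\<lambda>v :: complex ^ 'n. c *s v)"
    using linear_vec_scale by (simp add: linear_conv_bounded_linear)
  then obtain K where K: "\<And>v :: complex ^ 'n. norm (c *s v) \<le> norm v * K" using bounded_linear.bounded by blast
  have [measurable]: "(\<lambda>v :: complex ^ 'n. c *s v) \<in> borel_measurable borel"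
    by (intro borel_measurable_continuous_onI linear_continuous_on bl)
  have [measurable]: "f \<in> borel_measurable M" using assms by (rule sq_integrable_measurable)
  show ?thesis
    by (rule sq_integrable_bound[OF assms, where C = K]) (measurable, use K in \<open>simp add: mult.commute\<close>)
qed

text \<open>This is \<open>\<integral>\<langle>f, h\<rangle>\<close>: the real part of \<open>hinner u v\<close> is \<open>u \<bullet> v\<close>, and its imaginary part is \<open>u \<bullet> (\<i> *s v)\<close>.\<close>

definition cip :: "'a measure \<Rightarrow> ('a \<Rightarrow> complex ^ 'n) \<Rightarrow> ('a \<Rightarrow> complex ^ 'n) \<Rightarrow> complex" where
  "cip M f h = Complex (LINT t|M. f t \<bullet> h t) (LINT t|M. f t \<bullet> (\<i> *s h t))"

lemma cip_eq_0_iff: "cip M f h = 0 \<longleftrightarrow> (LINT t|M. f t \<bullet> h t) = 0 \<and> (LINT t|M. f t \<bullet> (\<i> *s h t)) = 0"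
  by (simp add: cip_def complex_eq_iff)

lemma cip_add_left:
  assumes "sq_integrable M f" "sq_integrable M g" "sq_integrable M h"
  shows "cip M (\<lambda>t. f t + g t) h = cip M f h + cip M g h"
  using assms by (simp add: cip_def inner_add_left integrable_inner sq_integrable_vec_scale complex_eq_iff)

lemma cip_scale_left:
  assumes "sq_integrable M f" "sq_integrable M h"
  shows "cip M (\<lambda>t. c *s f t) h = c * cip M f h"
proof -
  have 1: "(LINT t|M. (c *s f t) \<bullet> h t) = Re c * (LINT t|M. f t \<bullet> h t) - Im c * (LINT t|M. f t \<bullet> (\<i> *s h t))"
    unfolding vec_scale_eq_scaleR[of c] using assms
    by (simp add: inner_add_left inner_ii integrable_inner sq_integrable_vec_scale)
  have 2: "(LINT t|M. (c *s f t) \<bullet> (\<i> *s h t)) =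
      Re c * (LINT t|M. f t \<bullet> (\<i> *s h t)) + Im c * (LINT t|M. f t \<bullet> h t)"
    unfolding vec_scale_eq_scaleR[of c] using assms
    by (simp add: inner_add_left inner_ii integrable_inner sq_integrable_vec_scale)
  show ?thesis by (simp add: cip_def 1 2 complex_eq_iff)
qed

lemma sq_integrable_sum:
  "(\<And>i. i \<in> I \<Longrightarrow> sq_integrable M (f i)) \<Longrightarrow> sq_integrable M (\<lambda>t. \<Sum>i\<in>I. f i t)"
  by (induction I rule: infinite_finite_induct) (auto intro: sq_integrable_add)

lemma cip_sum_left:
  assumes "\<And>i. i \<in> I \<Longrightarrow> sq_integrable M (f i)" "sq_integrable M h"
  shows "cip M (\<lambda>t. \<Sum>i\<in>I. c i *s f i t) h = (\<Sum>i\<in>I. c i * cip M (f i) h)"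
  using assms(1)
proof (induction I rule: infinite_finite_induct)
  case (insert x F)
  have "cip M (\<lambda>t. c x *s f x t + (\<Sum>i\<in>F. c i *s f i t)) h =
      cip M (\<lambda>t. c x *s f x t) h + cip M (\<lambda>t. \<Sum>i\<in>F. c i *s f i t) h"
    using insert.prems assms(2)
    by (intro cip_add_left sq_integrable_vec_scale sq_integrable_sum) auto
  then show ?case using insert assms(2) by (simp add: cip_scale_left)
qed (simp_all add: cip_def complex_eq_iff)

context SL_boundary
begin

text \<open>By \<open>char\<close> the boundary term of Green's formula is exactly
  \<open>beta\<close>, which \<open>bform\<close> subtracts.\<close>

lemma eigenfunction_bform:
  assumes char: "\<And>ys xs yr xr. bdry ys xs yr xr \<in> \<Lambda> \<longleftrightarrow> (xs, xr) \<in> V \<and>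
       (\<forall>h\<in>V. yr \<bullet> snd h - ys \<bullet> fst h = beta (xs, xr) h)"
    and f: "f \<in> SL_eigenspace P Q R s r \<Lambda> \<mu>"
  shows "\<exists>g. form_dom f g \<and> (\<forall>h k. form_dom h k \<longrightarrow> bform f g h k = \<mu> * (LINT t|M. f t \<bullet> h t))"
proof -
  obtain g y y' where sol: "SL_solution P Q R s r \<mu> f g y y'" and bd: "bdry (y s) (f s) (y r) (f r) \<in> \<Lambda>"
    using f unfolding SL_eigenspace_iff[OF less] by blast
  have "form_dom f g"
    using SL_solutionD(1,3)[OF sol] bd unfolding form_dom_def char trace_def by blast
  moreover have "bform f g h k = \<mu> * (LINT t|M. f t \<bullet> h t)" if "form_dom h k" for h k
  proof -
    have "y r \<bullet> h r - y s \<bullet> h s = beta (trace f) (trace h)"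
      using bd form_domD(3)[OF that] unfolding char by (auto simp: trace_def)
    then show ?thesis
      using Green[OF sol form_domD(1)[OF that]] by (simp add: bform_def)
  qed
  ultimately show ?thesis by blast
qed

text \<open>The function is affine between the prescribed endpoint values, written as the primitive
  of a constant.\<close>

lemma trace_surjective:
  assumes "x \<in> V"
  obtains h k where "form_dom h k" "trace h = x"
proof -
  define e where "e = (1 / (r - s)) *\<^sub>R (snd x - fst x)"
  define h where "h = (\<lambda>t. if t \<in> {s..r} then fst x + (LINT u|lebesgue_on {s..t}. e) else 0)"
  have "sq_integrable M (\<lambda>u. e)" by (rule finite_measure.sq_integrable_const[OF finite_measure_interval])
  then have wd: "has_weak_deriv s r h (\<lambda>u. e)" unfolding h_def by (rule has_weak_deriv_primitive)
  have "h t = fst x + (t - s) *\<^sub>R e" if "t \<in> {s..r}" for t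
    using measure_interval[of s t] that by (simp add: h_def)
  then have "h s = fst x" "h r = fst x + (r - s) *\<^sub>R e" using less by simp_all
  then have "trace h = x" using less by (simp add: trace_def e_def prod_eq_iff)
  moreover from this have "form_dom h (\<lambda>u. e)" using wd assms by (auto simp: form_dom_def h_def)
  ultimately show thesis using that by blast
qed

text \<open>Test functions with zero endpoint values give the differential equation through
  \<open>du_Bois_Reymond\<close>. Green's formula then cancels the interior terms for all other test
  functions, and as their traces fill \<open>V\<close>, the natural boundary condition
  remains.\<close>

lemma bform_imp_eigenfunction:
  assumes char: "\<And>ys xs yr xr. bdry ys xs yr xr \<in> \<Lambda> \<longleftrightarrow> (xs, xr) \<in> V \<and>
       (\<forall>h\<in>V. yr \<bullet> snd h - ys \<bullet> fst h = beta (xs, xr) h)"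
    and f: "form_dom f g" and eq: "\<And>h k. form_dom h k \<Longrightarrow> bform f g h k = m * (LINT t|M. f t \<bullet> h t)"
  shows "f \<in> SL_eigenspace P Q R s r \<Lambda> m"
proof -
  note fd = form_domD[OF f]
  define y where "y = (\<lambda>t. mom P Q t (g t) (f t))"
  define w where "w = (\<lambda>t. force Q R t (g t) (f t) - complex_of_real m *s f t)"
  have sqy: "sq_integrable M y" unfolding y_def by (intro sq_integrable_mom fd)
  have sqw: "sq_integrable M w"
    unfolding w_def by (intro sq_integrable_diff sq_integrable_force sq_integrable_vec_scale fd)
  have Iyw: "Iform f g h k - m * (LINT t|M. f t \<bullet> h t) = (LINT t|M. y t \<bullet> k t) + (LINT t|M. w t \<bullet> h t)"
    if "has_weak_deriv s r h k" for h k
  proof -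
    have sq: "sq_integrable M h" "sq_integrable M k"
      using that has_weak_deriv_sq_integrable has_weak_deriv_sq_integrable_fun by blast+
    have "w t \<bullet> h t = force Q R t (g t) (f t) \<bullet> h t - m * (f t \<bullet> h t)" for t
      unfolding w_def vec_scale_eq_scaleR[of "complex_of_real m"] by (simp add: inner_diff_left)
    then show ?thesis
      using sq fd(4,5) sqy
      by (simp add: Iform_def Idens_def y_def integrable_inner sq_integrable_force)
  qed
  obtain Y where Y: "has_weak_deriv s r Y w" "\<And>t. t \<notin> {s..r} \<Longrightarrow> Y t = 0" "AE t in M. y t = Y t"
  proof (rule du_Bois_Reymond[OF less sqy sqw])
    fix h k :: "real \<Rightarrow> complex ^ 'n"
    assume h: "has_weak_deriv s r h k" "h s = 0" "h r = 0" "\<And>t. t \<notin> {s..r} \<Longrightarrow> h t = 0"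
    have "trace h = 0" using h by (simp add: trace_def zero_prod_def)
    then have "form_dom h k" using h subspace_0[OF subV] by (simp add: form_dom_def)
    from eq[OF this] have "Iform f g h k = m * (LINT t|M. f t \<bullet> h t)"
      by (simp add: bform_def beta_def \<open>trace h = 0\<close>)
    then show "(LINT t|M. y t \<bullet> k t) + (LINT t|M. w t \<bullet> h t) = 0" using Iyw[OF h(1)] by simp
  qed (use that in blast)
  have "AE t in M. Y t = mom P Q t (g t) (f t)" using Y(3) by eventually_elim (simp add: y_def)
  moreover have "AE t in M. w t = force Q R t (g t) (f t) - complex_of_real m *s f t" by (simp add: w_def)
  ultimately have sol: "SL_solution P Q R s r m f g Y w"
    unfolding SL_solution_def using fd(1,2) Y(1,2) by blast
  have "Y r \<bullet> snd x - Y s \<bullet> fst x = beta (f s, f r) x" if x: "x \<in> V" for x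
  proof -
    obtain h k where h: "form_dom h k" "trace h = x" using trace_surjective[OF x] by blast
    have "bform f g h k = (Y r \<bullet> h r - Y s \<bullet> h s) - beta (trace f) (trace h) + m * (LINT t|M. f t \<bullet> h t)"
      using Green[OF sol form_domD(1)[OF h(1)]] by (simp add: bform_def)
    then have "Y r \<bullet> h r - Y s \<bullet> h s = beta (trace f) (trace h)" using eq[OF h(1)] by simp
    then show ?thesis using h(2) by (auto simp: trace_def)
  qed
  then have "bdry (Y s) (f s) (Y r) (f r) \<in> \<Lambda>" unfolding char using fd(3) by (simp add: trace_def)
  then show ?thesis unfolding SL_eigenspace_iff[OF less] using sol by blast
qed

text \<open>In general a constrained minimiser satisfies its equation only up to Lagrange
  multipliers. Here these vanish: each \<psi> is itself an eigenfunction, so the form of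
  \<open>f\<close> with \<psi> is a multiple of their inner product, which is 0.\<close>

lemma next_eigenfunction:
  assumes char: "\<And>ys xs yr xr. bdry ys xs yr xr \<in> \<Lambda> \<longleftrightarrow> (xs, xr) \<in> V \<and>
       (\<forall>h\<in>V. yr \<bullet> snd h - ys \<bullet> fst h = beta (xs, xr) h)"
    and \<Psi>: "finite \<Psi>" "\<And>\<psi>. \<psi> \<in> \<Psi> \<Longrightarrow> \<exists>\<mu>. \<psi> \<in> SL_eigenspace P Q R s r \<Lambda> \<mu>"
      "\<And>\<psi>. \<psi> \<in> \<Psi> \<Longrightarrow> sqnorm \<psi> > 0"
      "\<And>\<psi> \<eta>. \<psi> \<in> \<Psi> \<Longrightarrow> \<eta> \<in> \<Psi> \<Longrightarrow> \<psi> \<noteq> \<eta> \<Longrightarrow> (LINT t|M. \<psi> t \<bullet> \<eta> t) = 0"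
    and w: "admissible \<Psi> w gw" "bform w gw w gw < 0"
  obtains m f where "m < 0" "f \<in> SL_eigenspace P Q R s r \<Lambda> m" "sqnorm f > 0"
    "\<forall>\<psi>\<in>\<Psi>. (LINT t|M. f t \<bullet> \<psi> t) = 0"
proof -
  have eig: "\<exists>g. form_dom \<psi> g \<and> (\<exists>\<mu>. \<forall>h k. form_dom h k \<longrightarrow> bform \<psi> g h k = \<mu> * (LINT t|M. \<psi> t \<bullet> h t))"
    if \<psi>: "\<psi> \<in> \<Psi>" for \<psi>
  proof -
    obtain \<mu> where "\<psi> \<in> SL_eigenspace P Q R s r \<Lambda> \<mu>" using \<Psi>(2)[OF \<psi>] by blast
    from eigenfunction_bform[OF char this] show ?thesis by blast
  qed
  have sq: "sq_integrable M \<psi>" if "\<psi> \<in> \<Psi>" for \<psi> using eig[OF that] form_domD(4) by blast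
  obtain m f g where min: "m < 0" "admissible \<Psi> f g" "sqnorm f > 0"
    "\<forall>h k. admissible \<Psi> h k \<longrightarrow> bform f g h k = m * (LINT t|M. f t \<bullet> h t)"
    using minimiser_exists[OF sq w] by blast
  have fd: "form_dom f g" and orth: "\<And>\<psi>. \<psi> \<in> \<Psi> \<Longrightarrow> (LINT t|M. f t \<bullet> \<psi> t) = 0"
    using min(2) by (auto simp: admissible_def)
  have "bform f g h k = m * (LINT t|M. f t \<bullet> h t)" if hk: "form_dom h k" for h k
  proof -
    text \<open>Subtracting the projection onto \<open>\<Psi>\<close> changes neither side.\<close>
    have "\<exists>h' k'. form_dom h' k' \<and> bform f g h' k' = bform f g h k \<and>
        (LINT t|M. f t \<bullet> h' t) = (LINT t|M. f t \<bullet> h t) \<and> (\<forall>\<eta>\<in>T. (LINT t|M. h' t \<bullet> \<eta> t) = 0)"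
      if "finite T" "T \<subseteq> \<Psi>" for T
      using that
    proof (induction T rule: finite_induct)
      case empty
      then show ?case using hk by blast
    next
      case (insert \<psi> T)
      then obtain h' k' where h': "form_dom h' k'" "bform f g h' k' = bform f g h k"
        "(LINT t|M. f t \<bullet> h' t) = (LINT t|M. f t \<bullet> h t)" "\<And>\<eta>. \<eta> \<in> T \<Longrightarrow> (LINT t|M. h' t \<bullet> \<eta> t) = 0"
        by auto
      have \<psi>: "\<psi> \<in> \<Psi>" using insert by simp
      obtain l \<mu> where l: "form_dom \<psi> l" "\<And>h k. form_dom h k \<Longrightarrow> bform \<psi> l h k = \<mu> * (LINT t|M. \<psi> t \<bullet> h t)"
        using eig[OF \<psi>] by blast
      define a where "a = - (LINT t|M. h' t \<bullet> \<psi> t) / sqnorm \<psi>"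
      have "bform f g \<psi> l = 0"
        using bform_sym[OF fd l(1)] l(2)[OF fd] orth[OF \<psi>] by (simp add: inner_commute)
      then have "bform f g (\<lambda>t. h' t + a *\<^sub>R \<psi> t) (\<lambda>t. k' t + a *\<^sub>R l t) = bform f g h k"
        using bform_comb_right[OF fd h'(1) l(1), of a] h'(2) by simp
      moreover have "(LINT t|M. f t \<bullet> (h' t + a *\<^sub>R \<psi> t)) = (LINT t|M. f t \<bullet> h t)"
        using form_domD(4)[OF fd] form_domD(4)[OF h'(1)] sq[OF \<psi>] h'(3) orth[OF \<psi>]
        by (simp add: inner_add_right integrable_inner)
      moreover have "(LINT t|M. (h' t + a *\<^sub>R \<psi> t) \<bullet> \<eta> t) = 0" if "\<eta> \<in> insert \<psi> T" for \<eta>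
      proof -
        have \<eta>: "\<eta> \<in> \<Psi>" using that insert by auto
        have "(LINT t|M. (h' t + a *\<^sub>R \<psi> t) \<bullet> \<eta> t) = (LINT t|M. h' t \<bullet> \<eta> t) + a * (LINT t|M. \<psi> t \<bullet> \<eta> t)"
          using form_domD(4)[OF h'(1)] sq[OF \<psi>] sq[OF \<eta>] by (simp add: inner_add_left integrable_inner)
        also have "\<dots> = 0"
        proof (cases "\<eta> = \<psi>")
          case True
          then show ?thesis using \<Psi>(3)[OF \<psi>] by (simp add: a_def)
        next
          case False
          then show ?thesis using that h'(4) \<Psi>(4)[OF \<psi> \<eta>] by auto
        qed
        finally show ?thesis .
      qed
      ultimately show ?case using form_dom_comb[OF h'(1) l(1), of a] by blast
    qed
    from this[OF \<Psi>(1) order_refl] obtain h' k' where h': "form_dom h' k'" "bform f g h' k' = bform f g h k"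
        "(LINT t|M. f t \<bullet> h' t) = (LINT t|M. f t \<bullet> h t)" "\<forall>\<eta>\<in>\<Psi>. (LINT t|M. h' t \<bullet> \<eta> t) = 0" by blast
    then have "admissible \<Psi> h' k'" by (simp add: admissible_def)
    then show ?thesis using min(4) h'(2,3) by simp
  qed
  from bform_imp_eigenfunction[OF char fd this] have "f \<in> SL_eigenspace P Q R s r \<Lambda> m" .
  moreover have "\<forall>\<psi>\<in>\<Psi>. (LINT t|M. f t \<bullet> \<psi> t) = 0" using orth by blast
  ultimately show thesis using that min(1,3) by blast
qed

lemma eigenfunction_sq_integrable:
  assumes "f \<in> SL_eigenspace P Q R s r \<Lambda> \<mu>"
  shows "sq_integrable M f"
proof -
  obtain g y y' where "SL_solution P Q R s r \<mu> f g y y'"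
    using assms unfolding SL_eigenspace_iff[OF less] by blast
  then show ?thesis by (rule has_weak_deriv_sq_integrable_fun[OF SL_solutionD(1)])
qed

text \<open>Orthogonality is complex on purpose: a function and its multiple by \<open>\<i>\<close>
  are orthogonal for the real inner product, yet dependent over the complex numbers.\<close>

definition negative_family where
  "negative_family \<Lambda> \<Phi> \<longleftrightarrow> finite \<Phi> \<and> cfun.independent \<Phi> \<and>
    (\<forall>\<phi>\<in>\<Phi>. \<exists>\<mu><0. \<phi> \<in> SL_eigenspace P Q R s r \<Lambda> \<mu>) \<and> (\<forall>\<phi>\<in>\<Phi>. sqnorm \<phi> > 0) \<and>
    (\<forall>\<phi>\<in>\<Phi>. \<forall>\<eta>\<in>\<Phi>. \<phi> \<noteq> \<eta> \<longrightarrow> cip M \<phi> \<eta> = 0)"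

lemma negative_familyD:
  assumes "negative_family \<Lambda> \<Phi>"
  shows "finite \<Phi>" "cfun.independent \<Phi>"
    "\<phi> \<in> \<Phi> \<Longrightarrow> \<exists>\<mu><0. \<phi> \<in> SL_eigenspace P Q R s r \<Lambda> \<mu>" "\<phi> \<in> \<Phi> \<Longrightarrow> sqnorm \<phi> > 0"
    "\<phi> \<in> \<Phi> \<Longrightarrow> \<eta> \<in> \<Phi> \<Longrightarrow> \<phi> \<noteq> \<eta> \<Longrightarrow> cip M \<phi> \<eta> = 0"
proof -
  note c1 = assms[unfolded negative_family_def]
  note c2 = conjunct2[OF c1] note c3 = conjunct2[OF c2] note c4 = conjunct2[OF c3]
  show "finite \<Phi>" by (rule conjunct1[OF c1])
  show "cfun.independent \<Phi>" by (rule conjunct1[OF c2])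
  show "\<phi> \<in> \<Phi> \<Longrightarrow> \<exists>\<mu><0. \<phi> \<in> SL_eigenspace P Q R s r \<Lambda> \<mu>" by (rule bspec[OF conjunct1[OF c3]])
  show "\<phi> \<in> \<Phi> \<Longrightarrow> sqnorm \<phi> > 0" by (rule bspec[OF conjunct1[OF c4]])
  show "\<phi> \<in> \<Phi> \<Longrightarrow> \<eta> \<in> \<Phi> \<Longrightarrow> \<phi> \<noteq> \<eta> \<Longrightarrow> cip M \<phi> \<eta> = 0" using conjunct2[OF c4] by simp
qed

text \<open>In \<open>neg\<close> the trial functions vanish at both ends, so \<open>beta\<close>
  does not contribute and negativity of the index form is negativity of
  \<open>bform\<close>.\<close>

lemma negative_eigenfunctions:
  assumes char: "\<And>ys xs yr xr. bdry ys xs yr xr \<in> \<Lambda> \<longleftrightarrow> (xs, xr) \<in> V \<and>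
       (\<forall>h\<in>V. yr \<bullet> snd h - ys \<bullet> fst h = beta (xs, xr) h)" and L: "vec.subspace \<Lambda>"
    and neg: "\<And>\<Phi>. finite \<Phi> \<Longrightarrow> card \<Phi> < N \<Longrightarrow> \<forall>\<phi>\<in>\<Phi>. sq_integrable M \<phi> \<Longrightarrow>
      \<exists>w gw. has_weak_deriv s r w gw \<and> (\<forall>t. t \<notin> {s..r} \<longrightarrow> w t = 0) \<and> w s = 0 \<and> w r = 0 \<and>
        Iform w gw w gw < 0 \<and> (\<forall>\<phi>\<in>\<Phi>. cip M w \<phi> = 0)"
  shows "n \<le> N \<Longrightarrow> \<exists>\<Phi>. negative_family \<Lambda> \<Phi> \<and> card \<Phi> = n"
proof (induction n)
  case 0
  have "negative_family \<Lambda> {}" unfolding negative_family_def by (simp only: cfun.independent_empty finite.emptyI) simp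
  then show ?case by (intro exI[of _ "{}"] conjI card.empty)
next
  case (Suc n)
  then obtain \<Phi> where fam: "negative_family \<Lambda> \<Phi>" and card: "card \<Phi> = n" by (meson Suc_leD)
  note \<Phi> = negative_familyD[OF fam]
  have sq: "sq_integrable M \<phi>" if "\<phi> \<in> \<Phi>" for \<phi> using \<Phi>(3)[OF that] by (auto intro: eigenfunction_sq_integrable)
  obtain w gw where w: "has_weak_deriv s r w gw" "\<forall>t. t \<notin> {s..r} \<longrightarrow> w t = 0" "w s = 0" "w r = 0"
    "Iform w gw w gw < 0" "\<forall>\<phi>\<in>\<Phi>. cip M w \<phi> = 0"
  proof -
    have "card \<Phi> < N" using card Suc.prems by simp
    moreover have "\<forall>\<phi>\<in>\<Phi>. sq_integrable M \<phi>" using sq by blast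
    ultimately show thesis using neg[OF \<Phi>(1)] that by meson
  qed
  \<comment> \<open>Real orthogonality to \<Psi> is complex orthogonality to \<Phi>. The added
    functions are eigenfunctions as well, the eigenspaces being complex subspaces.\<close>
  define \<Psi> where "\<Psi> = \<Phi> \<union> (\<lambda>\<phi> t. \<i> *s \<phi> t) ` \<Phi>"
  have tr: "trace w = 0" using w by (simp add: trace_def zero_prod_def)
  have "form_dom w gw" using w tr subspace_0[OF subV] by (simp add: form_dom_def)
  then have adm: "admissible \<Psi> w gw" using w(6) by (auto simp: admissible_def \<Psi>_def cip_eq_0_iff)
  have bneg: "bform w gw w gw < 0" using w(5) by (simp add: bform_def beta_def tr)
  have orth: "(LINT t|M. \<psi> t \<bullet> \<eta> t) = 0" if \<psi>\<eta>: "\<psi> \<in> \<Psi>" "\<eta> \<in> \<Psi>" "\<psi> \<noteq> \<eta>" for \<psi> \<eta>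
  proof -
    obtain \<phi>1 \<phi>2 where p: "\<phi>1 \<in> \<Phi>" "\<phi>2 \<in> \<Phi>" "\<psi> = \<phi>1 \<or> \<psi> = (\<lambda>t. \<i> *s \<phi>1 t)" "\<eta> = \<phi>2 \<or> \<eta> = (\<lambda>t. \<i> *s \<phi>2 t)"
      using \<psi>\<eta>(1,2) unfolding \<Psi>_def by blast
    show ?thesis
    proof (cases "\<phi>1 = \<phi>2")
      case True
      then show ?thesis using p(3,4) \<psi>\<eta>(3) by (auto simp: inner_ii)
    next
      case False
      from \<Phi>(5)[OF p(1,2) False] show ?thesis using p(3,4) by (auto simp: cip_eq_0_iff inner_ii)
    qed
  qed
  obtain m f where f: "m < 0" "f \<in> SL_eigenspace P Q R s r \<Lambda> m" "sqnorm f > 0"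
    "\<forall>\<psi>\<in>\<Psi>. (LINT t|M. f t \<bullet> \<psi> t) = 0"
  proof (rule next_eigenfunction[OF char _ _ _ orth adm bneg])
    show "finite \<Psi>" using \<Phi>(1) by (simp add: \<Psi>_def)
    show "\<exists>\<mu>. \<psi> \<in> SL_eigenspace P Q R s r \<Lambda> \<mu>" if "\<psi> \<in> \<Psi>" for \<psi>
      using that \<Phi>(3) cfun.subspace_scale[OF SL_eigenspace_subspace[OF less L]] unfolding \<Psi>_def by blast
    show "sqnorm \<psi> > 0" if "\<psi> \<in> \<Psi>" for \<psi>
      using that \<Phi>(4) unfolding \<Psi>_def by (auto simp: inner_ii)
  qed (use that in blast)
  have sqf: "sq_integrable M f" using f(2) by (rule eigenfunction_sq_integrable)
  have fc: "cip M f \<phi> = 0" if "\<phi> \<in> \<Phi>" for \<phi>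
    using f(4) that by (auto simp: cip_eq_0_iff \<Psi>_def)
  have fc': "cip M \<phi> f = 0" if "\<phi> \<in> \<Phi>" for \<phi>
    using fc[OF that] inner_ii(1)[of "f _" "\<phi> _"] by (simp add: cip_eq_0_iff inner_commute)
  have "f \<notin> cfun.span \<Phi>"
  proof
    assume "f \<in> cfun.span \<Phi>"
    then obtain u where u: "f = (\<Sum>\<phi>\<in>\<Phi>. (\<lambda>t. u \<phi> *s \<phi> t))" using cfun.span_finite[OF \<Phi>(1)] by blast
    have "f = (\<lambda>t. \<Sum>\<phi>\<in>\<Phi>. u \<phi> *s \<phi> t)" by (rule ext, subst u, rule cfun_sum_apply)
    then have "cip M f f = cip M (\<lambda>t. \<Sum>\<phi>\<in>\<Phi>. u \<phi> *s \<phi> t) f"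
      by (rule arg_cong[where f = "\<lambda>h. cip M h f"])
    also have "\<dots> = (\<Sum>\<phi>\<in>\<Phi>. u \<phi> * cip M \<phi> f)" by (rule cip_sum_left[OF sq sqf])
    also have "\<dots> = 0" using fc' by simp
    finally show False using f(3) by (simp add: cip_eq_0_iff)
  qed
  then have ind: "cfun.independent (insert f \<Phi>)" and "f \<notin> \<Phi>"
    using cfun.independent_insertI[OF _ \<Phi>(2)] cfun.span_base[of f \<Phi>] by metis+
  have "negative_family \<Lambda> (insert f \<Phi>)"
    unfolding negative_family_def
  proof (intro conjI ballI impI)
    show "finite (insert f \<Phi>)" using \<Phi>(1) by simp
    show "\<exists>\<mu><0. \<phi> \<in> SL_eigenspace P Q R s r \<Lambda> \<mu>" if "\<phi> \<in> insert f \<Phi>" for \<phi>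
      using that f(1,2) \<Phi>(3) by blast
    show "sqnorm \<phi> > 0" if "\<phi> \<in> insert f \<Phi>" for \<phi> using that f(3) \<Phi>(4) by blast
    show "cip M \<phi> \<eta> = 0" if "\<phi> \<in> insert f \<Phi>" "\<eta> \<in> insert f \<Phi>" "\<phi> \<noteq> \<eta>" for \<phi> \<eta>
      using that fc fc' \<Phi>(5) by blast
  qed (rule ind)
  moreover have "card (insert f \<Phi>) = Suc n" using \<Phi>(1) card \<open>f \<notin> \<Phi>\<close> by simp
  ultimately show ?case by blast
qed

end

section \<open>Counting\<close>

lemma sum_enat: "(\<Sum>x\<in>F. enat (f x)) = enat (\<Sum>x\<in>F. f x)"
  by (induction F rule: infinite_finite_induct) (simp_all add: zero_enat_def)

text \<open>The sum is the supremum of its finite partial sums. Strict inequality for the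
  predecessor of \<open>k\<close> selects one of them, also when the sum is infinite.\<close>

lemma enat_le_infsum_imp_finite:
  fixes f :: "'a \<Rightarrow> nat"
  assumes "enat k \<le> (\<Sum>\<^sub>\<infinity>x\<in>A. enat (f x))"
  shows "\<exists>F. finite F \<and> F \<subseteq> A \<and> k \<le> (\<Sum>x\<in>F. f x)"
proof (cases k)
  case 0
  then show ?thesis by (intro exI[of _ "{}"]) simp
next
  case (Suc j)
  have "enat j < (\<Sum>\<^sub>\<infinity>x\<in>A. enat (f x))" using assms Suc by (simp add: Suc_ile_eq)
  also have "(\<Sum>\<^sub>\<infinity>x\<in>A. enat (f x)) = (SUP F\<in>{F. finite F \<and> F \<subseteq> A}. \<Sum>x\<in>F. enat (f x))"
    by (rule nonneg_infsum_complete) simp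
  finally obtain F where F: "finite F" "F \<subseteq> A" "enat j < (\<Sum>x\<in>F. enat (f x))"
    by (auto simp: less_SUP_iff)
  then have "k \<le> (\<Sum>x\<in>F. f x)" using Suc by (simp add: sum_enat)
  then show ?thesis using F(1,2) by blast
qed

lemma sum_le_infsum_enat:
  fixes f :: "'a \<Rightarrow> nat"
  assumes "finite F" "F \<subseteq> A"
  shows "enat (\<Sum>x\<in>F. f x) \<le> (\<Sum>\<^sub>\<infinity>x\<in>A. enat (f x))"
proof -
  have "enat (\<Sum>x\<in>F. f x) = (\<Sum>x\<in>F. enat (f x))" by (rule sum_enat[symmetric])
  also have "\<dots> \<le> (SUP F\<in>{F. finite F \<and> F \<subseteq> A}. \<Sum>x\<in>F. enat (f x))"
    using assms by (intro SUP_upper) auto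
  also have "\<dots> = (\<Sum>\<^sub>\<infinity>x\<in>A. enat (f x))"
    by (rule nonneg_infsum_complete[symmetric]) simp
  finally show ?thesis .
qed

text \<open>Finite lower bounds suffice. If \<open>X\<close> is a finite \<open>N\<close>, no
  summand is infinite, for then \<open>Suc N\<close> would be an admissible lower bound and exceed
  \<open>X\<close>.\<close>

lemma enat_add3_leI:
  fixes x y z X :: enat
  assumes "\<And>i j k. enat i \<le> x \<Longrightarrow> enat j \<le> y \<Longrightarrow> enat k \<le> z \<Longrightarrow> enat (i + j + k) \<le> X"
  shows "x + y + z \<le> X"
proof (cases X)
  case (enat N)
  obtain i where "x = enat i" using assms[of "Suc N" 0 0] enat by (cases x) (auto simp flip: zero_enat_def)
  moreover obtain j where "y = enat j" using assms[of 0 "Suc N" 0] enat by (cases y) (auto simp flip: zero_enat_def)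
  moreover obtain k where "z = enat k" using assms[of 0 0 "Suc N"] enat by (cases z) (auto simp flip: zero_enat_def)
  ultimately show ?thesis using assms[of i j k] by simp
qed simp

section \<open>Negative eigenfunctions on the subintervals\<close>

lemma Lambda_D_subspace: "vec.subspace Lambda_D"
proof (rule vec.subspaceI)
  show "0 \<in> Lambda_D" by (simp add: bdry_in_Lambda_D flip: bdry_zero)
next
  fix u v :: "complex ^ (('a + 'a) + ('a + 'a))" assume "u \<in> Lambda_D" "v \<in> Lambda_D"
  then show "u + v \<in> Lambda_D"
    by (cases u rule: bdry_cases; cases v rule: bdry_cases) (simp add: bdry_add bdry_in_Lambda_D)
next
  fix c and u :: "complex ^ (('a + 'a) + ('a + 'a))" assume "u \<in> Lambda_D"
  then show "c *s u \<in> Lambda_D"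
    by (cases u rule: bdry_cases) (simp add: bdry_scale bdry_in_Lambda_D)
qed

lemma Lambda_D_isotropic: "\<forall>u\<in>Lambda_D. \<forall>v\<in>Lambda_D. omega2 u v = 0"
proof (intro ballI)
  fix u v :: "complex ^ (('n::finite + 'n) + ('n + 'n))" assume "u \<in> Lambda_D" "v \<in> Lambda_D"
  then show "omega2 u v = 0"
    by (cases u rule: bdry_cases; cases v rule: bdry_cases)
      (simp add: bdry_in_Lambda_D omega2_bdry hinner_simps)
qed

text \<open>All that the gluing needs to know about one subinterval, in a form that also makes sense
  on a degenerate one. The last clause makes the energy definite in the coefficients, so it contains
  the linear independence of the combinations that vanish at both ends.\<close>

definition negative_span where
  "negative_span P Q R s r \<Lambda> X \<longleftrightarrow>
    (\<forall>x\<in>X. sq_integrable (lebesgue_on {s..r}) (snd x) \<and> (\<forall>t. t \<notin> {s..r} \<longrightarrow> snd x t = 0) \<and>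
      (\<exists>ys yr. bdry ys (snd x s) yr (snd x r) \<in> \<Lambda>)) \<and>
    (\<forall>c W. W = (\<lambda>t. \<Sum>x\<in>X. c x *s snd x t) \<longrightarrow> W s = 0 \<longrightarrow> W r = 0 \<longrightarrow>
      (\<exists>g. has_weak_deriv s r W g \<and> energy P Q R s r W g \<le> 0 \<and>
        (energy P Q R s r W g = 0 \<longrightarrow> (\<forall>x\<in>X. c x = 0))))"

lemma negative_spanD:
  assumes "negative_span P Q R s r \<Lambda> X"
  shows "x \<in> X \<Longrightarrow> sq_integrable (lebesgue_on {s..r}) (snd x)" "x \<in> X \<Longrightarrow> t \<notin> {s..r} \<Longrightarrow> snd x t = 0"
    "x \<in> X \<Longrightarrow> \<exists>ys yr. bdry ys (snd x s) yr (snd x r) \<in> \<Lambda>"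
    "W = (\<lambda>t. \<Sum>x\<in>X. c x *s snd x t) \<Longrightarrow> W s = 0 \<Longrightarrow> W r = 0 \<Longrightarrow>
      \<exists>g. has_weak_deriv s r W g \<and> energy P Q R s r W g \<le> 0 \<and>
        (energy P Q R s r W g = 0 \<longrightarrow> (\<forall>x\<in>X. c x = 0))"
  using assms unfolding negative_span_def by simp_all

text \<open>The pairs in \<open>X\<close> consist of a negative eigenvalue and an element of a basis of its eigenspace.\<close>

lemma morse_index_basis:
  fixes P Q R :: "real \<Rightarrow> real ^ 'n ^ 'n"
  assumes sys: "s < r \<longrightarrow> SL_system P Q R s r" and L: "vec.subspace \<Lambda>"
    and isotropic: "\<forall>u\<in>\<Lambda>. \<forall>v\<in>\<Lambda>. omega2 u v = 0"
    and k: "enat k \<le> morse_index P Q R s r \<Lambda>"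
  shows "\<exists>X :: (real \<times> (real \<Rightarrow> complex ^ 'n)) set. finite X \<and> k \<le> card X \<and> negative_span P Q R s r \<Lambda> X"
proof (cases "s < r")
  case False
  then have "k = 0" using k by (simp add: morse_index_def zero_enat_def)
  have "negative_span P Q R s r \<Lambda> ({} :: (real \<times> (real \<Rightarrow> complex ^ 'n)) set)"
    unfolding negative_span_def
    by (auto simp: Idens_zero intro!: exI[of _ "\<lambda>t. 0"] has_weak_deriv_zero)
  then show ?thesis using \<open>k = 0\<close> by (intro exI[of _ "{}"]) simp
next
  case True
  interpret SL_system P Q R s r by (rule mp[OF sys True])
  have iso: "\<And>u v. u \<in> \<Lambda> \<Longrightarrow> v \<in> \<Lambda> \<Longrightarrow> omega2 u v = 0" using isotropic by blast
  let ?E = "SL_eigenspace P Q R s r \<Lambda>"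
  have "enat k \<le> (\<Sum>\<^sub>\<infinity>\<mu>\<in>{\<mu>. \<mu> < 0 \<and> SL_eigenvalue P Q R s r \<Lambda> \<mu>}. enat (cfun.dim (?E \<mu>)))"
    using k True by (simp add: morse_index_def)
  from enat_le_infsum_imp_finite[OF this]
  obtain F where F: "finite F" "F \<subseteq> {\<mu>. \<mu> < 0 \<and> SL_eigenvalue P Q R s r \<Lambda> \<mu>}"
    "k \<le> (\<Sum>\<mu>\<in>F. cfun.dim (?E \<mu>))" by (elim exE conjE)
  \<comment> \<open>A dimension 0 might be the default for an infinite basis, and then the empty set
    serves; a positive cardinality implies finiteness.\<close>
  have "\<exists>B. B \<subseteq> ?E \<mu> \<and> cfun.independent B \<and> finite B \<and> card B = cfun.dim (?E \<mu>)" for \<mu>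
  proof (cases "cfun.dim (?E \<mu>) = 0")
    case True
    show ?thesis
      by (intro exI[of _ "{}"] conjI cfun.independent_empty empty_subsetI finite.emptyI) (simp add: True)
  next
    case False
    obtain B where B: "B \<subseteq> ?E \<mu>" "cfun.independent B" "?E \<mu> \<subseteq> cfun.span B" "card B = cfun.dim (?E \<mu>)"
      using cfun.basis_exists .
    have "finite B" using False B(4) by (intro card_ge_0_finite) simp
    then show ?thesis using B(1,2,4) by (intro exI[of _ B] conjI)
  qed
  then have "\<exists>B. \<forall>\<mu>. B \<mu> \<subseteq> ?E \<mu> \<and> cfun.independent (B \<mu>) \<and> finite (B \<mu>) \<and> card (B \<mu>) = cfun.dim (?E \<mu>)"
    by (intro choice allI)
  then obtain B where B': "\<forall>\<mu>. B \<mu> \<subseteq> ?E \<mu> \<and> cfun.independent (B \<mu>) \<and> finite (B \<mu>) \<and> card (B \<mu>) = cfun.dim (?E \<mu>)"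
    by (elim exE)
  note b1 = spec[OF B'] note b2 = conjunct2[OF b1] note b3 = conjunct2[OF b2]
  note B = conjunct1[OF b1] conjunct1[OF b2] conjunct1[OF b3] conjunct2[OF b3]
  \<comment> \<open>Tagging with the eigenvalue makes the union disjoint, so that the dimensions add
    up without a separate proof that eigenspaces are independent.\<close>
  define X where "X = Sigma F B"
  have sol: "\<exists>g y y'. SL_solution P Q R s r (fst x) (snd x) g y y' \<and> bdry (y s) (snd x s) (y r) (snd x r) \<in> \<Lambda>"
    if "x \<in> X" for x
  proof -
    have "snd x \<in> B (fst x)" using that by (auto simp: X_def)
    then have "snd x \<in> ?E (fst x)" by (rule subsetD[OF B(1)])
    then show ?thesis unfolding SL_eigenspace_iff[OF True] .
  qed
  have comb: "\<exists>g. has_weak_deriv s r (\<lambda>t. \<Sum>x\<in>X. c x *s snd x t) g \<and>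
      Iform (\<lambda>t. \<Sum>x\<in>X. c x *s snd x t) g (\<lambda>t. \<Sum>x\<in>X. c x *s snd x t) g \<le> 0 \<and>
      (Iform (\<lambda>t. \<Sum>x\<in>X. c x *s snd x t) g (\<lambda>t. \<Sum>x\<in>X. c x *s snd x t) g = 0 \<longrightarrow> (\<forall>x\<in>X. c x = 0))"
    if bd: "(\<Sum>x\<in>X. c x *s snd x s) = 0" "(\<Sum>x\<in>X. c x *s snd x r) = 0" for c
  proof -
    define w where "w = (\<lambda>\<mu>. \<Sum>b\<in>B \<mu>. (\<lambda>t. c (\<mu>, b) *s b t))"
    have W: "(\<Sum>x\<in>X. c x *s snd x t) = (\<Sum>\<mu>\<in>F. w \<mu> t)" for t
    proof -
      have "(\<Sum>\<mu>\<in>F. w \<mu> t) = (\<Sum>\<mu>\<in>F. \<Sum>b\<in>B \<mu>. c (\<mu>, b) *s b t)" by (simp add: w_def cfun_sum_apply)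
      also have "\<dots> = (\<Sum>x\<in>X. c x *s snd x t)"
        unfolding X_def using F(1) B(3) by (subst sum.Sigma) (auto simp: case_prod_unfold)
      finally show ?thesis ..
    qed
    have wE: "\<mu> < 0 \<and> w \<mu> \<in> ?E \<mu>" if "\<mu> \<in> F" for \<mu>
    proof
      show "\<mu> < 0" using F(2) that by blast
      show "w \<mu> \<in> ?E \<mu>" unfolding w_def
        by (intro cfun.subspace_sum[OF SL_eigenspace_subspace[OF True L]]
            cfun.subspace_scale[OF SL_eigenspace_subspace[OF True L]] subsetD[OF B(1)])
    qed
    have "c x = 0" if x: "x \<in> X" and w0: "\<forall>\<mu>\<in>F. w \<mu> = 0" for x
    proof -
      obtain \<mu> b where xb: "x = (\<mu>, b)" "\<mu> \<in> F" "b \<in> B \<mu>" using x by (auto simp: X_def)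
      have "(\<Sum>b\<in>B \<mu>. (\<lambda>t. c (\<mu>, b) *s b t)) = 0" using w0 xb(2) by (simp add: w_def)
      from cfun.independentD[OF B(2) B(3) order_refl this xb(3)] show ?thesis by (simp add: xb(1))
    qed
    then have c0: "\<forall>\<mu>\<in>F. w \<mu> = 0 \<Longrightarrow> \<forall>x\<in>X. c x = 0" by simp
    from bd have bd': "(\<Sum>\<mu>\<in>F. w \<mu> s) = 0" "(\<Sum>\<mu>\<in>F. w \<mu> r) = 0" unfolding W .
    show ?thesis
      unfolding W
    proof (rule negative_combination[OF iso F(1) wE bd'])
      fix g
      assume g: "has_weak_deriv s r (\<lambda>t. \<Sum>\<mu>\<in>F. w \<mu> t) g"
        "Iform (\<lambda>t. \<Sum>\<mu>\<in>F. w \<mu> t) g (\<lambda>t. \<Sum>\<mu>\<in>F. w \<mu> t) g \<le> 0"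
        "Iform (\<lambda>t. \<Sum>\<mu>\<in>F. w \<mu> t) g (\<lambda>t. \<Sum>\<mu>\<in>F. w \<mu> t) g = 0 \<Longrightarrow> \<forall>\<mu>\<in>F. w \<mu> = 0"
      show "\<exists>g. has_weak_deriv s r (\<lambda>t. \<Sum>\<mu>\<in>F. w \<mu> t) g \<and>
        Iform (\<lambda>t. \<Sum>\<mu>\<in>F. w \<mu> t) g (\<lambda>t. \<Sum>\<mu>\<in>F. w \<mu> t) g \<le> 0 \<and>
        (Iform (\<lambda>t. \<Sum>\<mu>\<in>F. w \<mu> t) g (\<lambda>t. \<Sum>\<mu>\<in>F. w \<mu> t) g = 0 \<longrightarrow> (\<forall>x\<in>X. c x = 0))"
        by (intro exI[of _ g] conjI impI g(1,2) c0 g(3))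
    qed
  qed
  have "negative_span P Q R s r \<Lambda> X"
    unfolding negative_span_def
  proof (intro conjI ballI allI impI)
    fix x assume "x \<in> X"
    then obtain g y y' where x: "SL_solution P Q R s r (fst x) (snd x) g y y'"
      "bdry (y s) (snd x s) (y r) (snd x r) \<in> \<Lambda>" using sol by meson
    show "sq_integrable M (snd x)" by (rule has_weak_deriv_sq_integrable_fun[OF SL_solutionD(1)[OF x(1)]])
    show "snd x t = 0" if "t \<notin> {s..r}" for t using SL_solutionD(3)[OF x(1) that] .
    show "\<exists>ys yr. bdry ys (snd x s) yr (snd x r) \<in> \<Lambda>" using x(2) by (intro exI)
  next
    fix c W assume "W = (\<lambda>t. \<Sum>x\<in>X. c x *s snd x t)" "W s = 0" "W r = 0"
    then show "\<exists>g. has_weak_deriv s r W g \<and> energy P Q R s r W g \<le> 0 \<and>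
        (energy P Q R s r W g = 0 \<longrightarrow> (\<forall>x\<in>X. c x = 0))"
      using comb[of c] by (simp add: Iform_def)
  qed
  moreover have "finite X" using F(1) B(3) by (auto simp: X_def)
  moreover have "k \<le> card X" using F(1,3) B(3,4) by (simp add: X_def)
  ultimately show ?thesis by (intro exI[of _ X] conjI)
qed

text \<open>The family is sorted by eigenvalue, and each class is an independent subset of one
  eigenspace. Only finitely many eigenvalues occur, so a finite partial sum of the index is already
  large enough.\<close>

lemma (in SL_boundary) negative_family_le_morse_index:
  assumes "negative_family \<Lambda> \<Phi>" and L: "vec.subspace \<Lambda>"
  shows "enat (card \<Phi>) \<le> morse_index P Q R s r \<Lambda>"
proof -
  note \<Phi> = negative_familyD[OF assms(1)]
  let ?E = "SL_eigenspace P Q R s r \<Lambda>"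
  obtain \<mu> where \<mu>: "\<And>\<phi>. \<phi> \<in> \<Phi> \<Longrightarrow> \<mu> \<phi> < 0" "\<And>\<phi>. \<phi> \<in> \<Phi> \<Longrightarrow> \<phi> \<in> ?E (\<mu> \<phi>)"
    using \<Phi>(3) by metis
  have "card \<Phi> = (\<Sum>\<nu>\<in>\<mu> ` \<Phi>. card {\<phi> \<in> \<Phi>. \<mu> \<phi> = \<nu>})"
    using sum.image_gen[OF \<Phi>(1), of "\<lambda>_. 1 :: nat" \<mu>] by simp
  also have "\<dots> \<le> (\<Sum>\<nu>\<in>\<mu> ` \<Phi>. cfun.dim (?E \<nu>))"
  proof (rule sum_mono)
    fix \<nu>
    have "cfun.independent {\<phi> \<in> \<Phi>. \<mu> \<phi> = \<nu>}" by (rule cfun.independent_mono[OF \<Phi>(2)]) auto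
    then show "card {\<phi> \<in> \<Phi>. \<mu> \<phi> = \<nu>} \<le> cfun.dim (?E \<nu>)"
      by (rule eigenspace_independent_card_le_dim[OF L]) (use \<mu>(2) in auto)
  qed
  finally have "enat (card \<Phi>) \<le> enat (\<Sum>\<nu>\<in>\<mu> ` \<Phi>. cfun.dim (?E \<nu>))" by simp
  also have "\<dots> \<le> (\<Sum>\<^sub>\<infinity>\<nu>\<in>{\<nu>. \<nu> < 0 \<and> SL_eigenvalue P Q R s r \<Lambda> \<nu>}. enat (cfun.dim (?E \<nu>)))"
  proof (rule sum_le_infsum_enat)
    show "\<mu> ` \<Phi> \<subseteq> {\<nu>. \<nu> < 0 \<and> SL_eigenvalue P Q R s r \<Lambda> \<nu>}"
    proof
      fix \<nu> assume "\<nu> \<in> \<mu> ` \<Phi>"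
      then obtain \<phi> where \<phi>: "\<phi> \<in> \<Phi>" "\<nu> = \<mu> \<phi>" by blast
      have "\<phi> \<noteq> 0" using \<Phi>(4)[OF \<phi>(1)] by auto
      then show "\<nu> \<in> {\<nu>. \<nu> < 0 \<and> SL_eigenvalue P Q R s r \<Lambda> \<nu>}"
        using \<mu>[OF \<phi>(1)] \<phi>(2) unfolding SL_eigenvalue_def by blast
    qed
  qed (use \<Phi>(1) in simp)
  also have "\<dots> = morse_index P Q R s r \<Lambda>" using less by (simp add: morse_index_def)
  finally show ?thesis .
qed

text \<open>The term \<open>nu\<close> is added on the larger side, since subtraction in
  \<open>enat\<close> would truncate and an index could be infinite.\<close>

theorem corollary1p3:
  fixes P Q R :: "real \<Rightarrow> real ^ 'n ^ 'n"
    and a b c d :: real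
    and \<Lambda>\<^sub>0 :: "(complex ^ (('n + 'n) + ('n + 'n))) set"
  assumes "continuous_on {a..b} P" and "continuous_on {a..b} Q" and "continuous_on {a..b} R"
    and "\<And>t. t \<in> {a..b} \<Longrightarrow> transpose (P t) = P t"
    and "\<And>t v. t \<in> {a..b} \<Longrightarrow> v \<noteq> 0 \<Longrightarrow> v \<bullet> (P t *v v) > 0"
    and "\<And>t. t \<in> {a..b} \<Longrightarrow> transpose (R t) = R t"
    and "a \<le> c" and "c < d" and "d \<le> b"
    and "lagrangian \<Lambda>\<^sub>0"
  shows "morse_index P Q R a b \<Lambda>\<^sub>0 + enat (nu \<Lambda>\<^sub>0) \<ge>
           morse_index P Q R c d \<Lambda>\<^sub>0 + morse_index P Q R a c Lambda_D + morse_index P Q R d b Lambda_D"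
proof (rule enat_add3_leI)
  fix k1 k2 k3
  assume k1: "enat k1 \<le> morse_index P Q R c d \<Lambda>\<^sub>0" and k2: "enat k2 \<le> morse_index P Q R a c Lambda_D"
    and k3: "enat k3 \<le> morse_index P Q R d b Lambda_D"
  have sys: "SL_system P Q R u v" if "a \<le> u" "u < v" "v \<le> b" for u v
  proof
    have "{u..v} \<subseteq> {a..b}" using that by auto
    then show "continuous_on {u..v} P" "continuous_on {u..v} Q" "continuous_on {u..v} R"
      using assms(1-3) continuous_on_subset by blast+
  qed (use that assms(4-6) in auto)
  have L: "vec.subspace \<Lambda>\<^sub>0" and iso: "\<forall>u\<in>\<Lambda>\<^sub>0. \<forall>v\<in>\<Lambda>\<^sub>0. omega2 u v = 0"
    using assms(10) by (simp_all add: lagrangian_def)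
  have sys1: "c < d \<longrightarrow> SL_system P Q R c d" and sys2: "a < c \<longrightarrow> SL_system P Q R a c"
    and sys3: "d < b \<longrightarrow> SL_system P Q R d b"
    using sys assms(7-9) by simp_all
  have ab: "a < b" using assms(7-9) by linarith
  obtain V :: "((complex ^ 'n) \<times> (complex ^ 'n)) set" and Ys Yr :: "(complex ^ 'n) \<times> (complex ^ 'n) \<Rightarrow> complex ^ 'n"
    where V: "subspace V" "linear Ys" "linear Yr"
    "\<forall>x\<in>V. \<forall>h\<in>V. Yr x \<bullet> snd h - Ys x \<bullet> fst h = Yr h \<bullet> snd x - Ys h \<bullet> fst x"
    "\<forall>ys xs yr xr. bdry ys xs yr xr \<in> \<Lambda>\<^sub>0 \<longleftrightarrow> (xs, xr) \<in> V \<and>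
       (\<forall>h\<in>V. yr \<bullet> snd h - ys \<bullet> fst h = Yr (xs, xr) \<bullet> snd h - Ys (xs, xr) \<bullet> fst h)"
    using lagrangian_boundary[OF assms(10)] .
  interpret SL_system P Q R a b using sys ab by simp
  interpret SL_boundary P Q R a b V Ys Yr
    by (intro SL_boundary.intro SL_boundary_axioms.intro SL_system_axioms V(1-3) V(4)[rule_format])
  have char: "bdry ys xs yr xr \<in> \<Lambda>\<^sub>0 \<longleftrightarrow> (xs, xr) \<in> V \<and> (\<forall>h\<in>V. yr \<bullet> snd h - ys \<bullet> fst h = beta (xs, xr) h)"
    for ys xs yr xr unfolding beta_def by (rule V(5)[rule_format])
  obtain X1 :: "(real \<times> (real \<Rightarrow> complex ^ 'n)) set"
    where X1: "finite X1" "k1 \<le> card X1" and neg1: "negative_span P Q R c d \<Lambda>\<^sub>0 X1"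
    using morse_index_basis[OF sys1 L iso k1] by (elim exE conjE)
  obtain X2 :: "(real \<times> (real \<Rightarrow> complex ^ 'n)) set"
    where X2: "finite X2" "k2 \<le> card X2" and neg2: "negative_span P Q R a c Lambda_D X2"
    using morse_index_basis[OF sys2 Lambda_D_subspace Lambda_D_isotropic k2] by (elim exE conjE)
  obtain X3 :: "(real \<times> (real \<Rightarrow> complex ^ 'n)) set"
    where X3: "finite X3" "k3 \<le> card X3" and neg3: "negative_span P Q R d b Lambda_D X3"
    using morse_index_basis[OF sys3 Lambda_D_subspace Lambda_D_isotropic k3] by (elim exE conjE)
  \<comment> \<open>the truncated subtraction is harmless: only \<open>k1 + k2 + k3 \<le> N + nu \<Lambda>\<^sub>0\<close> is used in the end\<close>
  define N where "N = k1 + k2 + k3 - nu \<Lambda>\<^sub>0"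
  define X where "X = X1 <+> (X2 <+> X3)"
  let ?snd = "snd :: real \<times> (real \<Rightarrow> complex ^ 'n) \<Rightarrow> real \<Rightarrow> complex ^ 'n"
  define fv where "fv = case_sum ?snd (case_sum ?snd ?snd)"
  \<comment> \<open>Records the endpoint values that have to cancel. The Dirichlet pieces vanish at
    their ends already and receive 0.\<close>
  define v :: "_ \<Rightarrow> complex ^ (('n + 'n) + ('n + 'n))"
    where "v = case_sum (\<lambda>x. bdry 0 (?snd x c) 0 (?snd x d)) (\<lambda>_ :: (real \<times> (real \<Rightarrow> complex ^ 'n)) + (real \<times> (real \<Rightarrow> complex ^ 'n)). 0)"
  have finX: "finite X" and cardX: "k1 + k2 + k3 \<le> card X"
    using X1(1,2) X2(1,2) X3(1,2) by (auto simp: X_def card_Plus)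
  have vS: "v x \<in> (\<Lambda>\<^sub>0 + Lambda_D) \<inter> Lambda_N" if "x \<in> X" for x
  proof (cases x)
    case (Inl y)
    then have "y \<in> X1" using that by (auto simp: X_def)
    then obtain ys yr where "bdry ys (snd y c) yr (snd y d) \<in> \<Lambda>\<^sub>0" using negative_spanD(3)[OF neg1] by meson
    from bdry_in_nu_space[OF this] show ?thesis using Inl by (simp add: v_def)
  next
    case (Inr y)
    have "bdry 0 0 0 0 \<in> \<Lambda>\<^sub>0" using vec.subspace_0[OF L] by (simp add: bdry_zero)
    from bdry_in_nu_space[OF this] show ?thesis using Inr by (simp add: v_def bdry_zero)
  qed
  have ext: "sq_integrable M (snd y)" if "negative_span P Q R u v \<Lambda> Y" "y \<in> Y" "a \<le> u" "v \<le> b"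
    for u v \<Lambda> Y and y :: "real \<times> (real \<Rightarrow> complex ^ 'n)"
    by (rule sq_integrable_extend[OF negative_spanD(1)[OF that(1,2)] _ negative_spanD(2)[OF that(1,2)]])
      (use that(3,4) in auto)
  have fv_sq: "sq_integrable M (fv x)" if "x \<in> X" for x
    using that ext[OF neg1] ext[OF neg2] ext[OF neg3] assms(7-9) by (auto simp: X_def fv_def)
  have neg: "\<exists>w gw. has_weak_deriv a b w gw \<and> (\<forall>t. t \<notin> {a..b} \<longrightarrow> w t = 0) \<and> w a = 0 \<and> w b = 0 \<and>
        Iform w gw w gw < 0 \<and> (\<forall>\<phi>\<in>\<Phi>. cip M w \<phi> = 0)"
    if \<Phi>: "finite \<Phi>" "card \<Phi> < N" "\<forall>\<phi>\<in>\<Phi>. sq_integrable M \<phi>" for \<Phi>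
  proof -
    \<comment> \<open>More unknown coefficients than conditions: \<open>nu\<close> for the endpoint
      values at \<open>c\<close> and \<open>d\<close>, and one complex equation for each member of
      \<Phi>.\<close>
    have "vec.dim ((\<Lambda>\<^sub>0 + Lambda_D) \<inter> Lambda_N) + card \<Phi> < card X"
      using \<Phi>(2) cardX unfolding N_def nu_def by linarith
    then have "\<exists>f. (\<exists>x\<in>X. f x \<noteq> 0) \<and> (\<Sum>x\<in>X. f x *s v x) = 0 \<and>
        (\<forall>\<phi>\<in>\<Phi>. (\<Sum>x\<in>X. f x * cip M (fv x) \<phi>) = 0)"
      by (rule nontrivial_kernel_vec[OF \<Phi>(1) finX]) (rule vS)
    then obtain f where f: "\<exists>x\<in>X. f x \<noteq> 0" "(\<Sum>x\<in>X. f x *s v x) = 0"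
      "\<forall>\<phi>\<in>\<Phi>. (\<Sum>x\<in>X. f x * cip M (fv x) \<phi>) = 0" by blast
    define W1 where "W1 = (\<lambda>t. \<Sum>x\<in>X1. f (Inl x) *s snd x t)"
    define W2 where "W2 = (\<lambda>t. \<Sum>x\<in>X2. f (Inr (Inl x)) *s snd x t)"
    define W3 where "W3 = (\<lambda>t. \<Sum>x\<in>X3. f (Inr (Inr x)) *s snd x t)"
    have W: "(\<Sum>x\<in>X. f x *s fv x t) = W1 t + W2 t + W3 t" for t
      using X1(1) X2(1) X3(1) by (simp add: X_def sum.Plus fv_def W1_def W2_def W3_def add.assoc)
    have "(\<Sum>x\<in>X1. f (Inl x) *s bdry 0 (snd x c) 0 (snd x d)) = 0"
      using f(2) X1(1) X2(1) X3(1) by (simp add: X_def sum.Plus v_def)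
    moreover have "(\<Sum>x\<in>X1. f (Inl x) *s bdry 0 (snd x c) 0 (snd x d)) = bdry 0 (W1 c) 0 (W1 d)"
      unfolding W1_def using X1(1)
      by (induction X1 rule: finite_induct) (simp_all add: bdry_zero bdry_scale bdry_add)
    ultimately have W1bd: "W1 c = 0" "W1 d = 0" by (simp_all add: bdry_eq_iff flip: bdry_zero)
    have W2bd: "W2 a = 0" "W2 c = 0" and W3bd: "W3 d = 0" "W3 b = 0"
      using negative_spanD(3)[OF neg2] negative_spanD(3)[OF neg3]
      by (auto simp: W2_def W3_def bdry_in_Lambda_D intro!: sum.neutral)
    obtain g1 where g1: "has_weak_deriv c d W1 g1"
      "energy P Q R c d W1 g1 \<le> 0"
      "energy P Q R c d W1 g1 = 0 \<longrightarrow> (\<forall>x\<in>X1. f (Inl x) = 0)"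
      using negative_spanD(4)[OF neg1 W1_def W1bd] by blast
    obtain g2 where g2: "has_weak_deriv a c W2 g2"
      "energy P Q R a c W2 g2 \<le> 0"
      "energy P Q R a c W2 g2 = 0 \<longrightarrow> (\<forall>x\<in>X2. f (Inr (Inl x)) = 0)"
      using negative_spanD(4)[OF neg2 W2_def W2bd] by blast
    obtain g3 where g3: "has_weak_deriv d b W3 g3"
      "energy P Q R d b W3 g3 \<le> 0"
      "energy P Q R d b W3 g3 = 0 \<longrightarrow> (\<forall>x\<in>X3. f (Inr (Inr x)) = 0)"
      using negative_spanD(4)[OF neg3 W3_def W3bd] by blast
    have out1: "W1 t = 0" if "t \<notin> {c..d}" for t
      unfolding W1_def by (rule sum.neutral) (simp add: negative_spanD(2)[OF neg1 _ that])
    have out2: "W2 t = 0" if "t \<notin> {a..c}" for t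
      unfolding W2_def by (rule sum.neutral) (simp add: negative_spanD(2)[OF neg2 _ that])
    have out3: "W3 t = 0" if "t \<notin> {d..b}" for t
      unfolding W3_def by (rule sum.neutral) (simp add: negative_spanD(2)[OF neg3 _ that])
    obtain G where G: "has_weak_deriv a b (\<lambda>t. W2 t + W1 t + W3 t) G"
      "Iform (\<lambda>t. W2 t + W1 t + W3 t) G (\<lambda>t. W2 t + W1 t + W3 t) G =
      energy P Q R a c W2 g2 +
      energy P Q R c d W1 g1 +
      energy P Q R d b W3 g3"
      by (rule glue_three[OF assms(7) less_imp_le[OF assms(8)] assms(9) g2(1) g1(1) g3(1) out2 out1 out3
            W2bd W1bd W3bd]) blast
    define w where "w = (\<lambda>t. W2 t + W1 t + W3 t)"
    have w: "w = (\<lambda>t. \<Sum>x\<in>X. f x *s fv x t)" unfolding w_def W by (simp add: add_ac)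
    \<comment> \<open>None of the three energies is positive, so a vanishing sum makes each of them
      zero and with it every coefficient, against the choice of \<open>f\<close>.\<close>
    have "Iform w G w G \<noteq> 0"
    proof
      assume "Iform w G w G = 0"
      then have "\<forall>x\<in>X1. f (Inl x) = 0" "\<forall>x\<in>X2. f (Inr (Inl x)) = 0" "\<forall>x\<in>X3. f (Inr (Inr x)) = 0"
        using G(2) g1(2,3) g2(2,3) g3(2,3) unfolding w_def by linarith+
      then show False using f(1) by (auto simp: X_def)
    qed
    moreover have "Iform w G w G \<le> 0" using G(2) g1(2) g2(2) g3(2) unfolding w_def by linarith
    ultimately have "Iform w G w G < 0" by simp
    moreover have "cip M w \<phi> = 0" if "\<phi> \<in> \<Phi>" for \<phi>
    proof -
      have "cip M (\<lambda>t. \<Sum>x\<in>X. f x *s fv x t) \<phi> = (\<Sum>x\<in>X. f x * cip M (fv x) \<phi>)"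
        using \<Phi>(3) that by (intro cip_sum_left fv_sq) auto
      then show ?thesis using f(3) that by (simp add: w)
    qed
    moreover have "w t = 0" if "t \<notin> {a..b}" for t
    proof -
      have "t \<notin> {c..d}" "t \<notin> {a..c}" "t \<notin> {d..b}" using that assms(7-9) by auto
      then show ?thesis using out1 out2 out3 by (simp add: w_def)
    qed
    \<comment> \<open>If \<open>a = c\<close>, the inner piece \<open>W1\<close> vanishes at
      \<open>a\<close> not because of its support but because its values at \<open>c\<close> were
      made to cancel. The same happens at \<open>b\<close> when \<open>d = b\<close>.\<close>
    moreover have "w a = 0"
      using out1[of a] out3[of a] W1bd W2bd assms(7-9) by (cases "a = c") (auto simp: w_def)
    moreover have "w b = 0"
      using out1[of b] out2[of b] W1bd W3bd assms(7-9) by (cases "d = b") (auto simp: w_def)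
    ultimately show ?thesis using G(1) unfolding w_def by blast
  qed
  obtain \<Phi> where \<Phi>: "negative_family \<Lambda>\<^sub>0 \<Phi>" "card \<Phi> = N"
    using negative_eigenfunctions[OF char L neg order_refl] by blast
  have "k1 + k2 + k3 \<le> N + nu \<Lambda>\<^sub>0" by (simp add: N_def)
  then have "enat (k1 + k2 + k3) \<le> enat N + enat (nu \<Lambda>\<^sub>0)" by simp
  also have "\<dots> \<le> morse_index P Q R a b \<Lambda>\<^sub>0 + enat (nu \<Lambda>\<^sub>0)"
    using negative_family_le_morse_index[OF \<Phi>(1) L] \<Phi>(2) by (intro add_right_mono) simp
  finally show "enat (k1 + k2 + k3) \<le> morse_index P Q R a b \<Lambda>\<^sub>0 + enat (nu \<Lambda>\<^sub>0)" .
qed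

end
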